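(* Let $L=(\vec L,[-,-],h_2)$ be an injective hemistrict Lie 2-algebra (i.e. $d:L^{-1}\to L^0$ is injective) and let $V=(\vec V,l,r,h_v)$ be a representation of $L$ such that $l_\alpha=0$ for all $\alpha\in L^{-1}$. (1) Assume that the alternator satisfies $h_2(d\alpha,d\beta)=0$ for all $\alpha,\beta\in L^{-1}$. Then the cohomology of the representation $V$ of $L$ is isomorphic to the Chevalley-Eilenberg cohomology of the Lie algebra $L_{\mathrm{Lie}}$ with coefficients in $V$: $$H^\bullet(L,V)\cong H^\bullet_{\mathrm{CE}}(L_{\mathrm{Lie}},V).$$ (2) The cohomology of the semistrict Lie 2-algebra $\tilde L$ obtained from $L$ by skew-symmetrization is isomorphic to the Chevalley-Eilenberg cohomology of $L_{\mathrm{Lie}}$: $$H^\bullet(\tilde L,V)\cong H^\bullet_{\mathrm{CE}}(L_{\mathrm{Lie}},V).$$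
   Context: All vector spaces are over $\mathbb K=\mathbb R$ or $\mathbb C$. A 2-term cochain complex $\vec L=(L^{-1}\xrightarrow{d}L^0)$ sits in degrees $-1,0$; $|x|$ is the degree of $x$. **Hemistrict Lie 2-algebra** $L=(\vec L,[-,-],h_2)$: a 2-term complex $\vec L$, a degree-$0$ bilinear bracket on $L^\bullet=L^{-1}\oplus L^0$ (zero on $L^{-1}\times L^{-1}$) with $d[x,y]=[dx,y]+(-1)^{|x|}[x,dy]$ and $[x,[y,z]]=[[x,y],z]+(-1)^{|x||y|}[y,[x,z]]$, and a symmetric bilinear map $h_2:L^0\times L^0\to L^{-1}$ (alternator) such that $[x,y]+[y,x]=dh_2(x,y)$, $[x,\alpha]+[\alpha,x]=h_2(x,d\alpha)$, $[h_2(x,y),z]=0$, $[x,h_2(y,z)]=h_2([x,y],z)+h_2(y,[x,z])$ for $x,y,z\in L^0$, $\alpha\in L^{-1}$. **Representation** $V=(\vec V,l,r,h_v)$ of $L$ on a 2-term complex $\vec V=(V^{-1}\xrightarrow{d}V^0)$: cochain maps $l:L^i\otimes V^j\to V^{i+j}$, $r:V^j\otimes L^i\to V^{i+j}$ ($V^{-2}=0$) and a bilinear map $h_v:L^0\times V^0\to V^{-1}$. Write $l_xv=l(x,v)$, $r_xv=(-1)^{|x||v|}r(v,x)$. Required: $l_{[x_1,x_2]}=l_{x_1}l_{x_2}-(-1)^{|x_1||x_2|}l_{x_2}l_{x_1}$ for $x_i\in L^\bullet$; $l(x,v)+r(v,x)$ equals $dh_v(x,v)$ if $x\in L^0,v\in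 V^0$, equals $h_v(dx,v)$ if $x\in L^{-1},v\in V^0$, and equals $h_v(x,dv)$ if $x\in L^0,v\in V^{-1}$; and for $x_1,x_2\in L^0,v\in V^0$: $r_{x_2}h_v(x_1,v)=0$, $l_{h_2(x_1,x_2)}v=0$, $l_{x_1}h_v(x_2,v)=h_v([x_1,x_2],v)+h_v(x_2,l_{x_1}v)$. **$H^\bullet(L,V)$** (for $l_\alpha=0$ for all $\alpha\in L^{-1}$; the general definition of $D$ contains one further term, linear in the $l_{\alpha_j}$, which vanishes here). For $n\ge -1$, $C^n(L,V)$ is the space of families $\omega=(\omega^{(p)}_k)$, $p\in\{-1,0\}$, $0\le k\le\lfloor\frac{n-p}{2}\rfloor$, of linear maps $\omega_k^{(p)}:(L^0)^{\otimes(n-p-2k)}\otimes S^k(L^{-1})\to V^p$ ($S^k$ the ordinary symmetric power) with the weak symmetry property $$\omega_k^{(p)}(\cdots,x_i,x_{i+1},\cdots\mid\cdots)+\omega_k^{(p)}(\cdots,x_{i+1},x_i,\cdots\mid\cdots)=-\omega_{k+1}^{(p)}(\cdots,\widehat{x_i},\widehat{x_{i+1}},\cdots\mid h_2(x_i,x_{i+1}),\cdots)$$ for $1\le i\le n-p-2k-1$. The differential $D:C^n(L,V)\to C^{n+1}(L,V)$ is, with $m=n+1-p-2k$, $$(D\omega)_k^{(p)}(x_1,\dots,x_m\mid\alpha_1,\dots,\alpha_k)=\sum_{j}\omega^{(p)}_{k-1}(d\alpha_j,x_1,\dots,x_m\mid\cdots\widehat{\alpha_j}\cdots)+\epsilon_p(-1)^{n+1}d\,\omega_k^{(-1)}(x_1,\dots,x_m\mid\alpha_1,\dots,\alpha_k)$$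 $$+\sum_i(-1)^{i-1}l_{x_i}\omega_k^{(p)}(\cdots\widehat{x_i}\cdots\mid\alpha_1,\dots,\alpha_k)+\sum_{i<j}(-1)^i\omega_k^{(p)}(\cdots,\widehat{x_i},\cdots,\widehat{x_j},[x_i,x_j],\cdots\mid\alpha_1,\dots,\alpha_k)+\sum_{i}\sum_{j}(-1)^{i+1}\omega_k^{(p)}(\cdots\widehat{x_i}\cdots\mid\cdots,[\alpha_j,x_i],\cdots),$$ where $\epsilon_0=1$, $\epsilon_{-1}=0$, and $[x_i,x_j]$ (resp. $[\alpha_j,x_i]$) takes the place of $x_j$ (resp. $\alpha_j$). $H^\bullet(L,V)$ is the cohomology of $(C^\bullet(L,V),D)$. **$L_{\mathrm{Lie}}$ and $H_{\mathrm{CE}}$.** For $L$ injective, $L_{\mathrm{Lie}}=L^0/dL^{-1}$ with bracket induced by $[-,-]$; it is a Lie algebra. Since $l_\alpha=0$ for $\alpha\in L^{-1}$, $l$ induces an action of $L_{\mathrm{Lie}}$ on the complex $\vec V$. $H^\bullet_{\mathrm{CE}}(L_{\mathrm{Lie}},V)$ is the cohomology of the total complex with degree-$n$ part $\bigoplus_{p+r=n}\mathrm{Hom}(\wedge^pL_{\mathrm{Lie}},V^r)$ ($p\ge0$, $r\in\{-1,0\}$) and differential $d_V+d_{\mathrm{CE}}$, where $d_V\eta=(-1)^{n+1}d\circ\eta$ on total degree $n$ and $d_{\mathrm{CE}}$ is the Chevalley-Eilenberg differential. **$\tilde L$ and $H^\bullet(\tilde L,V)$.** $\tilde L=(\vec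 L,\tilde l_2,\tilde l_3)$ with $\tilde l_2(x,y)=\frac12([x,y]-(-1)^{|x||y|}[y,x])$ for $x,y\in L^\bullet$ and $\tilde l_3(x,y,z)=-\frac16\big(h_2(\tilde l_2(x,y),z)+h_2(\tilde l_2(y,z),x)+h_2(\tilde l_2(z,x),y)\big)$ for $x,y,z\in L^0$. As $l_\alpha=0$ for $\alpha\in L^{-1}$, $l$ gives a representation of $\tilde L$ on $\vec V$. $H^\bullet(\tilde L,V)$ is the cohomology of the complex $A$ with $A^n=\bigoplus_{p+2q+r=n}\mathrm{Hom}(\wedge^pL^0\otimes S^q(L^{-1}),V^r)$ ($p,q\ge0$, $r\in\{-1,0\}$) and differential, for $\eta\in A^n$ with components $\eta_q^{(r)}$ and $m=n+1-r-2q$, $$(D_A\eta)^{(r)}_q(x_1,\dots,x_m\mid\alpha_1,\dots,\alpha_q)=\epsilon_r(-1)^{n+1}d\,\eta_q^{(-1)}(x_1,\dots,x_m\mid\alpha_1,\dots,\alpha_q)+\sum_j\eta_{q-1}^{(r)}(d\alpha_j,x_1,\dots,x_m\mid\cdots\widehat{\alpha_j}\cdots)$$ $$+\sum_i(-1)^{i-1}l_{x_i}\eta_q^{(r)}(\cdots\widehat{x_i}\cdots\mid\cdots)+\sum_{i<j}(-1)^{i+j}\eta_q^{(r)}(\tilde l_2(x_i,x_j),\cdots\widehat{x_i}\cdots\widehat{x_j}\cdots\mid\cdots)+\sum_{i,j}(-1)^{i+1}\eta_q^{(r)}(\cdots\widehat{x_i}\cdots\mid\cdots,\tilde l_2(\alpha_j,x_i),\cdots)$$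 $$+\sum_{i<j<k}(-1)^{i+j+k}\eta_{q+1}^{(r)}(\cdots\widehat{x_i}\cdots\widehat{x_j}\cdots\widehat{x_k}\cdots\mid\tilde l_3(x_i,x_j,x_k),\alpha_1,\dots,\alpha_q).$$ *)

theory Defs
  imports
    Complex_Main
    "HOL-Library.Multiset"
    "HOL-Library.Set_Algebras"
    "HOL-Library.Function_Algebras"
    "HOL-Library.Product_Plus"
begin

section \<open>Linear maps, quotients, cohomology\<close>

text \<open>
  The ground field \<open>\<real>\<close> or \<open>\<complex>\<close> is rendered by the class \<^class>\<open>real_normed_field\<close>: by Gelfand-Mazur
  its instances are, up to isomorphism, exactly these two.

  Vector spaces that are whole types are given by \<^locale>\<open>vector_space\<close>.  Quotients of subspaces
  are sets of cosets: coset addition is the Minkowski sum of HOL-Library.Set_Algebras, whereas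
  scalar multiplication needs the extra summand \<open>B\<close>, since \<open>0 \<cdot> (x + B)\<close> has to be \<open>B\<close> and not
  \<open>{0}\<close>.
\<close>

definition lin_on ::
    "'x::plus set \<Rightarrow> ('k \<Rightarrow> 'x \<Rightarrow> 'x) \<Rightarrow> ('k \<Rightarrow> 'y::plus \<Rightarrow> 'y) \<Rightarrow> ('x \<Rightarrow> 'y) \<Rightarrow> bool"
  where "lin_on S s t f \<longleftrightarrow>
    (\<forall>x\<in>S. \<forall>y\<in>S. f (x + y) = f x + f y) \<and> (\<forall>c. \<forall>x\<in>S. f (s c x) = t c (f x))"

definition multilinear_on ::
    "'x::plus set \<Rightarrow> ('k \<Rightarrow> 'x \<Rightarrow> 'x) \<Rightarrow> ('k \<Rightarrow> 'y::plus \<Rightarrow> 'y) \<Rightarrow> ('x list \<Rightarrow> 'y) \<Rightarrow> bool"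
  where "multilinear_on S s t f \<longleftrightarrow>
    (\<forall>xs i. set xs \<subseteq> S \<and> i < length xs \<longrightarrow> lin_on S s t (\<lambda>y. f (xs[i := y])))"

definition alternating :: "('x list \<Rightarrow> 'y::zero) \<Rightarrow> bool"
  where "alternating f \<longleftrightarrow> (\<forall>xs. \<not> distinct xs \<longrightarrow> f xs = 0)"

definition bilin ::
    "('k::field \<Rightarrow> 'x::ab_group_add \<Rightarrow> 'x) \<Rightarrow> ('k \<Rightarrow> 'y::ab_group_add \<Rightarrow> 'y) \<Rightarrow>
     ('k \<Rightarrow> 'z::ab_group_add \<Rightarrow> 'z) \<Rightarrow> ('x \<Rightarrow> 'y \<Rightarrow> 'z) \<Rightarrow> bool"
  where "bilin s t u f \<longleftrightarrow>
    (\<forall>x. Vector_Spaces.linear t u (f x)) \<and> (\<forall>y. Vector_Spaces.linear s u (\<lambda>x. f x y))"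

definition quot :: "'x::plus set \<Rightarrow> 'x set \<Rightarrow> 'x set set"
  where "quot Z B = (\<lambda>z. z +o B) ` Z"

definition quot_smul :: "('k \<Rightarrow> 'x \<Rightarrow> 'x) \<Rightarrow> 'x::plus set \<Rightarrow> 'k \<Rightarrow> 'x set \<Rightarrow> 'x set"
  where "quot_smul s B c X = s c ` X + B"

text \<open>
  A complex is given by the subspaces \<open>C n\<close> of an ambient space and maps \<open>D n\<close> of the ambient
  space that restrict to \<open>C n \<rightarrow> C (n + 1)\<close>.
\<close>

definition cocycles :: "(int \<Rightarrow> 'x::zero set) \<Rightarrow> (int \<Rightarrow> 'x \<Rightarrow> 'x) \<Rightarrow> int \<Rightarrow> 'x set"
  where "cocycles C D n = {x \<in> C n. D n x = 0}"

definition coboundaries :: "(int \<Rightarrow> 'x set) \<Rightarrow> (int \<Rightarrow> 'x \<Rightarrow> 'x) \<Rightarrow> int \<Rightarrow> 'x set"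
  where "coboundaries C D n = D (n - 1) ` C (n - 1)"

definition cohomology ::
    "(int \<Rightarrow> 'x::{plus,zero} set) \<Rightarrow> (int \<Rightarrow> 'x \<Rightarrow> 'x) \<Rightarrow> int \<Rightarrow> 'x set set"
  where "cohomology C D n = quot (cocycles C D n) (coboundaries C D n)"

definition cohomology_isomorphic ::
    "('k \<Rightarrow> 'x::{plus,zero} \<Rightarrow> 'x) \<Rightarrow> (int \<Rightarrow> 'x set) \<Rightarrow> (int \<Rightarrow> 'x \<Rightarrow> 'x) \<Rightarrow>
     ('k \<Rightarrow> 'y::{plus,zero} \<Rightarrow> 'y) \<Rightarrow> (int \<Rightarrow> 'y set) \<Rightarrow> (int \<Rightarrow> 'y \<Rightarrow> 'y) \<Rightarrow> bool"
  where "cohomology_isomorphic s C D s' C' D' \<longleftrightarrow>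
    (\<forall>n. \<exists>f. bij_betw f (cohomology C D n) (cohomology C' D' n) \<and>
      lin_on (cohomology C D n)
        (quot_smul s (coboundaries C D n)) (quot_smul s' (coboundaries C' D' n)) f)"


section \<open>Hemistrict Lie 2-algebras and their representations\<close>

text \<open>
  The suffixes \<open>m\<close> and \<open>0\<close> stand for the degrees \<open>-1\<close> and \<open>0\<close>, in the order of the arguments:
  \<open>br_m0\<close> is the bracket on \<open>L\<^sup>-\<^sup>1 \<times> L\<^sup>0\<close>.  Components whose value lies in degree \<open>-2\<close> are zero and
  have no field.  In the axioms each graded identity is written out for all those degrees of the
  arguments in which it is not of the form \<open>0 = 0\<close>.
\<close>

record ('k, 'm, 'z) two_term =
  smul_m :: "'k \<Rightarrow> 'm \<Rightarrow> 'm"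
  smul_0 :: "'k \<Rightarrow> 'z \<Rightarrow> 'z"
  dif    :: "'m \<Rightarrow> 'z"

record ('k, 'm, 'z) lie2 = "('k, 'm, 'z) two_term" +
  br_00 :: "'z \<Rightarrow> 'z \<Rightarrow> 'z"
  br_0m :: "'z \<Rightarrow> 'm \<Rightarrow> 'm"
  br_m0 :: "'m \<Rightarrow> 'z \<Rightarrow> 'm"
  alt   :: "'z \<Rightarrow> 'z \<Rightarrow> 'm"

record ('k, 'm, 'z, 'a, 'b) lie2_rep = "('k, 'a, 'b) two_term" +
  l_00 :: "'z \<Rightarrow> 'b \<Rightarrow> 'b"
  l_0m :: "'z \<Rightarrow> 'a \<Rightarrow> 'a"
  l_m0 :: "'m \<Rightarrow> 'b \<Rightarrow> 'a"
  r_00 :: "'b \<Rightarrow> 'z \<Rightarrow> 'b"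
  r_0m :: "'b \<Rightarrow> 'm \<Rightarrow> 'a"
  r_m0 :: "'a \<Rightarrow> 'z \<Rightarrow> 'a"
  hv   :: "'z \<Rightarrow> 'b \<Rightarrow> 'a"

locale two_term_complex =
  fixes C :: "('k::field, 'm::ab_group_add, 'z::ab_group_add, 'more) two_term_scheme"
  assumes vs_m: "vector_space (smul_m C)"
    and vs_0: "vector_space (smul_0 C)"
    and dif_linear: "Vector_Spaces.linear (smul_m C) (smul_0 C) (dif C)"

locale hemistrict_lie2 = two_term_complex L
  for L :: "('k::field, 'm::ab_group_add, 'z::ab_group_add) lie2" +
  assumes br_00_bilin: "bilin (smul_0 L) (smul_0 L) (smul_0 L) (br_00 L)"
    and br_0m_bilin: "bilin (smul_0 L) (smul_m L) (smul_m L) (br_0m L)"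
    and br_m0_bilin: "bilin (smul_m L) (smul_0 L) (smul_m L) (br_m0 L)"
    and alt_bilin: "bilin (smul_0 L) (smul_0 L) (smul_m L) (alt L)"
    and dif_br_0m: "dif L (br_0m L x \<beta>) = br_00 L x (dif L \<beta>)"
    and dif_br_m0: "dif L (br_m0 L \<alpha> y) = br_00 L (dif L \<alpha>) y"
    and dif_br_mm: "0 = br_0m L (dif L \<alpha>) \<beta> - br_m0 L \<alpha> (dif L \<beta>)"
    and leibniz_000: "br_00 L x (br_00 L y z) = br_00 L (br_00 L x y) z + br_00 L y (br_00 L x z)"
    and leibniz_00m: "br_0m L x (br_0m L y \<gamma>) = br_0m L (br_00 L x y) \<gamma> + br_0m L y (br_0m L x \<gamma>)"
    and leibniz_0m0: "br_0m L x (br_m0 L \<beta> z) = br_m0 L (br_0m L x \<beta>) z + br_m0 L \<beta> (br_00 L x z)"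
    and leibniz_m00: "br_m0 L \<alpha> (br_00 L y z) = br_m0 L (br_m0 L \<alpha> y) z + br_0m L y (br_m0 L \<alpha> z)"
    and alt_sym: "alt L x y = alt L y x"
    and alt_00: "br_00 L x y + br_00 L y x = dif L (alt L x y)"
    and alt_0m: "br_0m L x \<alpha> + br_m0 L \<alpha> x = alt L x (dif L \<alpha>)"
    and br_alt_left: "br_m0 L (alt L x y) z = 0"
    and br_alt_right: "br_0m L x (alt L y z) = alt L (br_00 L x y) z + alt L y (br_00 L x z)"

locale hemistrict_lie2_rep = two_term_complex V
  for L :: "('k::field, 'm::ab_group_add, 'z::ab_group_add) lie2"
    and V :: "('k, 'm, 'z, 'a::ab_group_add, 'b::ab_group_add) lie2_rep" +
  assumes l_00_bilin: "bilin (smul_0 L) (smul_0 V) (smul_0 V) (l_00 V)"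
    and l_0m_bilin: "bilin (smul_0 L) (smul_m V) (smul_m V) (l_0m V)"
    and l_m0_bilin: "bilin (smul_m L) (smul_0 V) (smul_m V) (l_m0 V)"
    and r_00_bilin: "bilin (smul_0 V) (smul_0 L) (smul_0 V) (r_00 V)"
    and r_0m_bilin: "bilin (smul_0 V) (smul_m L) (smul_m V) (r_0m V)"
    and r_m0_bilin: "bilin (smul_m V) (smul_0 L) (smul_m V) (r_m0 V)"
    and hv_bilin: "bilin (smul_0 L) (smul_0 V) (smul_m V) (hv V)"
    \<comment> \<open>\<open>l\<close> and \<open>r\<close> are cochain maps\<close>
    and dif_l_0m: "dif V (l_0m V x w) = l_00 V x (dif V w)"
    and dif_l_m0: "dif V (l_m0 V \<alpha> v) = l_00 V (dif L \<alpha>) v"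
    and dif_l_mm: "0 = l_0m V (dif L \<alpha>) w - l_m0 V \<alpha> (dif V w)"
    and dif_r_m0: "dif V (r_m0 V w x) = r_00 V (dif V w) x"
    and dif_r_0m: "dif V (r_0m V v \<alpha>) = r_00 V v (dif L \<alpha>)"
    and dif_r_mm: "0 = r_0m V (dif V w) \<alpha> - r_m0 V w (dif L \<alpha>)"
    \<comment> \<open>\<open>l\<close> is a left action\<close>
    and l_br_000: "l_00 V (br_00 L x y) v = l_00 V x (l_00 V y v) - l_00 V y (l_00 V x v)"
    and l_br_00m: "l_0m V (br_00 L x y) w = l_0m V x (l_0m V y w) - l_0m V y (l_0m V x w)"
    and l_br_0m0: "l_m0 V (br_0m L x \<beta>) v = l_0m V x (l_m0 V \<beta> v) - l_m0 V \<beta> (l_00 V x v)"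
    and l_br_m00: "l_m0 V (br_m0 L \<alpha> y) v = l_m0 V \<alpha> (l_00 V y v) - l_0m V y (l_m0 V \<alpha> v)"
    \<comment> \<open>\<open>h\<^sub>v\<close> is the alternator\<close>
    and hv_00: "l_00 V x v + r_00 V v x = dif V (hv V x v)"
    and hv_m0: "l_m0 V \<alpha> v + r_0m V v \<alpha> = hv V (dif L \<alpha>) v"
    and hv_0m: "l_0m V x w + r_m0 V w x = hv V x (dif V w)"
    and r_hv: "r_m0 V (hv V x v) y = 0"
    and l_alt: "l_m0 V (alt L x y) v = 0"
    and l_hv: "l_0m V x (hv V y v) = hv V (br_00 L x y) v + hv V y (l_00 V x v)"


section \<open>Cochains\<close>

text \<open>
  A family of linear maps \<open>\<omega>\<^sub>k : (L\<^sup>0)\<^sup>\<otimes>\<^sup>m \<otimes> S\<^sup>k(L\<^sup>-\<^sup>1) \<rightarrow> W\<close>, one for each \<open>m, k \<ge> 0\<close> with \<open>m + 2k = q\<close>,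
  is encoded as one function of two lists, \<open>\<omega> (xs, as)\<close> being
  \<open>\<omega>\<^sub>k(x\<^sub>1, \<dots>, x\<^sub>m | \<alpha>\<^sub>1, \<dots>, \<alpha>\<^sub>k)\<close> for \<open>m = length xs\<close> and \<open>k = length as\<close>; it is zero on lists of other
  lengths.  For \<open>q < 0\<close> only the zero function is left.
\<close>

definition poly_hom ::
    "('k, 'm::plus, 'z::plus, 'more) two_term_scheme \<Rightarrow> ('k \<Rightarrow> 'w \<Rightarrow> 'w) \<Rightarrow> int \<Rightarrow>
     ('z list \<times> 'm list \<Rightarrow> 'w::ab_group_add) set"
  where "poly_hom L t q = {\<omega>.
    (\<forall>xs as. int (length xs) + 2 * int (length as) \<noteq> q \<longrightarrow> \<omega> (xs, as) = 0) \<and>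
    (\<forall>as. multilinear_on UNIV (smul_0 L) t (\<lambda>xs. \<omega> (xs, as))) \<and>
    (\<forall>xs. multilinear_on UNIV (smul_m L) t (\<lambda>as. \<omega> (xs, as))) \<and>
    (\<forall>xs as bs. mset as = mset bs \<longrightarrow> \<omega> (xs, as) = \<omega> (xs, bs))}"

text \<open>
  Cochains are pairs, consisting of the \<open>V\<^sup>-\<^sup>1\<close>-valued and the \<open>V\<^sup>0\<close>-valued part; the following is
  the pointwise scalar multiplication.
\<close>

definition cochain_smul ::
    "('k, 'a, 'b, 'more) two_term_scheme \<Rightarrow> 'k \<Rightarrow> ('x \<Rightarrow> 'a) \<times> ('x \<Rightarrow> 'b) \<Rightarrow> ('x \<Rightarrow> 'a) \<times> ('x \<Rightarrow> 'b)"
  where "cochain_smul V c = (\<lambda>(\<omega>, \<eta>). (\<lambda>u. smul_m V c (\<omega> u), \<lambda>u. smul_0 V c (\<eta> u)))"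

definition omit :: "nat \<Rightarrow> 'x list \<Rightarrow> 'x list"
  where "omit i xs = take i xs @ drop (Suc i) xs"

text \<open>
  List positions start at \<open>0\<close>, so that in the differentials below every sign \<open>(-1)\<^sup>i\<close>, \<open>(-1)\<^sup>i\<^sup>+\<^sup>j\<close>, \<open>\<dots>\<close>
  of the usual formulas changes by \<open>-1\<close> for each of the indices in its exponent.
\<close>

subsection \<open>The complex of a representation\<close>

definition weakly_symmetric ::
    "('z \<Rightarrow> 'z \<Rightarrow> 'm) \<Rightarrow> ('z list \<times> 'm list \<Rightarrow> 'w::ab_group_add) \<Rightarrow> bool"
  where "weakly_symmetric h \<omega> \<longleftrightarrow> (\<forall>us x y vs as.
    \<omega> (us @ x # y # vs, as) + \<omega> (us @ y # x # vs, as) = - \<omega> (us @ vs, h x y # as))"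

definition rep_cochains ::
    "('k, 'm::plus, 'z::plus) lie2 \<Rightarrow> ('k, 'm, 'z, 'a, 'b) lie2_rep \<Rightarrow> int \<Rightarrow>
     (('z list \<times> 'm list \<Rightarrow> 'a::ab_group_add) \<times> ('z list \<times> 'm list \<Rightarrow> 'b::ab_group_add)) set"
  where "rep_cochains L V n = {(\<omega>, \<eta>).
    \<omega> \<in> poly_hom L (smul_m V) (n + 1) \<and> weakly_symmetric (alt L) \<omega> \<and>
    \<eta> \<in> poly_hom L (smul_0 V) n \<and> weakly_symmetric (alt L) \<eta>}"

text \<open>
  The summands of \<open>D\<close> that do not involve the differential of \<open>V\<close>, for coefficients in the space
  with scalar multiplication \<open>t\<close> and action \<open>l\<close>.
\<close>

definition rep_diff_part ::
    "('k::field, 'm, 'z) lie2 \<Rightarrow> ('k \<Rightarrow> 'w \<Rightarrow> 'w) \<Rightarrow> ('z \<Rightarrow> 'w \<Rightarrow> 'w) \<Rightarrow>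
     ('z list \<times> 'm list \<Rightarrow> 'w::ab_group_add) \<Rightarrow> 'z list \<times> 'm list \<Rightarrow> 'w"
  where "rep_diff_part L t l \<omega> = (\<lambda>(xs, as).
      (\<Sum>j<length as. \<omega> (dif L (as ! j) # xs, omit j as))
    + (\<Sum>i<length xs. t ((-1) ^ i) (l (xs ! i) (\<omega> (omit i xs, as))))
    + (\<Sum>j<length xs. \<Sum>i<j.
        t ((-1) ^ (i + 1)) (\<omega> (omit i (xs[j := br_00 L (xs ! i) (xs ! j)]), as)))
    + (\<Sum>i<length xs. \<Sum>j<length as.
        t ((-1) ^ i) (\<omega> (omit i xs, as[j := br_m0 L (as ! j) (xs ! i)]))))"

definition rep_diff ::
    "('k::field, 'm, 'z) lie2 \<Rightarrow> ('k, 'm, 'z, 'a, 'b) lie2_rep \<Rightarrow> int \<Rightarrow>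
     ('z list \<times> 'm list \<Rightarrow> 'a::ab_group_add) \<times> ('z list \<times> 'm list \<Rightarrow> 'b::ab_group_add) \<Rightarrow>
     ('z list \<times> 'm list \<Rightarrow> 'a) \<times> ('z list \<times> 'm list \<Rightarrow> 'b)"
  where "rep_diff L V n = (\<lambda>(\<omega>, \<eta>).
    (rep_diff_part L (smul_m V) (l_0m V) \<omega>,
     \<lambda>u. smul_0 V ((-1) powi (n + 1)) (dif V (\<omega> u)) + rep_diff_part L (smul_0 V) (l_00 V) \<eta> u))"


subsection \<open>The complex of the skew-symmetrization\<close>

definition skew_00 :: "('k::field, 'm, 'z::ab_group_add) lie2 \<Rightarrow> 'z \<Rightarrow> 'z \<Rightarrow> 'z"
  where "skew_00 L x y = smul_0 L (1 / 2) (br_00 L x y - br_00 L y x)"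

definition skew_0m :: "('k::field, 'm::ab_group_add, 'z) lie2 \<Rightarrow> 'z \<Rightarrow> 'm \<Rightarrow> 'm"
  where "skew_0m L x \<alpha> = smul_m L (1 / 2) (br_0m L x \<alpha> - br_m0 L \<alpha> x)"

definition skew_m0 :: "('k::field, 'm::ab_group_add, 'z) lie2 \<Rightarrow> 'm \<Rightarrow> 'z \<Rightarrow> 'm"
  where "skew_m0 L \<alpha> x = smul_m L (1 / 2) (br_m0 L \<alpha> x - br_0m L x \<alpha>)"

definition skew_3 :: "('k::field, 'm::ab_group_add, 'z::ab_group_add) lie2 \<Rightarrow> 'z \<Rightarrow> 'z \<Rightarrow> 'z \<Rightarrow> 'm"
  where "skew_3 L x y z = smul_m L (- (1 / 6))
    (alt L (skew_00 L x y) z + alt L (skew_00 L y z) x + alt L (skew_00 L z x) y)"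

definition skew_cochains ::
    "('k, 'm::plus, 'z::plus) lie2 \<Rightarrow> ('k, 'm, 'z, 'a, 'b) lie2_rep \<Rightarrow> int \<Rightarrow>
     (('z list \<times> 'm list \<Rightarrow> 'a::ab_group_add) \<times> ('z list \<times> 'm list \<Rightarrow> 'b::ab_group_add)) set"
  where "skew_cochains L V n = {(\<omega>, \<eta>).
    \<omega> \<in> poly_hom L (smul_m V) (n + 1) \<and> (\<forall>as. alternating (\<lambda>xs. \<omega> (xs, as))) \<and>
    \<eta> \<in> poly_hom L (smul_0 V) n \<and> (\<forall>as. alternating (\<lambda>xs. \<eta> (xs, as)))}"

definition skew_diff_part ::
    "('k::field, 'm::ab_group_add, 'z::ab_group_add) lie2 \<Rightarrow> ('k \<Rightarrow> 'w \<Rightarrow> 'w) \<Rightarrow> ('z \<Rightarrow> 'w \<Rightarrow> 'w) \<Rightarrow>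
     ('z list \<times> 'm list \<Rightarrow> 'w::ab_group_add) \<Rightarrow> 'z list \<times> 'm list \<Rightarrow> 'w"
  where "skew_diff_part L t l \<omega> = (\<lambda>(xs, as).
      (\<Sum>j<length as. \<omega> (dif L (as ! j) # xs, omit j as))
    + (\<Sum>i<length xs. t ((-1) ^ i) (l (xs ! i) (\<omega> (omit i xs, as))))
    + (\<Sum>j<length xs. \<Sum>i<j.
        t ((-1) ^ (i + j)) (\<omega> (skew_00 L (xs ! i) (xs ! j) # omit i (omit j xs), as)))
    + (\<Sum>i<length xs. \<Sum>j<length as.
        t ((-1) ^ i) (\<omega> (omit i xs, as[j := skew_m0 L (as ! j) (xs ! i)])))
    + (\<Sum>k<length xs. \<Sum>j<k. \<Sum>i<j.
        t ((-1) ^ (i + j + k + 1))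
          (\<omega> (omit i (omit j (omit k xs)), skew_3 L (xs ! i) (xs ! j) (xs ! k) # as))))"

definition skew_diff ::
    "('k::field, 'm::ab_group_add, 'z::ab_group_add) lie2 \<Rightarrow> ('k, 'm, 'z, 'a, 'b) lie2_rep \<Rightarrow> int \<Rightarrow>
     ('z list \<times> 'm list \<Rightarrow> 'a::ab_group_add) \<times> ('z list \<times> 'm list \<Rightarrow> 'b::ab_group_add) \<Rightarrow>
     ('z list \<times> 'm list \<Rightarrow> 'a) \<times> ('z list \<times> 'm list \<Rightarrow> 'b)"
  where "skew_diff L V n = (\<lambda>(\<omega>, \<eta>).
    (skew_diff_part L (smul_m V) (l_0m V) \<omega>,
     \<lambda>u. smul_0 V ((-1) powi (n + 1)) (dif V (\<omega> u)) + skew_diff_part L (smul_0 V) (l_00 V) \<eta> u))"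


subsection \<open>The Chevalley-Eilenberg complex of the Lie algebra \<open>L\<^sup>0 / d L\<^sup>-\<^sup>1\<close>\<close>

definition lie_carrier :: "('k, 'm, 'z::plus) lie2 \<Rightarrow> 'z set set"
  where "lie_carrier L = quot UNIV (range (dif L))"

definition lie_smul :: "('k, 'm, 'z::plus) lie2 \<Rightarrow> 'k \<Rightarrow> 'z set \<Rightarrow> 'z set"
  where "lie_smul L = quot_smul (smul_0 L) (range (dif L))"

text \<open>
  Induced operations on cosets: the members of the union, and of the set below \<^const>\<open>the_elem\<close>,
  do not depend on the representatives.
\<close>

definition lie_bracket :: "('k, 'm, 'z::plus) lie2 \<Rightarrow> 'z set \<Rightarrow> 'z set \<Rightarrow> 'z set"
  where "lie_bracket L X Y = (\<Union>x\<in>X. \<Union>y\<in>Y. br_00 L x y +o range (dif L))"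

definition lie_action :: "('z \<Rightarrow> 'w \<Rightarrow> 'w) \<Rightarrow> 'z set \<Rightarrow> 'w \<Rightarrow> 'w"
  where "lie_action l X w = the_elem ((\<lambda>x. l x w) ` X)"

definition ce_hom ::
    "('k, 'm, 'z::plus) lie2 \<Rightarrow> ('k \<Rightarrow> 'w \<Rightarrow> 'w) \<Rightarrow> int \<Rightarrow> ('z set list \<Rightarrow> 'w::ab_group_add) set"
  where "ce_hom L t q = {f.
    (\<forall>Xs. \<not> (set Xs \<subseteq> lie_carrier L \<and> int (length Xs) = q) \<longrightarrow> f Xs = 0) \<and>
    multilinear_on (lie_carrier L) (lie_smul L) t f \<and> alternating f}"

definition ce_cochains ::
    "('k, 'm, 'z::plus) lie2 \<Rightarrow> ('k, 'm, 'z, 'a, 'b) lie2_rep \<Rightarrow> int \<Rightarrow>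
     (('z set list \<Rightarrow> 'a::ab_group_add) \<times> ('z set list \<Rightarrow> 'b::ab_group_add)) set"
  where "ce_cochains L V n = ce_hom L (smul_m V) (n + 1) \<times> ce_hom L (smul_0 V) n"

definition ce_diff_part ::
    "('k::field, 'm, 'z::plus) lie2 \<Rightarrow> ('k \<Rightarrow> 'w \<Rightarrow> 'w) \<Rightarrow> ('z \<Rightarrow> 'w \<Rightarrow> 'w) \<Rightarrow>
     ('z set list \<Rightarrow> 'w::ab_group_add) \<Rightarrow> 'z set list \<Rightarrow> 'w"
  where "ce_diff_part L t l f Xs = (if set Xs \<subseteq> lie_carrier L then
      (\<Sum>i<length Xs. t ((-1) ^ i) (lie_action l (Xs ! i) (f (omit i Xs))))
    + (\<Sum>j<length Xs. \<Sum>i<j.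
        t ((-1) ^ (i + j)) (f (lie_bracket L (Xs ! i) (Xs ! j) # omit i (omit j Xs))))
    else 0)"

definition ce_diff ::
    "('k::field, 'm, 'z::plus) lie2 \<Rightarrow> ('k, 'm, 'z, 'a, 'b) lie2_rep \<Rightarrow> int \<Rightarrow>
     ('z set list \<Rightarrow> 'a::ab_group_add) \<times> ('z set list \<Rightarrow> 'b::ab_group_add) \<Rightarrow>
     ('z set list \<Rightarrow> 'a) \<times> ('z set list \<Rightarrow> 'b)"
  where "ce_diff L V n = (\<lambda>(f, g).
    (ce_diff_part L (smul_m V) (l_0m V) f,
     \<lambda>Xs. smul_0 V ((-1) powi (n + 1)) (dif V (f Xs)) + ce_diff_part L (smul_0 V) (l_00 V) g Xs))"

end

theory Submission
  imports Defs
begin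

text \<open>
  Write \<open>G = L\<^sup>0 / d L\<^sup>-\<^sup>1\<close>.  Along \<open>L\<^sup>0 \<rightarrow> G\<close> a Chevalley-Eilenberg cochain pulls back to a cochain
  that vanishes as soon as it has an argument from \<open>L\<^sup>-\<^sup>1\<close> or one of its other arguments lies in
  \<open>d L\<^sup>-\<^sup>1\<close>.  Such cochains are called basic.  In both complexes, that of \<open>L\<close> and that of its
  skew-symmetrization, pulling back is an isomorphism of the Chevalley-Eilenberg complex with the
  subcomplex of basic cochains (\<open>basic_imp_pull\<close>, \<open>R_D_pull\<close>, \<open>S_D_pull\<close>).  What has to be shown is
  that the inclusion of this subcomplex induces an isomorphism on cohomology, and for this it suffices
  that every cochain with basic differential is cohomologous to a basic one (\<open>cohomology_iso\<close>).

  \<^bold>\<open>Cartan calculus.\<close>  Let \<open>i\<^sub>x\<close> insert \<open>x\<close> as first argument, and let \<open>L\<^sub>x\<close> be the action of \<open>x\<close> on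
  cochains through \<open>l\<close>, the left brackets \<open>[x,-]\<close> and the Leibniz rule.  On weakly symmetric cochains
  the differential satisfies \<open>i\<^sub>x D + D i\<^sub>x = L\<^sub>x\<close>.  This determines \<open>D\<close> by recursion on the number of
  arguments, and identities such as \<open>D\<^sup>2 = 0\<close> and \<open>L\<^sub>x D = D L\<^sub>x\<close> become short inductions in which no
  position of an argument and no sign occurs.

  \<^bold>\<open>Homotopy.\<close>  Choose a linear left inverse \<open>s\<close> of \<open>d\<close>, and let \<open>h\<close> be the alternating sum of all ways
  to remove an argument \<open>x\<close> and to insert \<open>s x\<close> among the arguments from \<open>L\<^sup>-\<^sup>1\<close>.  Then \<open>N = D h + h D\<close>
  has an explicit form: up to a term that evaluates the cochain on one more argument from \<open>L\<^sup>-\<^sup>1\<close>, it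
  multiplies the value at arguments taken from \<open>d L\<^sup>-\<^sup>1\<close>, \<open>ker s\<close> and \<open>L\<^sup>-\<^sup>1\<close> by the number of those
  that come from \<open>d L\<^sup>-\<^sup>1\<close> or \<open>L\<^sup>-\<^sup>1\<close> (\<open>N_top\<close>).  If \<open>D \<omega>\<close> is basic, then \<open>h D \<omega> = 0\<close>, so
  \<open>\<omega> - N \<omega> / k = \<omega> - D (h \<omega> / k)\<close> is cohomologous to \<open>\<omega>\<close>.  As the eigenvalues of the leading part of
  \<open>N\<close> are at most the number of arguments, finitely many of these steps make \<open>\<omega>\<close> basic (\<open>basic_schedule\<close>).

  \<^bold>\<open>Skew-symmetrization.\<close>  Weakly symmetric cochains are the linear maps on a Clifford algebra over
  \<open>S(L\<^sup>-\<^sup>1)\<close> with \<open>x y + y x = - h\<^sub>2(x,y)\<close>, alternating ones are the linear maps on the corresponding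
  exterior algebra.  Wick's formula identifies the two as vector spaces: replacing \<open>i\<^sub>x\<close> by
  \<open>i\<^sub>x + c \<cdot> e\<^sub>x\<close>, where \<open>e\<^sub>x\<close> contracts \<open>x\<close> with one argument by means of \<open>h\<^sub>2\<close>, changes the relation
  by \<open>2 c h\<^sub>2(x,y)\<close>.  The resulting bijection commutes with the differentials (\<open>wick_D\<close>); the ternary
  bracket \<open>l\<^sub>3\<close> is exactly the correction that this requires (\<open>skew_3_defect\<close>).  Hence the complex of
  the skew-symmetrization is isomorphic to that of \<open>L\<close>, by an isomorphism that fixes basic cochains.
\<close>

section \<open>Cosets and subcomplexes with the same cohomology\<close>

lemma coset_eq_iff:
  fixes x :: "'x::ab_group_add"
  assumes "vector_space s" "module.subspace s B"
  shows "x +o B = y +o B \<longleftrightarrow> x - y \<in> B"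
proof -
  interpret vector_space s by fact
  show ?thesis
  proof
    assume "x +o B = y +o B"
    moreover have "x \<in> x +o B" using subspace_0[OF assms(2)] by (force simp: elt_set_plus_def)
    ultimately show "x - y \<in> B" by (auto simp: elt_set_plus_def)
  next
    assume *: "x - y \<in> B"
    have "x +o B \<subseteq> y +o B" if "x - y \<in> B" for x y
    proof
      fix z assume "z \<in> x +o B"
      then have "(z - x) + (x - y) \<in> B" using that subspace_add[OF assms(2)] by (simp only: set_minus_plus)
      then show "z \<in> y +o B" by (simp flip: set_minus_plus)
    qed
    moreover have "y - x \<in> B" using subspace_neg[OF assms(2) *] by simp
    ultimately show "x +o B = y +o B" using * by blast
  qed
qed

lemma coset_add:
  fixes x :: "'x::ab_group_add"
  assumes "vector_space s" "module.subspace s B"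
  shows "(x +o B) + (y +o B) = (x + y) +o B"
proof -
  interpret vector_space s by fact
  have "B + B = B"
  proof
    show "B + B \<subseteq> B" using subspace_add[OF assms(2)] by (auto simp: set_plus_def)
    show "B \<subseteq> B + B" using subspace_0[OF assms(2)] by (force simp: set_plus_def)
  qed
  then show ?thesis by (simp add: set_plus_rearrange)
qed

lemma coset_smul:
  fixes x :: "'x::ab_group_add"
  assumes "vector_space s" "module.subspace s B"
  shows "quot_smul s B c (x +o B) = s c x +o B"
proof -
  interpret vector_space s by fact
  show ?thesis
  proof
    show "quot_smul s B c (x +o B) \<subseteq> s c x +o B"
    proof
      fix z assume "z \<in> quot_smul s B c (x +o B)"
      then obtain b b2 where "b \<in> B" "b2 \<in> B" "z = s c (x + b) + b2"
        by (auto simp: quot_smul_def set_plus_def elt_set_plus_def)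
      then have "z = s c x + (s c b + b2)" "s c b + b2 \<in> B"
        using subspace_add[OF assms(2)] subspace_scale[OF assms(2)] by (simp_all add: scale_right_distrib add.assoc)
      then show "z \<in> s c x +o B" by (auto simp: elt_set_plus_def)
    qed
    have "x \<in> x +o B" using subspace_0[OF assms(2)] by (force simp: elt_set_plus_def)
    then show "s c x +o B \<subseteq> quot_smul s B c (x +o B)"
      by (auto simp: quot_smul_def set_plus_def elt_set_plus_def)
  qed
qed

text \<open>
  An injective cochain map \<open>\<phi> : C' \<rightarrow> C\<close> such that \<open>C / \<phi> C'\<close> is acyclic.  The last assumption says so
  without mentioning the quotient: if \<open>D x\<close> lies in the image of \<open>\<phi>\<close>, then \<open>x\<close> lies in it up to a
  coboundary.
\<close>

locale cochain_embedding =
  fixes s :: "'k::field \<Rightarrow> 'x::ab_group_add \<Rightarrow> 'x" and C :: "int \<Rightarrow> 'x set" and D :: "int \<Rightarrow> 'x \<Rightarrow> 'x"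
    and s' :: "'k \<Rightarrow> 'y::ab_group_add \<Rightarrow> 'y" and C' :: "int \<Rightarrow> 'y set" and D' :: "int \<Rightarrow> 'y \<Rightarrow> 'y"
    and \<phi> :: "'y \<Rightarrow> 'x"
  assumes vs: "vector_space s" and vs': "vector_space s'"
    and sub: "module.subspace s (C n)" and sub': "module.subspace s' (C' n)"
    and D_lin: "lin_on (C n) s s (D n)"
    and D_in: "x \<in> C n \<Longrightarrow> D n x \<in> C (n + 1)"
    and DD: "x \<in> C n \<Longrightarrow> D (n + 1) (D n x) = 0"
    and D'_in: "y \<in> C' n \<Longrightarrow> D' n y \<in> C' (n + 1)"
    and \<phi>_lin: "lin_on (C' n) s' s \<phi>"
    and \<phi>_in: "y \<in> C' n \<Longrightarrow> \<phi> y \<in> C n"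
    and \<phi>_inj: "inj_on \<phi> (C' n)"
    and chain: "y \<in> C' n \<Longrightarrow> D n (\<phi> y) = \<phi> (D' n y)"
    and retract: "x \<in> C n \<Longrightarrow> D n x \<in> \<phi> ` C' (n + 1) \<Longrightarrow> \<exists>z\<in>C (n - 1). x - D (n - 1) z \<in> \<phi> ` C' n"
begin

sublocale X: vector_space s by (rule vs)
sublocale Y: vector_space s' by (rule vs')

lemmas C_closed = X.subspace_0[OF sub] X.subspace_add[OF sub] X.subspace_diff[OF sub] X.subspace_scale[OF sub]
lemmas C'_closed = Y.subspace_0[OF sub'] Y.subspace_add[OF sub'] Y.subspace_diff[OF sub'] Y.subspace_scale[OF sub']

lemma D_add: "x \<in> C n \<Longrightarrow> y \<in> C n \<Longrightarrow> D n (x + y) = D n x + D n y"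
  and D_scale: "x \<in> C n \<Longrightarrow> D n (s c x) = s c (D n x)"
  using D_lin[of n] by (auto simp: lin_on_def)

lemma D_diff: "x \<in> C n \<Longrightarrow> y \<in> C n \<Longrightarrow> D n (x - y) = D n x - D n y"
  using D_add[of "x - y" n y] C_closed(3)[of x n y] by simp

lemma D_0: "D n 0 = 0" using D_diff[of 0 n 0] C_closed(1) by simp

lemma \<phi>_add: "x \<in> C' n \<Longrightarrow> y \<in> C' n \<Longrightarrow> \<phi> (x + y) = \<phi> x + \<phi> y"
  and \<phi>_scale: "x \<in> C' n \<Longrightarrow> \<phi> (s' c x) = s c (\<phi> x)"
  using \<phi>_lin[of n] by (auto simp: lin_on_def)

lemma \<phi>_diff: "x \<in> C' n \<Longrightarrow> y \<in> C' n \<Longrightarrow> \<phi> (x - y) = \<phi> x - \<phi> y"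
  using \<phi>_add[of "x - y" n y] C'_closed(3)[of x n y] by simp

lemma \<phi>_0: "\<phi> 0 = 0" using \<phi>_diff[of 0 0 0] C'_closed(1) by simp

lemma \<phi>_eqD: "x \<in> C' n \<Longrightarrow> y \<in> C' n \<Longrightarrow> \<phi> x = \<phi> y \<Longrightarrow> x = y"
  using \<phi>_inj by (blast dest: inj_onD)

lemma D'D': "y \<in> C' n \<Longrightarrow> D' (n + 1) (D' n y) = 0"
  using D'_in[OF D'_in, of y n] C'_closed(1) \<phi>_eqD[of _ "n + 1 + 1" 0]
  by (simp add: \<phi>_0 DD \<phi>_in D'_in[of y n] flip: chain)

lemma D'_add: "x \<in> C' n \<Longrightarrow> y \<in> C' n \<Longrightarrow> D' n (x + y) = D' n x + D' n y"
  by (rule \<phi>_eqD[of _ "n + 1"])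
    (simp_all add: D'_in C'_closed(2) \<phi>_add[of _ "n + 1"] D_add \<phi>_add[of _ n] \<phi>_in flip: chain)

lemma D'_scale: "x \<in> C' n \<Longrightarrow> D' n (s' c x) = s' c (D' n x)"
  by (rule \<phi>_eqD[of _ "n + 1"])
    (simp_all add: D'_in C'_closed(4) \<phi>_scale[of _ "n + 1"] D_scale \<phi>_scale[of _ n] \<phi>_in flip: chain)

lemma D'_0: "D' n 0 = 0" using D'_add[of 0 n 0] C'_closed(1) by simp

abbreviation "Z n \<equiv> cocycles C D n"
abbreviation "B n \<equiv> coboundaries C D n"
abbreviation "Z' n \<equiv> cocycles C' D' n"
abbreviation "B' n \<equiv> coboundaries C' D' n"

lemma B_subspace: "X.subspace (B n)"
  unfolding coboundaries_def
proof (rule X.subspaceI)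
  show "0 \<in> D (n - 1) ` C (n - 1)" using D_0 C_closed(1) by (metis imageI)
  show "x + y \<in> D (n - 1) ` C (n - 1)" if xy: "x \<in> D (n - 1) ` C (n - 1)" "y \<in> D (n - 1) ` C (n - 1)" for x y
  proof -
    from xy obtain u v where "u \<in> C (n - 1)" "v \<in> C (n - 1)" "x = D (n - 1) u" "y = D (n - 1) v" by blast
    then show ?thesis using D_add C_closed(2) by (metis imageI)
  qed
  show "s c x \<in> D (n - 1) ` C (n - 1)" if "x \<in> D (n - 1) ` C (n - 1)" for c x
  proof -
    from that obtain u where u: "u \<in> C (n - 1)" "x = D (n - 1) u" by blast
    then show ?thesis using D_scale[OF u(1), of c] imageI[OF C_closed(4)[OF u(1), of c], of "D (n - 1)"] by simp
  qed
qed

lemma B'_subspace: "Y.subspace (B' n)"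
  unfolding coboundaries_def
proof (rule Y.subspaceI)
  show "0 \<in> D' (n - 1) ` C' (n - 1)" using D'_0 C'_closed(1) by (metis imageI)
  show "x + y \<in> D' (n - 1) ` C' (n - 1)" if xy: "x \<in> D' (n - 1) ` C' (n - 1)" "y \<in> D' (n - 1) ` C' (n - 1)" for x y
  proof -
    from xy obtain u v where "u \<in> C' (n - 1)" "v \<in> C' (n - 1)" "x = D' (n - 1) u" "y = D' (n - 1) v" by blast
    then show ?thesis using D'_add C'_closed(2) by (metis imageI)
  qed
  show "s' c x \<in> D' (n - 1) ` C' (n - 1)" if "x \<in> D' (n - 1) ` C' (n - 1)" for c x
  proof -
    from that obtain u where u: "u \<in> C' (n - 1)" "x = D' (n - 1) u" by blast
    then show ?thesis using D'_scale[OF u(1), of c] imageI[OF C'_closed(4)[OF u(1), of c], of "D' (n - 1)"] by simp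
  qed
qed

end

context cochain_embedding
begin

lemmas B_coset = coset_eq_iff[OF vs B_subspace] coset_add[OF vs B_subspace] coset_smul[OF vs B_subspace]
lemmas B'_coset = coset_eq_iff[OF vs' B'_subspace] coset_add[OF vs' B'_subspace] coset_smul[OF vs' B'_subspace]

text \<open>
  If \<open>\<phi> y = D z\<close>, then \<open>z\<close> has its differential in the image of \<open>\<phi>\<close>, so \<open>z\<close> may be replaced by some
  \<open>\<phi> w\<close>, and \<open>y = D' w\<close> by injectivity.  This is injectivity of \<open>\<phi>\<close> on cohomology.
\<close>

lemma \<phi>_coboundary_iff:
  assumes "y \<in> C' n" shows "\<phi> y \<in> B n \<longleftrightarrow> y \<in> B' n"
proof
  assume "\<phi> y \<in> B n"
  then obtain z where z: "z \<in> C (n - 1)" "\<phi> y = D (n - 1) z" by (auto simp: coboundaries_def)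
  then have "D (n - 1) z \<in> \<phi> ` C' (n - 1 + 1)" using imageI[OF assms, of \<phi>] by simp
  from retract[OF z(1) this] obtain u w where u: "u \<in> C (n - 1 - 1)" "w \<in> C' (n - 1)" "z - D (n - 1 - 1) u = \<phi> w" by auto
  have "\<phi> (D' (n - 1) w) = D (n - 1) (z - D (n - 1 - 1) u)" using u by (simp add: chain)
  also have "\<dots> = D (n - 1) z" using D_diff[OF z(1), of "D (n - 1 - 1) u"] D_in[OF u(1)] DD[OF u(1)] by simp
  also have "\<dots> = \<phi> y" using z by simp
  finally have "D' (n - 1) w = y" using \<phi>_eqD[of _ n, OF _ assms] D'_in[OF u(2)] by simp
  then show "y \<in> B' n" using u(2) by (auto simp: coboundaries_def)
next
  assume "y \<in> B' n"
  then obtain w where "w \<in> C' (n - 1)" "y = D' (n - 1) w" by (auto simp: coboundaries_def)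
  then show "\<phi> y \<in> B n" using chain[of w "n - 1"] \<phi>_in[of w "n - 1"]
    unfolding coboundaries_def by (metis imageI)
qed

text \<open>
  Surjectivity on cohomology: the differential \<open>0\<close> of a cocycle lies in the image of \<open>\<phi>\<close>.
\<close>

lemma Z_classes:
  assumes "x \<in> Z n"
  shows "\<exists>y\<in>Z' n. x +o B n = \<phi> y +o B n"
proof -
  have x: "x \<in> C n" "D n x = 0" using assms by (auto simp: cocycles_def)
  then have "D n x \<in> \<phi> ` C' (n + 1)" using \<phi>_0 C'_closed(1) by (metis imageI)
  from retract[OF x(1) this] obtain z y where z: "z \<in> C (n - 1)" "y \<in> C' n" "x - D (n - 1) z = \<phi> y" by auto
  have "\<phi> (D' n y) = D n (x - D (n - 1) z)" using z by (simp add: chain)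
  also have "\<dots> = 0" using D_diff[OF x(1), of "D (n - 1) z"] D_in[OF z(1)] DD[OF z(1)] x by simp
  finally have "D' n y = 0" using \<phi>_eqD[of _ "n + 1" 0] D'_in[OF z(2)] C'_closed(1) \<phi>_0 by simp
  moreover have "x - \<phi> y = D (n - 1) z" using z(3) by (simp add: algebra_simps)
  then have "x - \<phi> y \<in> B n" using z(1) by (auto simp: coboundaries_def)
  ultimately show ?thesis using z(2) by (auto simp: cocycles_def B_coset)
qed

theorem cohomology_iso: "cohomology_isomorphic s C D s' C' D'"
  unfolding cohomology_isomorphic_def
proof
  fix n
  \<comment> \<open>the inverse of the map induced by \<open>\<phi>\<close>\<close>
  define f where "f X = {y \<in> Z' n. \<phi> y \<in> X}" for X
  have Z': "y \<in> C' n" "D' n y = 0" if "y \<in> Z' n" for y using that by (auto simp: cocycles_def)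
  have f: "f (\<phi> y +o B n) = y +o B' n" if y: "y \<in> Z' n" for y
  proof -
    have "(\<phi> w \<in> \<phi> y +o B n) \<longleftrightarrow> w \<in> y +o B' n" if "w \<in> C' n" for w
    proof -
      show ?thesis using \<phi>_coboundary_iff[of "w - y" n] \<phi>_diff[OF that Z'(1)[OF y]] C'_closed(3)[OF that Z'(1)[OF y]]
        by (simp flip: set_minus_plus)
    qed
    moreover have "w \<in> Z' n" if "w \<in> y +o B' n" for w
    proof -
      obtain v where v: "v \<in> C' (n - 1)" "w = y + D' (n - 1) v"
        using \<open>w \<in> y +o B' n\<close> by (auto simp: elt_set_plus_def coboundaries_def)
      then show ?thesis using D'_in[OF v(1)] D'D'[OF v(1)] Z'[OF y] C'_closed(2) D'_add by (auto simp: cocycles_def)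
    qed
    ultimately show ?thesis using Z' by (auto simp: f_def)
  qed
  have H: "\<exists>y\<in>Z' n. X = \<phi> y +o B n" if "X \<in> cohomology C D n" for X
    using that Z_classes by (auto simp: cohomology_def quot_def)
  have H': "\<phi> y +o B n \<in> cohomology C D n" if "y \<in> Z' n" for y
    using Z'[OF that] \<phi>_in chain[of y n] \<phi>_0 by (auto simp: cohomology_def quot_def cocycles_def)
  have Z'_add: "y + w \<in> Z' n" and Z'_scale: "s' c y \<in> Z' n" if "y \<in> Z' n" "w \<in> Z' n" for y w c
    using Z'[OF that(1)] Z'[OF that(2)] C'_closed(2,4) D'_add D'_scale by (auto simp: cocycles_def)
  have "bij_betw f (cohomology C D n) (cohomology C' D' n)"
    unfolding bij_betw_def
  proof
    show "inj_on f (cohomology C D n)"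
    proof (rule inj_onI)
      fix X1 X2 assume X: "X1 \<in> cohomology C D n" "X2 \<in> cohomology C D n" "f X1 = f X2"
      obtain y1 y2 where y: "y1 \<in> Z' n" "y2 \<in> Z' n" "X1 = \<phi> y1 +o B n" "X2 = \<phi> y2 +o B n" using H X by metis
      then have "y1 - y2 \<in> B' n" using X(3) f by (simp add: B'_coset)
      then have "\<phi> (y1 - y2) \<in> B n" using \<phi>_coboundary_iff Z'(1) y C'_closed(3) by blast
      then show "X1 = X2" using y Z'(1) \<phi>_diff[of y1 n y2] by (simp add: B_coset)
    qed
    show "f ` cohomology C D n = cohomology C' D' n"
    proof
      show "f ` cohomology C D n \<subseteq> cohomology C' D' n"
        using H f by (force simp: cohomology_def[of C'] quot_def)
      show "cohomology C' D' n \<subseteq> f ` cohomology C D n"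
        using H' f by (force simp: cohomology_def[of C'] quot_def)
    qed
  qed
  moreover have "lin_on (cohomology C D n) (quot_smul s (B n)) (quot_smul s' (B' n)) f"
    unfolding lin_on_def
  proof (intro conjI ballI allI)
    fix X1 X2 c assume X1: "X1 \<in> cohomology C D n"
    then obtain y1 where y1: "y1 \<in> Z' n" "X1 = \<phi> y1 +o B n" using H by blast
    show "f (quot_smul s (B n) c X1) = quot_smul s' (B' n) c (f X1)"
      using f[OF Z'_scale[OF y1(1) y1(1), of c]] f[OF y1(1)] Z'(1)[OF y1(1)] y1(2)
      by (simp add: B_coset B'_coset \<phi>_scale)
    assume X2: "X2 \<in> cohomology C D n"
    then obtain y2 where y2: "y2 \<in> Z' n" "X2 = \<phi> y2 +o B n" using H by blast
    show "f (X1 + X2) = f X1 + f X2"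
      using f[OF Z'_add[OF y1(1) y2(1)]] f[OF y1(1)] f[OF y2(1)] Z'(1)[OF y1(1)] Z'(1)[OF y2(1)] y1(2) y2(2)
      by (simp add: B_coset B'_coset \<phi>_add)
  qed
  ultimately show "\<exists>f. bij_betw f (cohomology C D n) (cohomology C' D' n) \<and>
      lin_on (cohomology C D n) (quot_smul s (B n)) (quot_smul s' (B' n)) f" by blast
qed

text \<open>
  \<open>D2\<close> is the conjugate of \<open>D\<close> under a bijection \<open>P : C2 \<rightarrow> C\<close>.  In particular \<open>D2\<close> squares to zero
  and preserves \<open>C2\<close> because \<open>D\<close> does, with nothing to be computed for \<open>D2\<close> itself.
\<close>

lemma transport:
  assumes sub2: "\<And>n. module.subspace s (C2 n)"
    and P_lin: "\<And>n. lin_on (C2 n) s s P" and P_in: "\<And>n x. x \<in> C2 n \<Longrightarrow> P x \<in> C n"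
    and Q_lin: "\<And>n. lin_on (C n) s s Q" and Q_in: "\<And>n x. x \<in> C n \<Longrightarrow> Q x \<in> C2 n"
    and QP: "\<And>n x. x \<in> C2 n \<Longrightarrow> Q (P x) = x" and PQ: "\<And>n x. x \<in> C n \<Longrightarrow> P (Q x) = x"
    and D2: "\<And>n x. x \<in> C2 n \<Longrightarrow> D2 n x = Q (D n (P x))"
  shows "cochain_embedding s C2 D2 s' C' D' (\<lambda>y. Q (\<phi> y))"
proof
  fix n
  have Q_add: "x \<in> C n \<Longrightarrow> y \<in> C n \<Longrightarrow> Q (x + y) = Q x + Q y"
    and Q_scale: "x \<in> C n \<Longrightarrow> Q (s c x) = s c (Q x)" for x y c n
    using Q_lin[of n] by (auto simp: lin_on_def)
  have Q_diff: "Q (x - y) = Q x - Q y" if "x \<in> C n" "y \<in> C n" for x y n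
    using Q_add[of "x - y" n y] C_closed(3)[OF that] that by simp
  have P_add: "x \<in> C2 n \<Longrightarrow> y \<in> C2 n \<Longrightarrow> P (x + y) = P x + P y"
    and P_scale: "x \<in> C2 n \<Longrightarrow> P (s c x) = s c (P x)" for x y c n
    using P_lin[of n] by (auto simp: lin_on_def)
  have Q0: "Q 0 = 0" using Q_diff[of 0 n 0] C_closed(1) by simp
  have C2_closed: "x \<in> C2 n \<Longrightarrow> y \<in> C2 n \<Longrightarrow> x + y \<in> C2 n" "x \<in> C2 n \<Longrightarrow> s c x \<in> C2 n" for x y c n
    using X.subspace_add[OF sub2] X.subspace_scale[OF sub2] by blast+
  show "module.subspace s (C2 n)" by fact
  show "module.subspace s' (C' n)" by (rule sub')
  show "lin_on (C2 n) s s (D2 n)"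
    using D2 P_in P_add P_scale D_add D_scale D_in Q_add[of _ "n + 1"] Q_scale[of _ "n + 1"] C2_closed
    by (auto simp: lin_on_def)
  show "D2 n x \<in> C2 (n + 1)" if "x \<in> C2 n" for x
    using that D2 P_in D_in Q_in by simp
  show "D2 (n + 1) (D2 n x) = 0" if "x \<in> C2 n" for x
    using that D2[of x n] D2[of "D2 n x" "n + 1"] P_in D_in Q_in PQ[of _ "n + 1"] DD Q0 by simp
  show "D' n y \<in> C' (n + 1)" if "y \<in> C' n" for y using that by (rule D'_in)
  show "lin_on (C' n) s' s (\<lambda>y. Q (\<phi> y))"
    using \<phi>_add[of _ n] \<phi>_scale[of _ n] \<phi>_in Q_add[of _ n] Q_scale[of _ n] by (auto simp: lin_on_def)
  show "Q (\<phi> y) \<in> C2 n" if "y \<in> C' n" for y by (rule Q_in[OF \<phi>_in[OF that]])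
  show "inj_on (\<lambda>y. Q (\<phi> y)) (C' n)"
  proof (rule inj_onI)
    fix x y assume xy: "x \<in> C' n" "y \<in> C' n" "Q (\<phi> x) = Q (\<phi> y)"
    have "\<phi> x = P (Q (\<phi> x))" by (rule PQ[OF \<phi>_in[OF xy(1)], symmetric])
    also have "\<dots> = \<phi> y" unfolding xy(3) by (rule PQ[OF \<phi>_in[OF xy(2)]])
    finally have "\<phi> x = \<phi> y" .
    then show "x = y" by (rule \<phi>_eqD[OF xy(1,2)])
  qed
  show "D2 n (Q (\<phi> y)) = Q (\<phi> (D' n y))" if "y \<in> C' n" for y
    using that D2[of "Q (\<phi> y)" n] Q_in \<phi>_in PQ[of _ n] chain by simp
  fix x assume x: "x \<in> C2 n" "D2 n x \<in> (\<lambda>y. Q (\<phi> y)) ` C' (n + 1)"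
  then obtain y where y: "y \<in> C' (n + 1)" "Q (D n (P x)) = Q (\<phi> y)" using D2 by auto
  then have "D n (P x) = \<phi> y" using PQ[of _ "n + 1"] \<phi>_in[OF y(1)] D_in[OF P_in[OF x(1)]] by metis
  then obtain z w where z: "z \<in> C (n - 1)" "w \<in> C' n" "P x - D (n - 1) z = \<phi> w"
    using retract[OF P_in[OF x(1)]] y(1) by blast
  have "x - D2 (n - 1) (Q z) = Q (P x - D (n - 1) z)"
    using Q_diff[of "P x" n "D (n - 1) z"] P_in[OF x(1)] D_in[OF z(1)] QP[OF x(1)] D2[OF Q_in[OF z(1)]] PQ[OF z(1)]
    by simp
  then show "\<exists>z\<in>C2 (n - 1). x - D2 (n - 1) z \<in> (\<lambda>y. Q (\<phi> y)) ` C' n"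
    using Q_in[OF z(1)] z(2,3) by auto
qed

end

section \<open>Operations on cochains\<close>

text \<open>
  Contractions.  All operations below are defined by recursion on the arguments, that is, by their
  commutation rules with these two.
\<close>

definition arg0 :: "'z \<Rightarrow> ('z list \<times> 'm list \<Rightarrow> 'w) \<Rightarrow> 'z list \<times> 'm list \<Rightarrow> 'w"
  where "arg0 x \<eta> = (\<lambda>(xs, as). \<eta> (x # xs, as))"

definition argm :: "'m \<Rightarrow> ('z list \<times> 'm list \<Rightarrow> 'w) \<Rightarrow> 'z list \<times> 'm list \<Rightarrow> 'w"
  where "argm \<alpha> \<eta> = (\<lambda>(xs, as). \<eta> (xs, \<alpha> # as))"

lemma arg_apply [simp]: "arg0 x \<eta> (xs, as) = \<eta> (x # xs, as)" "argm \<alpha> \<eta> (xs, as) = \<eta> (xs, \<alpha> # as)"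
  by (simp_all add: arg0_def argm_def)

text \<open>
  The signed sum over all ways to move an argument through \<open>\<phi>\<close> into the second list
  (\<open>shift_sum\<close> below).  It serves as the homotopy, as contraction with \<open>h\<^sub>2\<close>, and as the part of the
  differential that comes from the bracket with a fixed element of \<open>L\<^sup>-\<^sup>1\<close>.
\<close>

fun shift :: "('z \<Rightarrow> 'm) \<Rightarrow> ('z list \<times> 'm list \<Rightarrow> 'w::ab_group_add) \<Rightarrow> 'z list \<times> 'm list \<Rightarrow> 'w"
  where
    "shift \<phi> \<eta> ([], as) = 0"
  | "shift \<phi> \<eta> (x # xs, as) = \<eta> (xs, \<phi> x # as) - shift \<phi> (arg0 x \<eta>) (xs, as)"

text \<open>
  The action on multilinear maps that is induced by endomorphisms \<open>l\<close>, \<open>f\<close>, \<open>g\<close> of the spaces of values,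
  of first and of second arguments.
\<close>

fun lie_deriv :: "('w \<Rightarrow> 'w) \<Rightarrow> ('z \<Rightarrow> 'z) \<Rightarrow> ('m \<Rightarrow> 'm) \<Rightarrow>
    ('z list \<times> 'm list \<Rightarrow> 'w::ab_group_add) \<Rightarrow> 'z list \<times> 'm list \<Rightarrow> 'w"
  where
    "lie_deriv l f g \<eta> ([], []) = l (\<eta> ([], []))"
  | "lie_deriv l f g \<eta> ([], \<alpha> # as) = lie_deriv l f g (argm \<alpha> \<eta>) ([], as) - \<eta> ([], g \<alpha> # as)"
  | "lie_deriv l f g \<eta> (x # xs, as) = lie_deriv l f g (arg0 x \<eta>) (xs, as) - \<eta> (f x # xs, as)"

text \<open>
  The quadratic analogue of \<open>shift\<close>, which replaces a pair of arguments by its value under \<open>\<tau>\<close>; it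
  produces the terms with \<open>l\<^sub>3\<close>.
\<close>

fun shift2 :: "('z \<Rightarrow> 'z \<Rightarrow> 'm) \<Rightarrow> ('z list \<times> 'm list \<Rightarrow> 'w::ab_group_add) \<Rightarrow> 'z list \<times> 'm list \<Rightarrow> 'w"
  where
    "shift2 \<tau> \<eta> ([], as) = 0"
  | "shift2 \<tau> \<eta> (x # xs, as) = shift (\<tau> x) \<eta> (xs, as) + shift2 \<tau> (arg0 x \<eta>) (xs, as)"

text \<open>
  The differential as the solution of \<open>i\<^sub>x D + D i\<^sub>x = \<Lambda>\<^sub>x\<close>.  When no argument \<open>x\<close> is left, only the
  terms with \<open>d\<close> remain.
\<close>

fun cartan_diff :: "('m \<Rightarrow> 'z) \<Rightarrow> ('z \<Rightarrow> ('z list \<times> 'm list \<Rightarrow> 'w) \<Rightarrow> 'z list \<times> 'm list \<Rightarrow> 'w) \<Rightarrow>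
    ('z list \<times> 'm list \<Rightarrow> 'w::ab_group_add) \<Rightarrow> 'z list \<times> 'm list \<Rightarrow> 'w"
  where
    "cartan_diff d \<Lambda> \<eta> ([], []) = 0"
  | "cartan_diff d \<Lambda> \<eta> ([], \<alpha> # as) = cartan_diff d \<Lambda> (argm \<alpha> \<eta>) ([], as) + \<eta> ([d \<alpha>], as)"
  | "cartan_diff d \<Lambda> \<eta> (x # xs, as) = \<Lambda> x \<eta> (xs, as) - cartan_diff d \<Lambda> (arg0 x \<eta>) (xs, as)"

text \<open>
  The contraction \<open>i\<^sub>x\<close> deformed by \<open>c\<close> times the contraction with \<open>h\<close>, and the linear map \<open>wick\<close> that
  intertwines the two: \<open>i\<^sub>x (wick \<eta>) = wick (wick_arg x \<eta>)\<close>.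
\<close>

definition wick_arg :: "('k \<Rightarrow> 'w \<Rightarrow> 'w) \<Rightarrow> ('z \<Rightarrow> 'z \<Rightarrow> 'm) \<Rightarrow> 'k \<Rightarrow> 'z \<Rightarrow>
    ('z list \<times> 'm list \<Rightarrow> 'w::ab_group_add) \<Rightarrow> 'z list \<times> 'm list \<Rightarrow> 'w"
  where "wick_arg t h c x \<eta> = arg0 x \<eta> + (\<lambda>u. t c (shift (h x) \<eta> u))"

fun wick :: "('k \<Rightarrow> 'w \<Rightarrow> 'w) \<Rightarrow> ('z \<Rightarrow> 'z \<Rightarrow> 'm) \<Rightarrow> 'k \<Rightarrow>
    ('z list \<times> 'm list \<Rightarrow> 'w::ab_group_add) \<Rightarrow> 'z list \<times> 'm list \<Rightarrow> 'w"
  where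
    "wick t h c \<eta> ([], as) = \<eta> ([], as)"
  | "wick t h c \<eta> (x # xs, as) = wick t h c (wick_arg t h c x \<eta>) (xs, as)"

lemma arg_shift: "arg0 x (shift \<phi> \<eta>) = argm (\<phi> x) \<eta> - shift \<phi> (arg0 x \<eta>)"
  by (auto simp: fun_eq_iff)
lemma arg0_lie_deriv: "arg0 x (lie_deriv l f g \<eta>) = lie_deriv l f g (arg0 x \<eta>) - arg0 (f x) \<eta>"
  by (auto simp: fun_eq_iff)
lemma arg0_cartan: "arg0 x (cartan_diff d \<Lambda> \<eta>) = \<Lambda> x \<eta> - cartan_diff d \<Lambda> (arg0 x \<eta>)"
  by (auto simp: fun_eq_iff)

abbreviation (input) lin where "lin \<equiv> lin_on UNIV"

lemma linI: "(\<And>x y. f (x + y) = f x + f y) \<Longrightarrow> (\<And>c x. f (s c x) = u c (f x)) \<Longrightarrow> lin s u f"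
  by (simp add: lin_on_def)

lemma lin_add: "lin s u f \<Longrightarrow> f (x + y) = f x + f y"
  and lin_scale: "lin s u f \<Longrightarrow> f (s c x) = u c (f x)"
  by (simp_all add: lin_on_def)

lemma lin_diff: "lin s u f \<Longrightarrow> f (x - y) = f x - f y"
  for f :: "'x::ab_group_add \<Rightarrow> 'y::ab_group_add"
  by (metis add_diff_cancel_right' diff_add_cancel lin_add)

lemma lin_zero: "lin s u f \<Longrightarrow> f 0 = 0"
  for f :: "'x::ab_group_add \<Rightarrow> 'y::ab_group_add"
  by (metis add_cancel_right_right lin_add)

lemma lin_minus: "lin s u f \<Longrightarrow> f (- x) = - f x"
  for f :: "'x::ab_group_add \<Rightarrow> 'y::ab_group_add"
  by (metis diff_0 lin_diff lin_zero)

lemma lin_compose: "lin s u f \<Longrightarrow> lin u v g \<Longrightarrow> lin s v (\<lambda>x. g (f x))"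
  by (simp add: lin_on_def)

lemma linear_imp_lin: "Vector_Spaces.linear s u f \<Longrightarrow> lin s u f"
  by (simp add: lin_on_def Vector_Spaces.linear_iff)

abbreviation (input) sc :: "('k \<Rightarrow> 'w \<Rightarrow> 'w) \<Rightarrow> 'k \<Rightarrow> ('u \<Rightarrow> 'w) \<Rightarrow> 'u \<Rightarrow> 'w"
  where "sc t \<equiv> \<lambda>c \<eta> u. t c (\<eta> u)"

lemma arg_ops [simp]:
  "arg0 x (\<eta> + \<zeta>) = arg0 x \<eta> + arg0 x \<zeta>" "arg0 x (\<eta> - \<zeta>) = arg0 x \<eta> - arg0 x \<zeta>"
  "arg0 x (- \<eta>) = - arg0 x \<eta>" "arg0 x (\<lambda>u. t c (\<eta> u)) = (\<lambda>u. t c (arg0 x \<eta> u))"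
  "argm \<alpha> (\<eta> + \<zeta>) = argm \<alpha> \<eta> + argm \<alpha> \<zeta>" "argm \<alpha> (\<eta> - \<zeta>) = argm \<alpha> \<eta> - argm \<alpha> \<zeta>"
  "argm \<alpha> (- \<eta>) = - argm \<alpha> \<eta>" "argm \<alpha> (\<lambda>u. t c (\<eta> u)) = (\<lambda>u. t c (argm \<alpha> \<eta> u))"
  "arg0 x 0 = 0" "argm \<alpha> 0 = 0"
  for \<eta> \<zeta> :: "'z list \<times> 'm list \<Rightarrow> 'w::ab_group_add"
  by (auto simp: fun_eq_iff)

lemma arg0_argm: "arg0 x (argm \<alpha> \<eta>) = argm \<alpha> (arg0 x \<eta>)"
  by (simp add: fun_eq_iff)

text \<open>
  Scalar multiplications on the spaces of values (\<open>t\<close>) and of arguments (\<open>sx\<close>, \<open>sa\<close>).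
\<close>

locale coefficients = vector_space t
  for t :: "'k::field \<Rightarrow> 'w::ab_group_add \<Rightarrow> 'w" +
  fixes sx :: "'k \<Rightarrow> 'z::ab_group_add \<Rightarrow> 'z" and sa :: "'k \<Rightarrow> 'm::ab_group_add \<Rightarrow> 'm"
begin

lemma lin_sub: "lin s t f \<Longrightarrow> lin s t g \<Longrightarrow> lin s t (\<lambda>x. f x - g x)"
  and lin_plus: "lin s t f \<Longrightarrow> lin s t g \<Longrightarrow> lin s t (\<lambda>x. f x + g x)"
  and lin_0: "lin s t (\<lambda>x. 0)"
  by (auto simp: lin_on_def scale_right_diff_distrib scale_right_distrib)

lemma lin_sc: "lin s t f \<Longrightarrow> lin s t (\<lambda>x. t c (f x))"
  by (simp add: lin_on_def scale_right_distrib scale_left_commute)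

lemma lin_fun_plus: "lin s (sc t) f \<Longrightarrow> lin s (sc t) g \<Longrightarrow> lin s (sc t) (\<lambda>x. f x + g x)"
  by (auto simp: lin_on_def fun_eq_iff scale_right_distrib)

lemma lin_at: "lin s (sc t) F \<Longrightarrow> lin s t (\<lambda>x. F x u)"
  by (auto simp: lin_on_def fun_eq_iff)

lemma lin_fun_iff: "lin s (sc t) F \<longleftrightarrow> (\<forall>u. lin s t (\<lambda>x. F x u))"
  by (auto simp: lin_on_def fun_eq_iff)

text \<open>
  Multilinear in all arguments and symmetric in those of the second list.  Linearity in the first and
  invariance under adjacent transpositions are enough for the second list, and they are what can be
  checked by induction.
\<close>

definition mlin :: "('z list \<times> 'm list \<Rightarrow> 'w) \<Rightarrow> bool"
  where "mlin \<eta> \<longleftrightarrow>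
    (\<forall>us vs as. lin sx t (\<lambda>x. \<eta> (us @ x # vs, as))) \<and>
    (\<forall>xs as. lin sa t (\<lambda>\<alpha>. \<eta> (xs, \<alpha> # as))) \<and>
    (\<forall>xs as \<alpha> \<beta> bs. \<eta> (xs, as @ \<alpha> # \<beta> # bs) = \<eta> (xs, as @ \<beta> # \<alpha> # bs))"

lemma mlinI:
  assumes "\<And>us vs as. lin sx t (\<lambda>x. \<eta> (us @ x # vs, as))"
    and "\<And>xs as. lin sa t (\<lambda>\<alpha>. \<eta> (xs, \<alpha> # as))"
    and "\<And>xs as \<alpha> \<beta> bs. \<eta> (xs, as @ \<alpha> # \<beta> # bs) = \<eta> (xs, as @ \<beta> # \<alpha> # bs)"
  shows "mlin \<eta>" using assms by (simp add: mlin_def)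

lemma mlin_slot0: "mlin \<eta> \<Longrightarrow> lin sx t (\<lambda>x. \<eta> (us @ x # vs, as))"
  and mlin_slotm: "mlin \<eta> \<Longrightarrow> lin sa t (\<lambda>\<alpha>. \<eta> (xs, \<alpha> # as))"
  and mlin_swap: "mlin \<eta> \<Longrightarrow> \<eta> (xs, as @ \<alpha> # \<beta> # bs) = \<eta> (xs, as @ \<beta> # \<alpha> # bs)"
  by (simp_all add: mlin_def)

lemma mlin_arg0 [simp]:
  assumes "mlin \<eta>" shows "mlin (arg0 x \<eta>)"
proof (rule mlinI)
  show "lin sx t (\<lambda>y. arg0 x \<eta> (us @ y # vs, as))" for us vs as
    using mlin_slot0[OF assms, of "x # us" vs as] by simp
qed (simp_all add: mlin_slotm mlin_swap assms)

lemma mlin_swap0: "mlin \<eta> \<Longrightarrow> \<eta> (xs, \<alpha> # \<beta> # bs) = \<eta> (xs, \<beta> # \<alpha> # bs)"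
  using mlin_swap[of \<eta> _ "[]"] by auto

lemma mlin_argm [simp]:
  assumes "mlin \<eta>" shows "mlin (argm \<alpha> \<eta>)"
proof (rule mlinI)
  show "lin sa t (\<lambda>\<beta>. argm \<alpha> \<eta> (xs, \<beta> # as))" for xs as
    using mlin_slotm[OF assms, of xs "\<alpha> # as"] mlin_swap0[OF assms, of xs \<alpha>]
    by (simp only: arg_apply)
  show "argm \<alpha> \<eta> (xs, as @ \<gamma> # \<beta> # bs) = argm \<alpha> \<eta> (xs, as @ \<beta> # \<gamma> # bs)" for xs as \<gamma> \<beta> bs
    using mlin_swap[OF assms, of xs "\<alpha> # as"] by simp
qed (simp add: mlin_slot0 assms)

lemma mlin_lin0: "mlin \<eta> \<Longrightarrow> lin sx (sc t) (\<lambda>x. arg0 x \<eta>)"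
  using mlin_slot0[of \<eta> "[]"] by (auto simp: lin_fun_iff)

lemma mlin_linm: "mlin \<eta> \<Longrightarrow> lin sa (sc t) (\<lambda>\<alpha>. argm \<alpha> \<eta>)"
  using mlin_slotm[of \<eta>] by (auto simp: lin_fun_iff)

lemma argm_swap: "mlin \<eta> \<Longrightarrow> argm \<alpha> (argm \<beta> \<eta>) = argm \<beta> (argm \<alpha> \<eta>)"
  using mlin_swap[of \<eta> _ "[]"] by (auto simp: fun_eq_iff)

lemma mlin_diff [simp]: "mlin \<eta> \<Longrightarrow> mlin \<zeta> \<Longrightarrow> mlin (\<eta> - \<zeta>)"
  and mlin_add [simp]: "mlin \<eta> \<Longrightarrow> mlin \<zeta> \<Longrightarrow> mlin (\<eta> + \<zeta>)"
  and mlin_zero [simp]: "mlin 0"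
  and mlin_sc [simp]: "mlin \<eta> \<Longrightarrow> mlin (\<lambda>u. t c (\<eta> u))"
  by (auto simp: mlin_def intro: lin_sub lin_plus lin_0 lin_sc)

lemma shift_lin: "lin (sc t) (sc t) (shift \<phi>)" for \<phi> :: "'z \<Rightarrow> 'm"
proof (rule linI; rule ext)
  show "shift \<phi> (\<eta> + \<zeta>) u = (shift \<phi> \<eta> + shift \<phi> \<zeta>) u" for \<eta> \<zeta> and u :: "'z list \<times> 'm list"
    by (induction \<phi> \<eta> u arbitrary: \<zeta> rule: shift.induct) simp_all
  show "shift \<phi> (\<lambda>u. t c (\<eta> u)) u = t c (shift \<phi> \<eta> u)" for \<eta> c and u :: "'z list \<times> 'm list"
    by (induction \<phi> \<eta> u rule: shift.induct) (simp_all add: scale_right_diff_distrib)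
qed

lemmas shift_simps [simp] = lin_add[OF shift_lin] lin_diff[OF shift_lin] lin_minus[OF shift_lin]
  lin_zero[OF shift_lin] lin_scale[OF shift_lin]

lemma shift_lin_map:
  assumes "\<And>z. lin s sa (\<lambda>x. \<phi> x z)" "mlin \<eta>"
  shows "lin s (sc t) (\<lambda>x. shift (\<phi> x) \<eta>)"
  unfolding lin_fun_iff
proof
  fix u :: "'z list \<times> 'm list"
  have "\<forall>\<eta>. mlin \<eta> \<longrightarrow> lin s t (\<lambda>x. shift (\<phi> x) \<eta> (xs, as))" for xs as
  proof (induction xs)
    case Nil then show ?case by (simp add: lin_0)
  next
    case (Cons y ys)
    show ?case
    proof (intro allI impI)
      fix \<eta> assume "mlin \<eta>"
      then show "lin s t (\<lambda>x. shift (\<phi> x) \<eta> (y # ys, as))"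
        using Cons lin_compose[OF assms(1) mlin_slotm[of \<eta> ys as]] by (auto intro!: lin_sub)
    qed
  qed
  then show "lin s t (\<lambda>x. shift (\<phi> x) \<eta> u)" using assms(2) by (cases u) auto
qed

lemma argm_shift: "mlin \<eta> \<Longrightarrow> argm \<alpha> (shift \<phi> \<eta>) = shift \<phi> (argm \<alpha> \<eta>)"
proof
  fix u :: "'z list \<times> 'm list" assume "mlin \<eta>"
  then show "argm \<alpha> (shift \<phi> \<eta>) u = shift \<phi> (argm \<alpha> \<eta>) u"
  proof (induction \<phi> \<eta> u rule: shift.induct)
    case (2 \<phi> \<eta> x xs as) then show ?case
      using mlin_swap0[of \<eta>] by (simp add: arg0_argm[symmetric])
  qed simp
qed

lemma mlin_shift:
  assumes "lin sx sa \<phi>" "mlin \<eta>"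
  shows "mlin (shift \<phi> \<eta>)"
proof (rule mlinI)
  show "lin sx t (\<lambda>x. shift \<phi> \<eta> (us @ x # vs, as))" for us vs as
    using assms(2)
  proof (induction us arbitrary: \<eta>)
    case Nil
    have "lin sx t (\<lambda>x. \<eta> (vs, \<phi> x # as))"
      using lin_compose[OF assms(1) mlin_slotm[OF Nil, of vs as]] .
    moreover have "lin sx t (\<lambda>x. shift \<phi> (arg0 x \<eta>) (vs, as))"
      by (rule lin_at[OF lin_compose[OF mlin_lin0[OF Nil] shift_lin]])
    ultimately show ?case by (simp add: lin_sub)
  next
    case (Cons u us)
    then show ?case by (simp add: lin_sub mlin_slot0)
  qed
  show "lin sa t (\<lambda>\<alpha>. shift \<phi> \<eta> (xs, \<alpha> # as))" for xs as
  proof -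
    have "lin sa t (\<lambda>\<alpha>. shift \<phi> (argm \<alpha> \<eta>) (xs, as))"
      by (rule lin_at[OF lin_compose[OF mlin_linm[OF assms(2)] shift_lin]])
    then show ?thesis by (simp add: argm_shift[OF assms(2), symmetric])
  qed
  show "shift \<phi> \<eta> (xs, as @ \<alpha> # \<beta> # bs) = shift \<phi> \<eta> (xs, as @ \<beta> # \<alpha> # bs)" for xs as \<alpha> \<beta> bs
    using assms(2)
  proof (induction xs arbitrary: \<eta>)
    case (Cons x xs)
    then show ?case using mlin_swap[OF Cons(2), of xs "\<phi> x # as"] by simp
  qed simp
qed

text \<open>
  Moving two arguments in either order gives the same terms, because the second list is symmetric, but
  with opposite signs.
\<close>

lemma shift_anticommute:
  assumes "mlin \<eta>"
  shows "shift \<phi> (shift \<psi> \<eta>) = - shift \<psi> (shift \<phi> \<eta>)"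
proof
  fix u :: "'z list \<times> 'm list"
  obtain xs as where u: "u = (xs, as)" by fastforce
  show "shift \<phi> (shift \<psi> \<eta>) u = (- shift \<psi> (shift \<phi> \<eta>)) u"
    unfolding u using assms
  proof (induction xs arbitrary: \<eta>)
    case (Cons x xs)
    have "shift \<psi> \<eta> (xs, \<phi> x # as) = shift \<psi> (argm (\<phi> x) \<eta>) (xs, as)" for \<phi> \<psi>
      using fun_cong[OF argm_shift[OF Cons(2), of "\<phi> x" \<psi>], of "(xs, as)"] by simp
    then show ?case using Cons(1)[of "arg0 x \<eta>"] Cons(2) by (simp add: arg_shift)
  qed simp
qed

text \<open>
  Weak symmetry at the first two positions is the relation \<open>i\<^sub>x i\<^sub>y + i\<^sub>y i\<^sub>x = - h(x,y)\<close> of a Clifford algebra.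
\<close>

lemma ws_head: "weakly_symmetric h \<eta> \<Longrightarrow> arg0 x (arg0 y \<eta>) = - argm (h x y) \<eta> - arg0 y (arg0 x \<eta>)"
  for h :: "'z \<Rightarrow> 'z \<Rightarrow> 'm" and \<eta> :: "'z list \<times> 'm list \<Rightarrow> 'w"
proof -
  assume "weakly_symmetric h \<eta>"
  then have "\<eta> (x # y # vs, as) + \<eta> (y # x # vs, as) = - \<eta> (vs, h x y # as)" for x y vs as
    unfolding weakly_symmetric_def by (metis append_Nil)
  then have *: "\<eta> (y # x # vs, as) = - \<eta> (vs, h x y # as) - \<eta> (x # y # vs, as)" for x y vs as
    by (metis add_diff_cancel_left')
  show ?thesis
  proof
    fix u :: "'z list \<times> 'm list"
    show "arg0 x (arg0 y \<eta>) u = (- argm (h x y) \<eta> - arg0 y (arg0 x \<eta>)) u"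
      using *[of y x "fst u" "snd u"] by (cases u) simp
  qed
qed

lemma ws_arg0 [simp]:
  fixes h :: "'z \<Rightarrow> 'z \<Rightarrow> 'm" and \<eta> :: "'z list \<times> 'm list \<Rightarrow> 'w"
  assumes "weakly_symmetric h \<eta>" shows "weakly_symmetric h (arg0 u \<eta>)"
proof -
  have "\<eta> ((u # us) @ x # y # vs, as) + \<eta> ((u # us) @ y # x # vs, as) = - \<eta> ((u # us) @ vs, h x y # as)" for us x y vs as
    using assms unfolding weakly_symmetric_def by blast
  then show ?thesis by (simp add: weakly_symmetric_def)
qed

lemma ws_argm [simp]:
  fixes h :: "'z \<Rightarrow> 'z \<Rightarrow> 'm" and \<eta> :: "'z list \<times> 'm list \<Rightarrow> 'w"
  assumes "mlin \<eta>" "weakly_symmetric h \<eta>" shows "weakly_symmetric h (argm \<alpha> \<eta>)"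
  using assms(2) mlin_swap0[OF assms(1), of _ \<alpha>] by (simp add: weakly_symmetric_def)

lemma ws_ops [simp]:
  fixes h :: "'z \<Rightarrow> 'z \<Rightarrow> 'm" and \<eta> :: "'z list \<times> 'm list \<Rightarrow> 'w"
  shows ws_diff: "weakly_symmetric h \<eta> \<Longrightarrow> weakly_symmetric h \<zeta> \<Longrightarrow> weakly_symmetric h (\<eta> - \<zeta>)"
    and ws_sc: "weakly_symmetric h \<eta> \<Longrightarrow> weakly_symmetric h (\<lambda>u. t c (\<eta> u))"
    and ws_minus: "weakly_symmetric h \<eta> \<Longrightarrow> weakly_symmetric h (- \<eta>)"
    and ws_zero: "weakly_symmetric h 0"
    and ws_add: "weakly_symmetric h \<eta> \<Longrightarrow> weakly_symmetric h \<zeta> \<Longrightarrow> weakly_symmetric h (\<eta> + \<zeta>)"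
proof -
  show 1: "weakly_symmetric h \<eta> \<Longrightarrow> weakly_symmetric h \<zeta> \<Longrightarrow> weakly_symmetric h (\<eta> - \<zeta>)" for \<eta> \<zeta>
    unfolding weakly_symmetric_def by (simp flip: add_diff_add)
  show 0: "weakly_symmetric h 0" by (simp add: weakly_symmetric_def)
  show 2: "weakly_symmetric h \<eta> \<Longrightarrow> weakly_symmetric h (- \<eta>)" for \<eta>
    using 1[OF 0] by simp
  show "weakly_symmetric h \<eta> \<Longrightarrow> weakly_symmetric h \<zeta> \<Longrightarrow> weakly_symmetric h (\<eta> + \<zeta>)"
    using 1[OF _ 2, of \<eta> \<zeta>] by simp
  show "weakly_symmetric h \<eta> \<Longrightarrow> weakly_symmetric h (\<lambda>u. t c (\<eta> u))"
    unfolding weakly_symmetric_def by (simp flip: scale_right_distrib)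
qed

text \<open>
  Swapping two adjacent arguments permutes the terms that remove one of the two, with opposite signs, so
  these cancel; in the other terms the arguments stay adjacent.
\<close>

lemma ws_shift:
  assumes "mlin \<eta>" "weakly_symmetric h \<eta>"
  shows "weakly_symmetric h (shift \<phi> \<eta>)"
proof -
  have "shift \<phi> \<eta> (us @ x # y # vs, as) + shift \<phi> \<eta> (us @ y # x # vs, as) = - shift \<phi> \<eta> (us @ vs, h x y # as)"
    for us x y vs as using assms
  proof (induction us arbitrary: \<eta>)
    case Nil
    have "shift \<phi> \<eta> (vs, h x y # as) = shift \<phi> (argm (h x y) \<eta>) (vs, as)"
      using fun_cong[OF argm_shift[OF Nil(1), of "h x y" \<phi>], of "(vs, as)"] by simp
    then show ?case using ws_head[OF Nil(2), of x y] by simp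
  next
    case (Cons u us)
    have "\<eta> (us @ x # y # vs, \<phi> u # as) + \<eta> (us @ y # x # vs, \<phi> u # as) = - \<eta> (us @ vs, \<phi> u # h x y # as)"
      using Cons(3) mlin_swap0[OF Cons(2)] by (simp add: weakly_symmetric_def)
    then show ?case using Cons(1)[of "arg0 u \<eta>"] Cons(2,3) by (simp flip: add_diff_add)
  qed
  then show ?thesis by (simp add: weakly_symmetric_def)
qed

lemma arg0_add: "mlin \<eta> \<Longrightarrow> arg0 (x + y) \<eta> = arg0 x \<eta> + arg0 y \<eta>"
  using lin_add[OF mlin_lin0] by blast

lemma arg_0: "mlin \<eta> \<Longrightarrow> argm 0 \<eta> = 0" "mlin \<eta> \<Longrightarrow> arg0 0 \<eta> = 0"
  using lin_zero[OF mlin_linm] lin_zero[OF mlin_lin0] by blast+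

lemma shift_add_map: "mlin \<eta> \<Longrightarrow> shift (\<lambda>z. \<phi> z + \<psi> z) \<eta> = shift \<phi> \<eta> + shift \<psi> \<eta>"
proof
  fix u :: "'z list \<times> 'm list" assume "mlin \<eta>"
  then show "shift (\<lambda>z. \<phi> z + \<psi> z) \<eta> u = (shift \<phi> \<eta> + shift \<psi> \<eta>) u"
  proof (induction \<phi> \<eta> u rule: shift.induct)
    case (2 \<phi> \<eta> x xs as) then show ?case
      using lin_add[OF mlin_slotm[OF 2(2), of xs as]] by simp
  qed simp
qed

lemma shift_zero_map: "mlin \<eta> \<Longrightarrow> (\<And>z. \<phi> z = 0) \<Longrightarrow> shift \<phi> \<eta> = 0"
proof
  fix u :: "'z list \<times> 'm list" assume "mlin \<eta>" "\<And>z. \<phi> z = 0"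
  then show "shift \<phi> \<eta> u = 0 u"
  proof (induction \<phi> \<eta> u rule: shift.induct)
    case (2 \<phi> \<eta> x xs as) then show ?case
      using lin_zero[OF mlin_slotm[OF 2(2), of xs as]] by simp
  qed simp
qed

lemma lie_deriv_lin:
  fixes f :: "'z \<Rightarrow> 'z" and g :: "'m \<Rightarrow> 'm"
  assumes "lin t t l"
  shows "lin (sc t) (sc t) (lie_deriv l f g)"
proof (rule linI; rule ext)
  show "lie_deriv l f g (\<eta> + \<zeta>) u = (lie_deriv l f g \<eta> + lie_deriv l f g \<zeta>) u" for \<eta> \<zeta> :: "'z list \<times> 'm list \<Rightarrow> 'w" and u
    using assms by (induction l f g \<eta> u arbitrary: \<zeta> rule: lie_deriv.induct) (simp_all add: lin_add)
  show "lie_deriv l f g (\<lambda>u. t c (\<eta> u)) u = t c (lie_deriv l f g \<eta> u)" for \<eta> c u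
    using assms by (induction l f g \<eta> u rule: lie_deriv.induct)
      (simp_all add: scale_right_diff_distrib lin_scale)
qed

lemmas lie_deriv_simps = lin_add[OF lie_deriv_lin] lin_diff[OF lie_deriv_lin] lin_minus[OF lie_deriv_lin]
  lin_zero[OF lie_deriv_lin] lin_scale[OF lie_deriv_lin]

lemma argm_lie_deriv: "argm \<alpha> (lie_deriv l f g \<eta>) = lie_deriv l f g (argm \<alpha> \<eta>) - argm (g \<alpha>) \<eta>"
  for \<eta> :: "'z list \<times> 'm list \<Rightarrow> 'w"
proof
  fix u :: "'z list \<times> 'm list"
  obtain xs as where u: "u = (xs, as)" by fastforce
  show "argm \<alpha> (lie_deriv l f g \<eta>) u = (lie_deriv l f g (argm \<alpha> \<eta>) - argm (g \<alpha>) \<eta>) u"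
    unfolding u by (induction xs arbitrary: \<eta>) (simp_all add: arg0_argm)
qed

lemma lie_deriv_lin_map:
  assumes "\<And>w. lin s t (\<lambda>x. l x w)" "\<And>z. lin s sx (\<lambda>x. f x z)" "\<And>\<alpha>. lin s sa (\<lambda>x. g x \<alpha>)" "mlin \<eta>"
  shows "lin s (sc t) (\<lambda>x. lie_deriv (l x) (f x) (g x) \<eta>)"
  unfolding lin_fun_iff
proof
  fix u :: "'z list \<times> 'm list"
  obtain xs as where u: "u = (xs, as)" by fastforce
  show "lin s t (\<lambda>x. lie_deriv (l x) (f x) (g x) \<eta> u)"
    unfolding u using assms(4)
  proof (induction xs arbitrary: \<eta>)
    case Nil
    then show ?case
    proof (induction as arbitrary: \<eta>)
      case Nil then show ?case using assms(1) by simp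
    next
      case (Cons \<alpha> as)
      from Cons show ?case
        using lin_compose[OF assms(3)[of \<alpha>] mlin_slotm[OF Cons(2), of "[]" as]] by (simp add: lin_sub)
    qed
  next
    case (Cons x xs)
    then show ?case
      using lin_compose[OF assms(2)[of x] mlin_slot0[OF Cons(2), of "[]" xs as]] by (simp add: lin_sub)
  qed
qed

text \<open>
  The map \<open>\<phi>\<close> is the only ingredient of \<open>shift \<phi>\<close> that the action can change, and it changes by its own
  derivative \<open>g \<circ> \<phi> - \<phi> \<circ> f\<close>.
\<close>

lemma lie_deriv_shift:
  assumes "lin t t l" "mlin \<eta>"
  shows "lie_deriv l f g (shift \<phi> \<eta>) = shift \<phi> (lie_deriv l f g \<eta>) + shift (\<lambda>x. g (\<phi> x) - \<phi> (f x)) \<eta>"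
proof
  fix u :: "'z list \<times> 'm list"
  obtain xs as where u: "u = (xs, as)" by fastforce
  show "lie_deriv l f g (shift \<phi> \<eta>) u = (shift \<phi> (lie_deriv l f g \<eta>) + shift (\<lambda>x. g (\<phi> x) - \<phi> (f x)) \<eta>) u"
    unfolding u using assms(2)
  proof (induction xs arbitrary: \<eta>)
    case Nil
    have "lie_deriv l f g \<zeta> ([], as) = 0" if "\<And>bs. \<zeta> ([], bs) = 0" for \<zeta>
      using that by (induction as arbitrary: \<zeta>) (simp_all add: lin_zero[OF assms(1)])
    then show ?case by simp
  next
    case (Cons x xs)
    have "lie_deriv l f g \<eta> (xs, \<phi> x # as) = (lie_deriv l f g (argm (\<phi> x) \<eta>) - argm (g (\<phi> x)) \<eta>) (xs, as)"
      by (simp flip: argm_lie_deriv)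
    then show ?case
      using Cons(1)[of "arg0 x \<eta>"] Cons(2) lin_diff[OF mlin_slotm[OF Cons(2), of xs as]]
      by (simp add: arg_shift arg0_lie_deriv lie_deriv_simps assms(1))
  qed
qed

lemma mlin_lie_deriv:
  assumes "lin t t l" "lin sx sx f" "lin sa sa g" "mlin \<eta>"
  shows "mlin (lie_deriv l f g \<eta>)"
proof (rule mlinI)
  show "lin sx t (\<lambda>x. lie_deriv l f g \<eta> (us @ x # vs, as))" for us vs as
    using assms(4)
  proof (induction us arbitrary: \<eta>)
    case Nil
    have "lin sx t (\<lambda>x. \<eta> (f x # vs, as))"
      using lin_compose[OF assms(2) mlin_slot0[OF Nil, of "[]" vs as]] by simp
    moreover have "lin sx t (\<lambda>x. lie_deriv l f g (arg0 x \<eta>) (vs, as))"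
      by (rule lin_at[OF lin_compose[OF mlin_lin0[OF Nil] lie_deriv_lin[OF assms(1)]]])
    ultimately show ?case by (simp add: lin_sub)
  next
    case (Cons u us)
    then show ?case using mlin_slot0[OF Cons(2), of "f u # us" vs as] by (simp add: lin_sub)
  qed
  show "lin sa t (\<lambda>\<alpha>. lie_deriv l f g \<eta> (xs, \<alpha> # as))" for xs as
  proof -
    have "lin sa t (\<lambda>\<alpha>. lie_deriv l f g (argm \<alpha> \<eta>) (xs, as))"
      by (rule lin_at[OF lin_compose[OF mlin_linm[OF assms(4)] lie_deriv_lin[OF assms(1)]]])
    moreover have "lin sa t (\<lambda>\<alpha>. \<eta> (xs, g \<alpha> # as))"
      by (rule lin_compose[OF assms(3) mlin_slotm[OF assms(4)]])
    ultimately have "lin sa t (\<lambda>\<alpha>. (lie_deriv l f g (argm \<alpha> \<eta>) - argm (g \<alpha>) \<eta>) (xs, as))"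
      by (simp add: lin_sub)
    then show ?thesis by (simp flip: argm_lie_deriv)
  qed
  show "lie_deriv l f g \<eta> (xs, as @ \<alpha> # \<beta> # bs) = lie_deriv l f g \<eta> (xs, as @ \<beta> # \<alpha> # bs)" for xs as \<alpha> \<beta> bs
    using assms(4)
  proof (induction xs arbitrary: \<eta>)
    case Nil
    then show ?case
    proof (induction as arbitrary: \<eta>)
      case Nil
      then show ?case by (simp add: argm_swap mlin_swap0 algebra_simps)
    next
      case (Cons \<gamma> as)
      then show ?case using mlin_swap[OF Cons(2), of "[]" "g \<gamma> # as" \<alpha> \<beta> bs] by simp
    qed
  next
    case (Cons x xs)
    then show ?case using mlin_swap[OF Cons(2), of "f x # xs" as \<alpha> \<beta> bs] by simp
  qed
qed

text \<open>
  The hypothesis on \<open>h\<close> says that \<open>h\<close> is invariant, hence so is the relation that it defines.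
\<close>

lemma ws_lie_deriv:
  assumes "lin t t l" "\<And>x y. g (h x y) = h (f x) y + h x (f y)" "mlin \<eta>" "weakly_symmetric h \<eta>"
  shows "weakly_symmetric h (lie_deriv l f g \<eta>)"
proof -
  have "lie_deriv l f g \<eta> (us @ x # y # vs, as) + lie_deriv l f g \<eta> (us @ y # x # vs, as)
      = - lie_deriv l f g \<eta> (us @ vs, h x y # as)" for us x y vs as
    using assms(3,4)
  proof (induction us arbitrary: \<eta>)
    case Nil
    have *: "arg0 y (arg0 x \<eta>) + arg0 x (arg0 y \<eta>) = - argm (h x y) \<eta>" for x y
      using ws_head[OF Nil(2), of x y] by simp
    have "lie_deriv l f g \<eta> (vs, h x y # as) =
      (lie_deriv l f g (argm (h x y) \<eta>) - argm (g (h x y)) \<eta>) (vs, as)"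
      by (simp flip: argm_lie_deriv)
    also have "\<dots> = (- lie_deriv l f g (arg0 y (arg0 x \<eta>) + arg0 x (arg0 y \<eta>))
      + (arg0 y (arg0 (f x) \<eta>) + arg0 (f x) (arg0 y \<eta>)) + (arg0 (f y) (arg0 x \<eta>) + arg0 x (arg0 (f y) \<eta>))) (vs, as)"
      unfolding * by (simp add: assms(2) lin_add[OF mlin_slotm[OF Nil(1)]] lie_deriv_simps[OF assms(1)])
    finally show ?case by (simp add: lie_deriv_simps[OF assms(1)])
  next
    case (Cons u us)
    have "\<eta> ((f u # us) @ x # y # vs, as) + \<eta> ((f u # us) @ y # x # vs, as) = - \<eta> ((f u # us) @ vs, h x y # as)"
      using Cons(3) unfolding weakly_symmetric_def by blast
    then show ?case using Cons(1)[of "arg0 u \<eta>"] Cons(2,3) by (simp flip: add_diff_add)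
  qed
  then show ?thesis by (simp add: weakly_symmetric_def)
qed

lemma lie_deriv_commutator:
  assumes "lin t t l" "lin t t l'" "mlin \<eta>"
    and "\<And>w. l'' w = l (l' w) - l' (l w)" "\<And>x. f'' x = f (f' x) - f' (f x)" "\<And>\<alpha>. g'' \<alpha> = g (g' \<alpha>) - g' (g \<alpha>)"
  shows "lie_deriv l f g (lie_deriv l' f' g' \<eta>) = lie_deriv l' f' g' (lie_deriv l f g \<eta>) + lie_deriv l'' f'' g'' \<eta>"
proof
  fix u :: "'z list \<times> 'm list"
  obtain xs as where u: "u = (xs, as)" by fastforce
  show "lie_deriv l f g (lie_deriv l' f' g' \<eta>) u = (lie_deriv l' f' g' (lie_deriv l f g \<eta>) + lie_deriv l'' f'' g'' \<eta>) u"
    unfolding u using assms(3)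
  proof (induction xs arbitrary: \<eta>)
    case Nil
    then show ?case
    proof (induction as arbitrary: \<eta>)
      case Nil then show ?case by (simp add: assms(4))
    next
      case (Cons \<alpha> as)
      then show ?case using Cons(1)[of "argm \<alpha> \<eta>"]
        by (simp add: argm_lie_deriv lie_deriv_simps assms(1,2,6) lin_diff[OF mlin_slotm])
    qed
  next
    case (Cons x xs)
    then show ?case using Cons(1)[of "arg0 x \<eta>"]
      by (simp add: arg0_lie_deriv lie_deriv_simps assms(1,2,5)
         lin_diff[OF mlin_slot0[OF Cons(2), of "[]" xs as, simplified]])
  qed
qed

lemma shift2_lin: "lin (sc t) (sc t) (shift2 \<tau>)" for \<tau> :: "'z \<Rightarrow> 'z \<Rightarrow> 'm"
proof (rule linI; rule ext)
  show "shift2 \<tau> (\<eta> + \<zeta>) u = (shift2 \<tau> \<eta> + shift2 \<tau> \<zeta>) u" for \<eta> \<zeta> :: "'z list \<times> 'm list \<Rightarrow> 'w" and u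
    by (induction \<tau> \<eta> u arbitrary: \<zeta> rule: shift2.induct) simp_all
  show "shift2 \<tau> (\<lambda>u. t c (\<eta> u)) u = t c (shift2 \<tau> \<eta> u)" for \<eta> c and u :: "'z list \<times> 'm list"
    by (induction \<tau> \<eta> u rule: shift2.induct) (simp_all add: scale_right_distrib)
qed

lemmas shift2_simps [simp] = lin_add[OF shift2_lin] lin_diff[OF shift2_lin] lin_minus[OF shift2_lin]
  lin_zero[OF shift2_lin] lin_scale[OF shift2_lin]

lemma arg0_shift2: "arg0 x (shift2 \<tau> \<eta>) = shift (\<tau> x) \<eta> + shift2 \<tau> (arg0 x \<eta>)"
  by (auto simp: fun_eq_iff)

lemma argm_shift2: "mlin \<eta> \<Longrightarrow> argm \<alpha> (shift2 \<tau> \<eta>) = shift2 \<tau> (argm \<alpha> \<eta>)"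
proof
  fix u :: "'z list \<times> 'm list" assume "mlin \<eta>"
  then show "argm \<alpha> (shift2 \<tau> \<eta>) u = shift2 \<tau> (argm \<alpha> \<eta>) u"
  proof (induction \<tau> \<eta> u rule: shift2.induct)
    case (2 \<tau> \<eta> x xs as) then show ?case
      using fun_cong[OF argm_shift[OF 2(2), of \<alpha> "\<tau> x"], of "(xs, as)"] by (simp add: arg0_argm)
  qed simp
qed

lemma shift2_shift:
  assumes "mlin \<eta>" shows "shift2 \<tau> (shift \<phi> \<eta>) = shift \<phi> (shift2 \<tau> \<eta>)"
proof
  fix u :: "'z list \<times> 'm list"
  obtain xs as where u: "u = (xs, as)" by fastforce
  show "shift2 \<tau> (shift \<phi> \<eta>) u = shift \<phi> (shift2 \<tau> \<eta>) u"
    unfolding u using assms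
  proof (induction xs arbitrary: \<eta>)
    case (Cons x xs)
    have "shift2 \<tau> \<eta> (xs, \<phi> x # as) = shift2 \<tau> (argm (\<phi> x) \<eta>) (xs, as)"
      using fun_cong[OF argm_shift2[OF Cons(2), of "\<phi> x" \<tau>], of "(xs, as)"] by simp
    moreover have "shift (\<tau> x) (shift \<phi> \<eta>) (xs, as) = - shift \<phi> (shift (\<tau> x) \<eta>) (xs, as)"
      using shift_anticommute[OF Cons(2), of "\<tau> x" \<phi>] by simp
    ultimately show ?case using Cons(1)[of "arg0 x \<eta>"] Cons(2) by (simp add: arg_shift arg0_shift2)
  qed simp
qed

lemma cartan_diff_lin:
  fixes d :: "'m \<Rightarrow> 'z"
  assumes "\<And>x. lin (sc t) (sc t) (\<Lambda> x)"
  shows "lin (sc t) (sc t) (cartan_diff d \<Lambda>)"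
proof (rule linI; rule ext)
  show "cartan_diff d \<Lambda> (\<eta> + \<zeta>) u = (cartan_diff d \<Lambda> \<eta> + cartan_diff d \<Lambda> \<zeta>) u" for \<eta> \<zeta> :: "'z list \<times> 'm list \<Rightarrow> 'w" and u
    using assms by (induction d \<Lambda> \<eta> u arbitrary: \<zeta> rule: cartan_diff.induct)
      (simp_all add: lin_on_def)
  show "cartan_diff d \<Lambda> (\<lambda>u. t c (\<eta> u)) u = t c (cartan_diff d \<Lambda> \<eta> u)" for \<eta> c u
    using assms by (induction d \<Lambda> \<eta> u rule: cartan_diff.induct)
      (simp_all add: scale_right_diff_distrib scale_right_distrib lin_on_def)
qed

end

section \<open>Cartan calculus for the differential\<close>

text \<open>
  What the complex of a representation and that of its skew-symmetrization have in common.  The action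
  \<open>\<Lambda>\<^sub>x\<close> involves a bracket \<open>f\<close> of first arguments and a left bracket \<open>\<rho>\<close> with second arguments; \<open>\<mu>\<close> is
  the corresponding right bracket, and \<open>h\<close> measures the failure of \<open>\<rho>\<close> and \<open>\<mu>\<close> to be opposite.  The
  assumptions involve a single \<open>\<Lambda>\<^sub>x\<close> at a time, because the skew-symmetrized bracket satisfies the Jacobi
  identity only up to homotopy.
\<close>

locale cartan = coefficients t sx sa
  for t :: "'k::field \<Rightarrow> 'w::ab_group_add \<Rightarrow> 'w"
    and sx :: "'k \<Rightarrow> 'z::ab_group_add \<Rightarrow> 'z" and sa :: "'k \<Rightarrow> 'm::ab_group_add \<Rightarrow> 'm" +
  fixes d :: "'m \<Rightarrow> 'z" and \<Lambda> :: "'z \<Rightarrow> ('z list \<times> 'm list \<Rightarrow> 'w) \<Rightarrow> 'z list \<times> 'm list \<Rightarrow> 'w"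
    and f :: "'z \<Rightarrow> 'z \<Rightarrow> 'z" and \<rho> :: "'z \<Rightarrow> 'm \<Rightarrow> 'm" and \<mu> :: "'m \<Rightarrow> 'z \<Rightarrow> 'm"
    and h :: "'z \<Rightarrow> 'z \<Rightarrow> 'm"
  assumes h_sym: "h x y = h y x"
    and \<Lambda>_lin: "lin (sc t) (sc t) (\<Lambda> x)"
    and argm_\<Lambda>: "mlin \<eta> \<Longrightarrow> argm \<alpha> (\<Lambda> x \<eta>) = \<Lambda> x (argm \<alpha> \<eta>) - argm (\<rho> x \<alpha>) \<eta>"
    and \<Lambda>_shift: "mlin \<eta> \<Longrightarrow> \<Lambda> x (shift \<phi> \<eta>) = shift \<phi> (\<Lambda> x \<eta>) + shift (\<lambda>z. \<rho> x (\<phi> z) - \<phi> (f x z)) \<eta>"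
    and h_d: "h (d \<alpha>) x = \<rho> x \<alpha> + \<mu> \<alpha> x"
begin

abbreviation "D \<equiv> cartan_diff d \<Lambda>"

lemmas D_lin = cartan_diff_lin[OF \<Lambda>_lin]
lemmas D_simps [simp] = lin_add[OF D_lin] lin_diff[OF D_lin] lin_minus[OF D_lin]
  lin_zero[OF D_lin] lin_scale[OF D_lin]
lemmas \<Lambda>_simps [simp] = lin_add[OF \<Lambda>_lin] lin_diff[OF \<Lambda>_lin] lin_minus[OF \<Lambda>_lin]
  lin_zero[OF \<Lambda>_lin] lin_scale[OF \<Lambda>_lin]

text \<open>
  To pass \<open>\<alpha>\<close> under \<open>D\<close>, the argument \<open>d \<alpha>\<close> has to move past \<open>x\<close>, at the expense of \<open>h(d \<alpha>, x)\<close>.  This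
  turns the bracket \<open>\<rho>\<close>, which comes from \<open>\<Lambda>\<^sub>x\<close>, into the bracket \<open>\<mu>\<close> of the last summand.
\<close>

lemma argm_D:
  assumes "mlin \<eta>" "weakly_symmetric h \<eta>"
  shows "argm \<alpha> (D \<eta>) = D (argm \<alpha> \<eta>) + arg0 (d \<alpha>) \<eta> + shift (\<mu> \<alpha>) \<eta>"
proof
  fix u :: "'z list \<times> 'm list"
  obtain xs as where u: "u = (xs, as)" by fastforce
  show "argm \<alpha> (D \<eta>) u = (D (argm \<alpha> \<eta>) + arg0 (d \<alpha>) \<eta> + shift (\<mu> \<alpha>) \<eta>) u"
    unfolding u using assms
  proof (induction xs arbitrary: \<eta>)
    case (Cons x xs)
    have "\<Lambda> x \<eta> (xs, \<alpha> # as) = \<Lambda> x (argm \<alpha> \<eta>) (xs, as) - \<eta> (xs, \<rho> x \<alpha> # as)"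
      using fun_cong[OF argm_\<Lambda>[OF Cons(2)], of \<alpha> x "(xs, as)"] by simp
    moreover have "\<eta> (x # d \<alpha> # xs, as) = - (\<eta> (xs, \<rho> x \<alpha> # as) + \<eta> (xs, \<mu> \<alpha> x # as)) - \<eta> (d \<alpha> # x # xs, as)"
      using fun_cong[OF ws_head[OF Cons(3), of x "d \<alpha>"], of "(xs, as)"]
      by (simp add: h_sym[of x] h_d lin_add[OF mlin_slotm[OF Cons(2)]])
    ultimately show ?case using Cons(1)[of "arg0 x \<eta>"] Cons(2,3)
      by (simp add: arg0_argm)
  qed simp
qed

text \<open>
  The operator that is null-homotopic by means of \<open>shift \<phi>\<close>.  The next lemmas determine it recursively.
  It is used for three choices of \<open>\<phi>\<close>: a bracket with an element of \<open>L\<^sup>-\<^sup>1\<close> (to prove \<open>D\<^sup>2 = 0\<close>), a left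
  inverse of \<open>d\<close> (for the homotopy), and \<open>h\<^sub>2(x,-)\<close> (for the skew-symmetrization).
\<close>

definition K :: "('z \<Rightarrow> 'm) \<Rightarrow> ('z list \<times> 'm list \<Rightarrow> 'w) \<Rightarrow> 'z list \<times> 'm list \<Rightarrow> 'w"
  where "K \<phi> \<eta> = D (shift \<phi> \<eta>) + shift \<phi> (D \<eta>)"

lemma K_Nil: "K \<phi> \<eta> ([], []) = 0"
  and K_argm: "mlin \<eta> \<Longrightarrow> K \<phi> \<eta> ([], \<alpha> # as) = K \<phi> (argm \<alpha> \<eta>) ([], as) + \<eta> ([], \<phi> (d \<alpha>) # as)"
  by (simp_all add: K_def argm_shift)

lemma K_arg0:
  assumes "mlin \<eta>" "weakly_symmetric h \<eta>"
  shows "arg0 x (K \<phi> \<eta>) = K \<phi> (arg0 x \<eta>) + arg0 (d (\<phi> x)) \<eta>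
    + shift (\<lambda>z. \<rho> x (\<phi> z) - \<phi> (f x z) + \<mu> (\<phi> x) z) \<eta>"
  by (simp add: K_def arg0_cartan arg_shift \<Lambda>_shift argm_D shift_add_map assms)

end

section \<open>The differential of a representation\<close>

text \<open>
  One of the two spaces of the complex \<open>V\<close>.  As \<open>l\<^sub>\<alpha> = 0\<close>, each of them is a module over the Leibniz
  algebra \<open>L\<^sup>0\<close> on which \<open>d L\<^sup>-\<^sup>1\<close> acts trivially.
\<close>

locale lie2_module = hemistrict_lie2 L + coefficients t "smul_0 L" "smul_m L"
  for L :: "('k::field_char_0, 'm::ab_group_add, 'z::ab_group_add) lie2"
    and t :: "'k \<Rightarrow> 'w::ab_group_add \<Rightarrow> 'w" +
  fixes l :: "'z \<Rightarrow> 'w \<Rightarrow> 'w"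
  assumes l_bilin: "bilin (smul_0 L) t t l"
    and l_br: "l (br_00 L x y) w = l x (l y w) - l y (l x w)"
    and l_dif: "l (dif L \<alpha>) w = 0"
begin

sublocale X: vector_space "smul_0 L" by (rule vs_0)
sublocale A: vector_space "smul_m L" by (rule vs_m)

lemma bilin_lin: "bilin s u v f \<Longrightarrow> lin u v (f x)" "bilin s u v f \<Longrightarrow> lin s v (\<lambda>x. f x y)"
  by (simp_all add: bilin_def linear_imp_lin)

lemmas bilin_lins = bilin_lin[OF br_00_bilin] bilin_lin[OF br_0m_bilin] bilin_lin[OF br_m0_bilin]
  bilin_lin[OF alt_bilin] bilin_lin[OF l_bilin] linear_imp_lin[OF dif_linear]

abbreviation Lie :: "'z \<Rightarrow> ('z list \<times> 'm list \<Rightarrow> 'w) \<Rightarrow> 'z list \<times> 'm list \<Rightarrow> 'w"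
  where "Lie x \<equiv> lie_deriv (l x) (br_00 L x) (br_0m L x)"

sublocale R: cartan t "smul_0 L" "smul_m L" "dif L" Lie "br_00 L" "br_0m L" "br_m0 L" "alt L"
proof
  show "alt L (dif L \<alpha>) x = br_0m L x \<alpha> + br_m0 L \<alpha> x" for \<alpha> x
    by (simp add: alt_0m alt_sym)
qed (simp_all add: alt_sym lie_deriv_lin argm_lie_deriv lie_deriv_shift bilin_lins)

abbreviation ws :: "('z list \<times> 'm list \<Rightarrow> 'w) \<Rightarrow> bool" where "ws \<equiv> weakly_symmetric (alt L)"

lemma mlin_Lie [simp]: "mlin \<eta> \<Longrightarrow> mlin (Lie x \<eta>)"
  by (simp add: mlin_lie_deriv bilin_lins)

lemma ws_Lie [simp]: "mlin \<eta> \<Longrightarrow> ws \<eta> \<Longrightarrow> ws (Lie x \<eta>)"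
  by (simp add: ws_lie_deriv bilin_lins br_alt_right)

lemma Lie_lin: "mlin \<eta> \<Longrightarrow> lin (smul_0 L) (sc t) (\<lambda>x. Lie x \<eta>)"
  by (rule lie_deriv_lin_map) (simp_all add: bilin_lins)

lemma Lie_Lie: "mlin \<eta> \<Longrightarrow> Lie x (Lie y \<eta>) = Lie y (Lie x \<eta>) + Lie (br_00 L x y) \<eta>"
  by (rule lie_deriv_commutator) (simp_all add: bilin_lins l_br leibniz_000[of x y] leibniz_00m[of x y])

text \<open>
  Linearity in the second list is visible only from \<open>argm_D\<close>, since the recursion for \<open>D\<close> consumes the
  first list before it.
\<close>

lemma mlin_D [simp]:
  assumes "mlin \<eta>" "ws \<eta>" shows "mlin (R.D \<eta>)"
proof (rule mlinI)
  show "lin (smul_0 L) t (\<lambda>x. R.D \<eta> (us @ x # vs, as))" for us vs as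
    using assms
  proof (induction us arbitrary: \<eta>)
    case Nil
    have "lin (smul_0 L) t (\<lambda>x. (Lie x \<eta>) (vs, as))" by (rule lin_at[OF Lie_lin[OF Nil(1)]])
    moreover have "lin (smul_0 L) t (\<lambda>x. R.D (arg0 x \<eta>) (vs, as))"
      by (rule lin_at[OF lin_compose[OF mlin_lin0[OF Nil(1)] R.D_lin]])
    ultimately show ?case by (simp add: lin_sub)
  next
    case (Cons u us)
    then show ?case by (simp add: lin_sub mlin_slot0[OF mlin_Lie])
  qed
  show "lin (smul_m L) t (\<lambda>\<alpha>. R.D \<eta> (xs, \<alpha> # as))" for xs as
  proof -
    have "lin (smul_m L) t (\<lambda>\<alpha>. (R.D (argm \<alpha> \<eta>) + arg0 (dif L \<alpha>) \<eta> + shift (br_m0 L \<alpha>) \<eta>) (xs, as))"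
      using lin_at[OF lin_compose[OF mlin_linm[OF assms(1)] R.D_lin], where u = "(xs, as)"]
        lin_compose[OF bilin_lins(11) mlin_slot0[OF assms(1), of "[]" xs as]]
        lin_at[OF shift_lin_map[of _ "br_m0 L", OF bilin_lins(6) assms(1)], where u = "(xs, as)"]
      by (simp add: lin_plus)
    then show ?thesis by (simp flip: R.argm_D[OF assms])
  qed
  show "R.D \<eta> (xs, as @ \<alpha> # \<beta> # bs) = R.D \<eta> (xs, as @ \<beta> # \<alpha> # bs)" for xs as \<alpha> \<beta> bs
    using assms
  proof (induction xs arbitrary: \<eta>)
    case Nil
    then show ?case
    proof (induction as arbitrary: \<eta>)
      case Nil then show ?case by (simp add: argm_swap[of _ \<alpha> \<beta>] algebra_simps)
    next
      case (Cons \<gamma> as)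
      then show ?case using mlin_swap[OF Cons(2), of "[dif L \<gamma>]" as \<alpha> \<beta> bs] by simp
    qed
  next
    case (Cons x xs)
    then show ?case using mlin_swap[OF mlin_Lie[OF Cons(2)], of x xs as \<alpha> \<beta> bs] by simp
  qed
qed

text \<open>
  All the data from which \<open>D\<close> is built are invariant under \<open>x\<close>.
\<close>

lemma Lie_D:
  assumes "mlin \<eta>" "ws \<eta>" shows "Lie x (R.D \<eta>) = R.D (Lie x \<eta>)"
proof
  fix u :: "'z list \<times> 'm list"
  obtain xs as where u: "u = (xs, as)" by fastforce
  show "Lie x (R.D \<eta>) u = R.D (Lie x \<eta>) u"
    unfolding u using assms
  proof (induction xs arbitrary: \<eta>)
    case Nil
    then show ?case
    proof (induction as arbitrary: \<eta>)
      case Nil then show ?case by (simp add: lin_zero[OF bilin_lins(9)])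
    next
      case (Cons \<alpha> as)
      have "lie_deriv (l x) (br_00 L x) (br_0m L x) \<zeta> ([], as) = 0" if "\<And>bs. \<zeta> ([], bs) = 0" for \<zeta>
        using that by (induction as arbitrary: \<zeta>) (simp_all add: lin_zero[OF bilin_lins(9)])
      then have "Lie x (shift (br_m0 L \<alpha>) \<eta>) ([], as) = 0" by simp
      then show ?case using Cons(1)[of "argm \<alpha> \<eta>"] Cons(2,3)
        by (simp add: R.argm_D lie_deriv_simps bilin_lins argm_lie_deriv dif_br_0m)
    qed
  next
    case (Cons y ys)
    show ?case using Cons(1)[of "arg0 y \<eta>"] Cons(2,3)
      by (simp add: arg0_cartan arg0_lie_deriv lie_deriv_simps bilin_lins Lie_Lie[of \<eta> x y])
  qed
qed

text \<open>
  By the Cartan formula, the anticommutator of \<open>i\<^sub>x\<close> and \<open>i\<^sub>y\<close> applied to \<open>D \<eta>\<close> involves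
  \<open>[x,y] + [y,x] = d h\<^sub>2(x,y)\<close>, as does \<open>argm_D\<close> for \<open>\<alpha> = h\<^sub>2(x,y)\<close>.  The remaining term
  \<open>shift [h\<^sub>2(x,y),-]\<close> vanishes by \<open>br_alt_left\<close>.
\<close>

lemma ws_D [simp]:
  assumes "mlin \<eta>" "ws \<eta>" shows "ws (R.D \<eta>)"
proof -
  have "R.D \<eta> (us @ x # y # vs, as) + R.D \<eta> (us @ y # x # vs, as) = - R.D \<eta> (us @ vs, alt L x y # as)"
    for us x y vs as
    using assms
  proof (induction us arbitrary: \<eta>)
    case Nil
    have "shift (br_m0 L (alt L x y)) \<eta> = 0"
      by (rule shift_zero_map) (simp_all add: br_alt_left Nil)
    then have 1: "R.D \<eta> (vs, alt L x y # as) = (R.D (argm (alt L x y) \<eta>) + arg0 (dif L (alt L x y)) \<eta>) (vs, as)"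
      using fun_cong[OF R.argm_D[OF Nil, of "alt L x y"], of "(vs, as)"] Nil(1) by simp
    have 2: "argm (alt L x y) \<eta> = - (arg0 y (arg0 x \<eta>) + arg0 x (arg0 y \<eta>))"
      using ws_head[OF Nil(2), of x y] by simp
    have 3: "arg0 (dif L (alt L x y)) \<eta> = arg0 (br_00 L x y) \<eta> + arg0 (br_00 L y x) \<eta>"
      by (simp add: arg0_add[OF Nil(1)] flip: alt_00)
    show ?case using 1[unfolded 2 3] by (simp add: algebra_simps)
  next
    case (Cons u us)
    have "Lie u \<eta> (us @ x # y # vs, as) + Lie u \<eta> (us @ y # x # vs, as) = - Lie u \<eta> (us @ vs, alt L x y # as)"
      using ws_Lie[OF Cons(2,3), of u] unfolding weakly_symmetric_def by blast
    then show ?case using Cons(1)[of "arg0 u \<eta>"] Cons(2,3) by (simp flip: add_diff_add)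
  qed
  then show ?thesis by (simp add: weakly_symmetric_def)
qed

text \<open>
  For \<open>\<phi> = [\<alpha>,-]\<close> the quadratic term of \<open>K\<close> vanishes by the Leibniz rule, and the linear one is the
  action of \<open>- d \<alpha>\<close>.
\<close>

lemma K_ad:
  assumes "mlin \<eta>" "ws \<eta>"
  shows "R.K (br_m0 L \<alpha>) \<eta> = - Lie (dif L \<alpha>) \<eta>"
proof
  fix u :: "'z list \<times> 'm list"
  obtain xs as where u: "u = (xs, as)" by fastforce
  show "R.K (br_m0 L \<alpha>) \<eta> u = (- Lie (dif L \<alpha>) \<eta>) u"
    unfolding u using assms
  proof (induction xs arbitrary: \<eta>)
    case Nil
    then show ?case
    proof (induction as arbitrary: \<eta>)
      case Nil then show ?case by (simp add: R.K_Nil l_dif)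
    next
      case (Cons \<beta> as)
      then show ?case using Cons(1)[of "argm \<beta> \<eta>"] dif_br_mm[of \<alpha> \<beta>]
        by (simp add: R.K_argm)
    qed
  next
    case (Cons x xs)
    have "shift (\<lambda>z. br_0m L x (br_m0 L \<alpha> z) - br_m0 L \<alpha> (br_00 L x z) + br_m0 L (br_m0 L \<alpha> x) z) \<eta> = 0"
      by (rule shift_zero_map) (simp_all add: leibniz_m00 Cons)
    then show ?case
      using Cons(1)[of "arg0 x \<eta>"] Cons(2,3) fun_cong[OF R.K_arg0[OF Cons(2,3), of x "br_m0 L \<alpha>"], of "(xs, as)"]
      by (simp add: dif_br_m0)
  qed
qed

text \<open>
  \<open>D\<^sup>2\<close> commutes with all \<open>i\<^sub>x\<close> as \<open>D\<close> commutes with the action, so only first arguments of the form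
  \<open>d \<alpha>\<close> matter; there the Cartan formula for \<open>d \<alpha>\<close> and \<open>K_ad\<close> cancel.
\<close>

lemma D_D:
  assumes "mlin \<eta>" "ws \<eta>" shows "R.D (R.D \<eta>) = 0"
proof
  fix u :: "'z list \<times> 'm list"
  obtain xs as where u: "u = (xs, as)" by fastforce
  show "R.D (R.D \<eta>) u = 0 u"
    unfolding u using assms
  proof (induction xs arbitrary: \<eta>)
    case Nil
    then show ?case
    proof (induction as arbitrary: \<eta>)
      case (Cons \<alpha> as)
      have "R.D (shift (br_m0 L \<alpha>) \<eta>) ([], as) = - Lie (dif L \<alpha>) \<eta> ([], as)"
        using fun_cong[OF K_ad[OF Cons(2,3), of \<alpha>], of "([], as)"] by (simp add: R.K_def)
      then show ?case using Cons(1)[of "argm \<alpha> \<eta>"] Cons(2,3) by (simp add: R.argm_D)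
    qed simp
  next
    case (Cons x xs)
    then show ?case using Cons(1)[of "arg0 x \<eta>"] by (simp add: arg0_cartan Lie_D)
  qed
qed

end

section \<open>The homotopy that makes cochains basic\<close>

definition homogeneous :: "int \<Rightarrow> ('z list \<times> 'm list \<Rightarrow> 'w::zero) \<Rightarrow> bool"
  where "homogeneous p \<eta> \<longleftrightarrow> (\<forall>xs as. int (length xs) + 2 * int (length as) \<noteq> p \<longrightarrow> \<eta> (xs, as) = 0)"

lemma hom_apply: "homogeneous p \<eta> \<Longrightarrow> int (length xs) + 2 * int (length as) \<noteq> p \<Longrightarrow> \<eta> (xs, as) = 0"
  by (simp add: homogeneous_def)

lemma hom_arg0 [simp]: "homogeneous p \<eta> \<Longrightarrow> homogeneous (p - 1) (arg0 x \<eta>)"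
  and hom_argm [simp]: "homogeneous p \<eta> \<Longrightarrow> homogeneous (p - 2) (argm \<alpha> \<eta>)"
  by (auto simp: homogeneous_def)

lemma hom_shift [simp]:
  assumes "homogeneous p \<eta>" shows "homogeneous (p - 1) (shift \<phi> \<eta>)"
proof -
  have "shift \<phi> \<eta> (xs, as) = 0" if "int (length xs) + 2 * int (length as) \<noteq> p - 1" for xs as
    using assms that
  proof (induction xs arbitrary: p \<eta>)
    case (Cons x xs)
    have "\<eta> (xs, \<phi> x # as) = 0" by (rule hom_apply[OF Cons(2)]) (use Cons(3) in auto)
    moreover have "shift \<phi> (arg0 x \<eta>) (xs, as) = 0"
      by (rule Cons(1)[of "p - 1"]) (use Cons(2,3) in auto)
    ultimately show ?case by simp
  qed simp
  then show ?thesis by (simp add: homogeneous_def)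
qed

lemma hom_lie_deriv:
  assumes "l 0 = 0" "homogeneous p \<eta>" shows "homogeneous p (lie_deriv l f g \<eta>)"
proof -
  have "lie_deriv l f g \<eta> (xs, as) = 0" if "int (length xs) + 2 * int (length as) \<noteq> p" for xs as
    using assms(2) that
  proof (induction xs arbitrary: p \<eta>)
    case Nil
    then show ?case
    proof (induction as arbitrary: p \<eta>)
      case Nil then show ?case using assms(1) by (simp add: homogeneous_def)
    next
      case (Cons \<alpha> as)
      have "\<eta> ([], g \<alpha> # as) = 0" by (rule hom_apply[OF Cons(2)]) (use Cons(3) in auto)
      moreover have "lie_deriv l f g (argm \<alpha> \<eta>) ([], as) = 0"
        by (rule Cons(1)[of "p - 2"]) (use Cons(2,3) in auto)
      ultimately show ?case by simp
    qed
  next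
    case (Cons x xs)
    have "\<eta> (f x # xs, as) = 0" by (rule hom_apply[OF Cons(2)]) (use Cons(3) in auto)
    moreover have "lie_deriv l f g (arg0 x \<eta>) (xs, as) = 0"
      by (rule Cons(1)[of "p - 1"]) (use Cons(2,3) in auto)
    ultimately show ?case by simp
  qed
  then show ?thesis by (simp add: homogeneous_def)
qed

context coefficients
begin
lemma hom_ops [simp]: "homogeneous p \<eta> \<Longrightarrow> homogeneous p \<zeta> \<Longrightarrow> homogeneous p (\<eta> + \<zeta>)"
  "homogeneous p \<eta> \<Longrightarrow> homogeneous p \<zeta> \<Longrightarrow> homogeneous p (\<eta> - \<zeta>)" "homogeneous p \<eta> \<Longrightarrow> homogeneous p (\<lambda>u. t c (\<eta> u))" "homogeneous p 0"
  for \<eta> \<zeta> :: "'z list \<times> 'm list \<Rightarrow> 'w"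
  by (simp_all add: homogeneous_def)
end

context lie2_module
begin

lemma hom_D [simp]:
  assumes "homogeneous p \<eta>" shows "homogeneous (p + 1) (R.D \<eta>)"
proof -
  have "R.D \<eta> (xs, as) = 0" if "int (length xs) + 2 * int (length as) \<noteq> p + 1" for xs as
    using assms that
  proof (induction xs arbitrary: p \<eta>)
    case Nil
    then show ?case
    proof (induction as arbitrary: p \<eta>)
      case (Cons \<alpha> as)
      have "\<eta> ([dif L \<alpha>], as) = 0" by (rule hom_apply[OF Cons(2)]) (use Cons(3) in auto)
      moreover have "R.D (argm \<alpha> \<eta>) ([], as) = 0"
        by (rule Cons(1)[of "p - 2"]) (use Cons(2,3) in auto)
      ultimately show ?case by simp
    qed simp
  next
    case (Cons x xs)
    have "Lie x \<eta> (xs, as) = 0"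
      by (rule hom_apply[OF hom_lie_deriv[OF _ Cons(2)]])
        (use Cons(3) in \<open>auto simp: lin_zero[OF bilin_lins(9)]\<close>)
    moreover have "R.D (arg0 x \<eta>) (xs, as) = 0"
      by (rule Cons(1)[of "p - 1"]) (use Cons(2,3) in auto)
    ultimately show ?case by simp
  qed
  then show ?thesis by (simp add: homogeneous_def)
qed

end

text \<open>
  The cochains that come from \<open>L\<^sup>0 / d L\<^sup>-\<^sup>1\<close>.
\<close>

definition basic :: "('m \<Rightarrow> 'z) \<Rightarrow> ('z list \<times> 'm list \<Rightarrow> 'w::zero) \<Rightarrow> bool"
  where "basic d \<eta> \<longleftrightarrow> (\<forall>xs as. as \<noteq> [] \<or> (\<exists>x\<in>set xs. x \<in> range d) \<longrightarrow> \<eta> (xs, as) = 0)"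

definition vanishes_above :: "nat \<Rightarrow> ('z list \<times> 'm list \<Rightarrow> 'w::zero) \<Rightarrow> bool"
  where "vanishes_above q \<eta> \<longleftrightarrow> (\<forall>xs as. q < length as \<longrightarrow> \<eta> (xs, as) = 0)"

lemma vanishes_above_shift:
  "vanishes_above q \<eta> \<Longrightarrow> q \<le> length as \<Longrightarrow> shift \<phi> \<eta> (xs, as) = 0"
  by (induction xs arbitrary: \<eta>) (auto simp: vanishes_above_def)

lemma vanishes_above_arg0: "vanishes_above q \<eta> \<Longrightarrow> vanishes_above q (arg0 x \<eta>)"
  by (simp add: vanishes_above_def)

text \<open>
  Every term of \<open>shift\<close> has an argument in the second list.
\<close>

lemma basic_shift: "basic d \<eta> \<Longrightarrow> shift \<phi> \<eta> = 0"
proof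
  fix u assume "basic d \<eta>"
  then have "vanishes_above 0 \<eta>" by (auto simp: basic_def vanishes_above_def)
  then show "shift \<phi> \<eta> u = 0 u" using vanishes_above_shift by (cases u) fastforce
qed

text \<open>
  The values of \<open>k\<close> in the steps \<open>\<eta> \<rightarrow> \<eta> - N \<eta> / k\<close>: one round of all possible eigenvalues for each
  possible length of the second list.  The list depends on the degree alone, so that the same
  steps can be applied to both components of a cochain.
\<close>

definition schedule :: "nat \<Rightarrow> nat list"
  where "schedule M = concat (replicate (Suc M) [1..<Suc M])"

locale split_lie2_module = lie2_module L t l
  for L :: "('k::field_char_0, 'm::ab_group_add, 'z::ab_group_add) lie2"
    and t :: "'k \<Rightarrow> 'w::ab_group_add \<Rightarrow> 'w" and l +
  fixes s :: "'z \<Rightarrow> 'm"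
  assumes s_lin: "lin (smul_0 L) (smul_m L) s" and s_dif [simp]: "s (dif L \<alpha>) = \<alpha>"
begin

text \<open>
  Lists of arguments adapted to the decomposition \<open>L\<^sup>0 = d L\<^sup>-\<^sup>1 \<oplus> ker s\<close>.
\<close>

definition splits :: "'z list \<Rightarrow> bool"
  where "splits xs \<longleftrightarrow> (\<forall>x\<in>set xs. x \<in> range (dif L) \<or> s x = 0)"

definition exacts :: "'z list \<Rightarrow> nat"
  where "exacts xs = length (filter (\<lambda>x. x \<in> range (dif L)) xs)"

text \<open>
  The name refers to the number operator, which is the leading part by \<open>N_top\<close>.
\<close>

abbreviation "N \<equiv> R.K s"

lemma mlin_N [simp]: "mlin \<eta> \<Longrightarrow> ws \<eta> \<Longrightarrow> mlin (N \<eta>)"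
  and ws_N [simp]: "mlin \<eta> \<Longrightarrow> ws \<eta> \<Longrightarrow> ws (N \<eta>)"
  and hom_N [simp]: "homogeneous p \<eta> \<Longrightarrow> homogeneous p (N \<eta>)"
  using hom_D[of "p - 1" "shift s \<eta>"] hom_shift[of "p + 1" "R.D \<eta>"]
  by (simp_all add: R.K_def mlin_shift ws_shift s_lin)

lemma N_Nil: "mlin \<eta> \<Longrightarrow> N \<eta> ([], as) = t (of_nat (length as)) (\<eta> ([], as))"
  by (induction as arbitrary: \<eta>) (simp_all add: R.K_Nil R.K_argm scale_left_distrib)

text \<open>
  The quadratic term of \<open>K_arg0\<close> evaluates \<open>\<eta>\<close> on a longer second list, where it is zero.
\<close>

lemma N_Cons:
  "mlin \<eta> \<Longrightarrow> ws \<eta> \<Longrightarrow> vanishes_above q \<eta> \<Longrightarrow> q \<le> length as \<Longrightarrow>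
    N \<eta> (x # xs, as) = N (arg0 x \<eta>) (xs, as) + \<eta> (dif L (s x) # xs, as)"
  using fun_cong[OF R.K_arg0[of \<eta> x s], of "(xs, as)"] by (simp add: vanishes_above_shift)

lemma vanishes_above_N:
  assumes "mlin \<eta>" "ws \<eta>" "vanishes_above q \<eta>"
  shows "vanishes_above q (N \<eta>)"
proof -
  have "N \<eta> (xs, as) = 0" if "q < length as" for xs as
    using assms
  proof (induction xs arbitrary: \<eta>)
    case Nil then show ?case using that by (simp add: N_Nil vanishes_above_def)
  next
    case (Cons x xs)
    then show ?case using that by (simp add: N_Cons[of _ q] vanishes_above_arg0) (simp add: vanishes_above_def)
  qed
  then show ?thesis by (simp add: vanishes_above_def)
qed

text \<open>
  As \<open>d s\<close> is the identity on \<open>d L\<^sup>-\<^sup>1\<close> and zero on \<open>ker s\<close>, each argument of the first list contributes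
  the value once or not at all; those of the second list are counted by \<open>N_Nil\<close>.
\<close>

lemma N_top:
  assumes "mlin \<eta>" "ws \<eta>" "vanishes_above q \<eta>" "q \<le> length as" "splits xs"
  shows "N \<eta> (xs, as) = t (of_nat (length as + exacts xs)) (\<eta> (xs, as))"
  using assms
proof (induction xs arbitrary: \<eta>)
  case Nil then show ?case by (simp add: N_Nil exacts_def)
next
  case (Cons x xs)
  have IH: "N (arg0 x \<eta>) (xs, as) = t (of_nat (length as + exacts xs)) (\<eta> (x # xs, as))"
    using Cons by (simp add: vanishes_above_arg0 splits_def)
  show ?case
  proof (cases "x \<in> range (dif L)")
    case True
    then have "dif L (s x) = x" by auto
    then show ?thesis using Cons True by (simp add: N_Cons[of _ q] IH exacts_def scale_left_distrib)
  next
    case False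
    then have "s x = 0" using Cons(6) by (simp add: splits_def)
    then show ?thesis using Cons False lin_zero[OF mlin_slot0[OF Cons(2), of "[]" xs as]]
      by (simp add: N_Cons[of _ q] IH exacts_def lin_zero[OF bilin_lins(11)])
  qed
qed

definition relax :: "nat \<Rightarrow> ('z list \<times> 'm list \<Rightarrow> 'w) \<Rightarrow> 'z list \<times> 'm list \<Rightarrow> 'w"
  where "relax n \<eta> = \<eta> - (\<lambda>u. t (1 / of_nat n) (N \<eta> u))"

lemma relax_closed [simp]:
  "mlin \<eta> \<Longrightarrow> ws \<eta> \<Longrightarrow> mlin (relax n \<eta>)" "mlin \<eta> \<Longrightarrow> ws \<eta> \<Longrightarrow> ws (relax n \<eta>)" "homogeneous p \<eta> \<Longrightarrow> homogeneous p (relax n \<eta>)"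
  by (simp_all add: relax_def)

lemma vanishes_above_relax:
  "mlin \<eta> \<Longrightarrow> ws \<eta> \<Longrightarrow> vanishes_above q \<eta> \<Longrightarrow> vanishes_above q (relax n \<eta>)"
  using vanishes_above_N[of \<eta> q] by (simp add: relax_def vanishes_above_def)

lemma fold_relax_closed [simp]:
  assumes "mlin \<eta>" "ws \<eta>"
  shows "mlin (fold relax ns \<eta>) \<and> ws (fold relax ns \<eta>)"
  using assms by (induction ns arbitrary: \<eta>) simp_all

lemma fold_relax_hom [simp]: "homogeneous p \<eta> \<Longrightarrow> homogeneous p (fold relax ns \<eta>)"
  by (induction ns arbitrary: \<eta>) simp_all

lemma fold_relax_vanishes_above:
  "mlin \<eta> \<Longrightarrow> ws \<eta> \<Longrightarrow> vanishes_above q \<eta> \<Longrightarrow> vanishes_above q (fold relax ns \<eta>)"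
  by (induction ns arbitrary: \<eta>) (simp_all add: vanishes_above_relax)

text \<open>
  On the longest second lists on which \<open>\<eta>\<close> is not zero, the step for \<open>k\<close> multiplies by
  \<open>1 - (q + exacts xs) / k\<close>, which is zero for one of the steps unless the value is zero from the start.
\<close>

lemma fold_relax_kills:
  assumes "mlin \<eta>" "ws \<eta>" "vanishes_above q \<eta>" "length as = q" "splits xs" "0 \<notin> set ns"
    and "\<eta> (xs, as) = 0 \<or> q + exacts xs \<in> set ns"
  shows "fold relax ns \<eta> (xs, as) = 0"
  using assms
proof (induction ns arbitrary: \<eta>)
  case (Cons n ns)
  have *: "relax n \<eta> (xs, as) = \<eta> (xs, as) - t (of_nat (q + exacts xs) / of_nat n) (\<eta> (xs, as))"
    using Cons by (simp add: relax_def N_top[of _ q])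
  have "relax n \<eta> (xs, as) = 0 \<or> q + exacts xs \<in> set ns"
    using Cons(8) Cons(7) unfolding * by (auto simp del: of_nat_add)
  then show ?case using Cons by (simp add: vanishes_above_relax)
qed simp

text \<open>
  Expand every argument as \<open>x = d (s x) + (x - d (s x))\<close>, except those already in \<open>d L\<^sup>-\<^sup>1\<close>, which have to
  be kept because they may be the reason why \<open>\<eta>\<close> vanishes.
\<close>

lemma splits_suffice:
  assumes "mlin \<eta>" and "\<And>xs. splits xs \<Longrightarrow> B \<or> 0 < exacts xs \<Longrightarrow> \<eta> (xs, as) = 0"
    and "B \<or> (\<exists>x\<in>set xs. x \<in> range (dif L))"
  shows "\<eta> (xs, as) = 0"
proof -
  have "\<eta> (us @ vs, as) = 0" if "splits vs" "B \<or> (\<exists>x\<in>set (us @ vs). x \<in> range (dif L))" for us vs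
    using that
  proof (induction us arbitrary: vs rule: rev_induct)
    case Nil
    then show ?case using assms(2)[of vs] by (auto simp: exacts_def filter_empty_conv)
  next
    case (snoc x us)
    show ?case
    proof (cases "x \<in> range (dif L)")
      case True
      then show ?thesis using snoc(1)[of "x # vs"] snoc(2,3) by (auto simp: splits_def)
    next
      case False
      have "s (x - dif L (s x)) = 0" by (simp add: lin_diff[OF s_lin])
      then have "\<eta> (us @ (x - dif L (s x)) # vs, as) = 0" "\<eta> (us @ dif L (s x) # vs, as) = 0"
        using snoc(1)[of "(x - dif L (s x)) # vs"] snoc(1)[of "dif L (s x) # vs"] snoc(2,3) False
        by (auto simp: splits_def)
      then show ?thesis
        using lin_add[OF mlin_slot0[OF assms(1), of us vs as], of "x - dif L (s x)" "dif L (s x)"] by simp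
    qed
  qed
  from this[of "[]" xs] show ?thesis using assms(3) by (simp add: splits_def)
qed

lemma relax_round:
  assumes "mlin \<eta>" "ws \<eta>" "homogeneous p \<eta>" "p \<le> int M" "vanishes_above (Suc q) \<eta>"
  shows "vanishes_above q (fold relax [1..<Suc M] \<eta>)"
  unfolding vanishes_above_def
proof (intro allI impI)
  fix xs :: "'z list" and as :: "'m list" assume q: "q < length as"
  show "fold relax [1..<Suc M] \<eta> (xs, as) = 0"
  proof (cases "length as = Suc q \<and> int (length xs) + 2 * int (length as) = p")
    case False
    then consider "Suc q < length as" | "int (length xs) + 2 * int (length as) \<noteq> p" using q by linarith
    then show ?thesis
      using fold_relax_vanishes_above[OF assms(1,2,5), of "[1..<Suc M]"] hom_apply[OF fold_relax_hom[OF assms(3)]]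
      by cases (simp_all only: vanishes_above_def)
  next
    case True
    show ?thesis
    proof (rule splits_suffice[where B = True])
      fix ys assume ys: "splits ys"
      show "fold relax [1..<Suc M] \<eta> (ys, as) = 0"
      proof (cases "length ys = length xs")
        case False
        then show ?thesis using hom_apply[OF fold_relax_hom[OF assms(3)], of ys as "[1..<Suc M]"] True by (auto simp del: upt_Suc)
      next
        case len: True
        have "exacts ys \<le> length ys" by (simp add: exacts_def)
        then show ?thesis
          using fold_relax_kills[OF assms(1,2,5), of as ys "[1..<Suc M]"] True len ys assms(4)
          by (auto simp del: upt_Suc simp: atLeastLessThan_upt[symmetric])
      qed
    qed (simp_all add: assms)
  qed
qed

text \<open>
  For empty second lists the eigenvalue may be \<open>0\<close>, and no step kills this part: what survives is basic.
\<close>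

lemma relax_last:
  assumes "mlin \<eta>" "ws \<eta>" "homogeneous p \<eta>" "p \<le> int M" "vanishes_above 0 \<eta>"
  shows "basic (dif L) (fold relax [1..<Suc M] \<eta>)"
  unfolding basic_def
proof (intro allI impI)
  fix xs :: "'z list" and as :: "'m list" assume *: "as \<noteq> [] \<or> (\<exists>x\<in>set xs. x \<in> range (dif L))"
  show "fold relax [1..<Suc M] \<eta> (xs, as) = 0"
  proof (cases "as = []")
    case False
    then show ?thesis
      using fold_relax_vanishes_above[OF assms(1,2,5), of "[1..<Suc M]"] by (auto simp: vanishes_above_def simp del: upt_Suc)
  next
    case True
    show ?thesis
    proof (rule splits_suffice[where B = False])
      fix ys assume ys: "splits ys" "False \<or> 0 < exacts ys"
      have "exacts ys \<le> length ys" by (simp add: exacts_def)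
      then show "fold relax [1..<Suc M] \<eta> (ys, as) = 0"
        using fold_relax_kills[OF assms(1,2,5), of as ys "[1..<Suc M]"] ys assms(4) True
          hom_apply[OF fold_relax_hom[OF assms(3)], of ys as "[1..<Suc M]"]
        by (cases "int (length ys) = p") (auto simp del: upt_Suc simp: atLeastLessThan_upt[symmetric])
    qed (use * True in \<open>simp_all add: assms\<close>)
  qed
qed

lemma basic_schedule:
  assumes "mlin \<eta>" "ws \<eta>" "homogeneous p \<eta>" "p \<le> int M"
  shows "basic (dif L) (fold relax (schedule M) \<eta>)"
proof -
  have "basic (dif L) (fold relax (concat (replicate (Suc q) [1..<Suc M])) \<eta>)" if "vanishes_above q \<eta>" for q
    using assms that
  proof (induction q arbitrary: \<eta>)
    case 0 then show ?case using relax_last by simp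
  next
    case (Suc q)
    have "basic (dif L) (fold relax (concat (replicate (Suc q) [1..<Suc M])) (fold relax [1..<Suc M] \<eta>))"
      by (rule Suc(1)) (simp_all only: fold_relax_closed fold_relax_hom Suc relax_round[OF Suc(2-6)])
    then show ?case by (simp del: upt_Suc)
  qed
  moreover have "vanishes_above M \<eta>" using assms(3,4) by (auto simp: vanishes_above_def homogeneous_def)
  ultimately show ?thesis by (simp only: schedule_def)
qed

end

context coefficients
begin

lemma scale_twice: "t c w + t c w = t (2 * c) w"
  by (simp only: mult_2 scale_left_distrib)

lemma shift_scale_map: "mlin \<eta> \<Longrightarrow> shift (\<lambda>z. sa c (\<phi> z)) \<eta> = (\<lambda>u. t c (shift \<phi> \<eta> u))"
proof
  fix u :: "'z list \<times> 'm list" assume "mlin \<eta>"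
  then show "shift (\<lambda>z. sa c (\<phi> z)) \<eta> u = t c (shift \<phi> \<eta> u)"
  proof (induction \<phi> \<eta> u rule: shift.induct)
    case (2 \<phi> \<eta> x xs as) then show ?case
      using lin_scale[OF mlin_slotm[OF 2(2), of xs as]] by (simp add: scale_right_diff_distrib)
  qed simp
qed

lemma arg0_wick: "arg0 x (wick t h c \<eta>) = wick t h c (wick_arg t h c x \<eta>)"
  by (auto simp: fun_eq_iff)

lemma wick_arg_lin:
  fixes h :: "'z \<Rightarrow> 'z \<Rightarrow> 'm"
  shows "lin (sc t) (sc t) (wick_arg t h c x)"
  by (rule linI) (auto simp: wick_arg_def fun_eq_iff scale_right_distrib mult.commute)

lemmas wick_arg_simps [simp] = lin_add[OF wick_arg_lin] lin_diff[OF wick_arg_lin]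
  lin_minus[OF wick_arg_lin] lin_zero[OF wick_arg_lin] lin_scale[OF wick_arg_lin]

lemma add_apply: "(\<eta> + \<zeta>) (xs, as) = \<eta> (xs, as) + \<zeta> (xs, as)"
  for \<eta> \<zeta> :: "'z list \<times> 'm list \<Rightarrow> 'w"
  by simp

lemma wick_lin:
  fixes h :: "'z \<Rightarrow> 'z \<Rightarrow> 'm"
  shows "lin (sc t) (sc t) (wick t h c)"
proof (rule linI; rule ext)
  fix \<eta> \<zeta> :: "'z list \<times> 'm list \<Rightarrow> 'w" and u :: "'z list \<times> 'm list" and b
  obtain xs as where u: "u = (xs, as)" by fastforce
  show "wick t h c (\<eta> + \<zeta>) u = (wick t h c \<eta> + wick t h c \<zeta>) u"
    unfolding u by (induction xs arbitrary: \<eta> \<zeta>) simp_all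
  show "wick t h c (\<lambda>u. t b (\<eta> u)) u = t b (wick t h c \<eta> u)"
    unfolding u by (induction xs arbitrary: \<eta>) simp_all
qed

lemmas wick_simps [simp] = lin_add[OF wick_lin] lin_diff[OF wick_lin] lin_minus[OF wick_lin]
  lin_zero[OF wick_lin] lin_scale[OF wick_lin]

end

text \<open>
  The form \<open>h\<close> defines the Clifford relation.
\<close>

locale alternator = coefficients t sx sa
  for t :: "'k::field \<Rightarrow> 'w::ab_group_add \<Rightarrow> 'w"
    and sx :: "'k \<Rightarrow> 'z::ab_group_add \<Rightarrow> 'z" and sa :: "'k \<Rightarrow> 'm::ab_group_add \<Rightarrow> 'm" +
  fixes h :: "'z \<Rightarrow> 'z \<Rightarrow> 'm"
  assumes h_sym: "h x y = h y x" and h_lin: "lin sx sa (h x)"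
    and sa_vs: "vector_space sa"
begin

sublocale A: vector_space sa by (rule sa_vs)

lemma h_lin': "lin sx sa (\<lambda>x. h x y)" using h_lin[of y] by (simp add: h_sym[of _ y])

abbreviation "W \<equiv> wick t h"
abbreviation "J \<equiv> wick_arg t h"

lemma mlin_J [simp]: "mlin \<eta> \<Longrightarrow> mlin (J c x \<eta>)"
  by (simp add: wick_arg_def mlin_shift h_lin)

lemma ws_J [simp]: "mlin \<eta> \<Longrightarrow> weakly_symmetric h' \<eta> \<Longrightarrow> weakly_symmetric h' (J c x \<eta>)"
  by (simp add: wick_arg_def ws_shift)

lemma argm_J: "mlin \<eta> \<Longrightarrow> argm \<alpha> (J c x \<eta>) = J c x (argm \<alpha> \<eta>)"
  by (simp add: wick_arg_def arg0_argm argm_shift)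

lemma argm_wick:
  assumes "mlin \<eta>" shows "argm \<alpha> (W c \<eta>) = W c (argm \<alpha> \<eta>)"
proof
  fix u :: "'z list \<times> 'm list"
  obtain xs as where u: "u = (xs, as)" by fastforce
  show "argm \<alpha> (W c \<eta>) u = W c (argm \<alpha> \<eta>) u"
    unfolding u using assms by (induction xs arbitrary: \<eta>) (simp_all add: argm_J)
qed

lemma shift_J:
  assumes "mlin \<eta>"
  shows "J c x (shift \<phi> \<eta>) = argm (\<phi> x) \<eta> - shift \<phi> (J c x \<eta>)"
  by (simp add: wick_arg_def arg_shift shift_anticommute[OF assms, of "h x" \<phi>] fun_eq_iff)

text \<open>
  \<open>wick\<close> is built from contractions and from operators \<open>shift (h x)\<close>.  It commutes with \<open>shift \<phi>\<close>
  because these operators anticommute with it.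
\<close>

lemma shift_wick:
  assumes "mlin \<eta>" shows "shift \<phi> (W c \<eta>) = W c (shift \<phi> \<eta>)"
proof
  fix u :: "'z list \<times> 'm list"
  obtain xs as where u: "u = (xs, as)" by fastforce
  show "shift \<phi> (W c \<eta>) u = W c (shift \<phi> \<eta>) u"
    unfolding u using assms
  proof (induction xs arbitrary: \<eta>)
    case (Cons y ys)
    have "W c \<eta> (ys, \<phi> y # as) = W c (argm (\<phi> y) \<eta>) (ys, as)"
      using fun_cong[OF argm_wick[OF Cons(2), of "\<phi> y" c], of "(ys, as)"] by simp
    then show ?case using Cons by (simp add: arg0_wick shift_J)
  qed simp
qed

text \<open>
  The deformations by \<open>c\<close> and \<open>- c\<close> cancel, as \<open>shift (h y)\<close> commutes with \<open>wick\<close>.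
\<close>

lemma wick_inverse:
  assumes "mlin \<eta>" shows "W c (W (- c) \<eta>) = \<eta>"
proof
  fix u :: "'z list \<times> 'm list"
  obtain xs as where u: "u = (xs, as)" by fastforce
  show "W c (W (- c) \<eta>) u = \<eta> u"
    unfolding u using assms
  proof (induction xs arbitrary: \<eta>)
    case (Cons y ys)
    have "J c y (W (- c) \<eta>) = W (- c) (J (- c) y \<eta> + (\<lambda>u. t c (shift (h y) \<eta> u)))"
      by (simp add: wick_arg_def[of t h c y "W (- c) \<eta>"] arg0_wick shift_wick[OF Cons(2)])
    also have "J (- c) y \<eta> + (\<lambda>u. t c (shift (h y) \<eta> u)) = arg0 y \<eta>"
      by (simp add: wick_arg_def fun_eq_iff)
    finally show ?case using Cons by simp
  qed simp
qed

lemma mlin_wick [simp]: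
  assumes "mlin \<eta>" shows "mlin (W c \<eta>)"
proof (rule mlinI)
  show "lin sx t (\<lambda>x. W c \<eta> (us @ x # vs, as))" for us vs as
    using assms
  proof (induction us arbitrary: \<eta>)
    case Nil
    have "lin sx (sc t) (\<lambda>x. J c x \<eta>)"
      using mlin_lin0[OF Nil] shift_lin_map[of sx h, OF h_lin' Nil]
      unfolding wick_arg_def by (intro lin_fun_plus) (auto simp: lin_fun_iff intro: lin_sc)
    from lin_at[OF lin_compose[OF this wick_lin], where u = "(vs, as)"] show ?case by simp
  qed simp
  show "lin sa t (\<lambda>\<alpha>. W c \<eta> (xs, \<alpha> # as))" for xs as
  proof -
    have "lin sa t (\<lambda>\<alpha>. W c (argm \<alpha> \<eta>) (xs, as))"
      by (rule lin_at[OF lin_compose[OF mlin_linm[OF assms] wick_lin]])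
    then show ?thesis by (simp flip: argm_wick[OF assms])
  qed
  show "W c \<eta> (xs, as @ \<alpha> # \<beta> # bs) = W c \<eta> (xs, as @ \<beta> # \<alpha> # bs)" for xs as \<alpha> \<beta> bs
    using assms by (induction xs arbitrary: \<eta>) (simp_all add: mlin_swap[of _ _ _ \<alpha> \<beta>])
qed

lemma hom_wick [simp]:
  assumes "homogeneous p \<eta>" shows "homogeneous p (W c \<eta>)"
proof -
  have "W c \<eta> (xs, as) = 0" if "int (length xs) + 2 * int (length as) \<noteq> p" for xs as
    using assms that
  proof (induction xs arbitrary: p \<eta>)
    case Nil then show ?case by (simp add: homogeneous_def)
  next
    case (Cons x xs)
    have "homogeneous (p - 1) (J c x \<eta>)" using Cons(2) by (simp add: wick_arg_def)
    from Cons(1)[OF this] Cons(3) show ?case by simp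
  qed
  then show ?thesis by (simp add: homogeneous_def)
qed

text \<open>
  The two deformations \<open>c \<cdot> shift (h x)\<close> and \<open>c \<cdot> shift (h y)\<close> anticommute; each of the two mixed
  anticommutators contributes \<open>c \<cdot> h(x,y)\<close>.
\<close>

lemma J_J:
  assumes "mlin \<eta>"
  shows "J c y (J c x \<eta>) + J c x (J c y \<eta>) =
    arg0 y (arg0 x \<eta>) + arg0 x (arg0 y \<eta>) + (\<lambda>u. t c (argm (h x y) \<eta> u) + t c (argm (h x y) \<eta> u))"
  by (simp add: wick_arg_def arg_shift shift_anticommute[OF assms, of "h y" "h x"] h_sym[of y x] fun_eq_iff
      scale_left_distrib scale_right_distrib scale_right_diff_distrib algebra_simps)

text \<open>
  The deformation by \<open>c\<close> changes the Clifford relation by \<open>J_J\<close>.  Here \<open>\<kappa> = 0\<close> are the alternating cochains and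
  \<open>\<kappa> = 1\<close> the weakly symmetric ones, and \<open>c = 1/2\<close> or \<open>c = - 1/2\<close> leads from one to the other.
\<close>

lemma ws_wick:
  assumes "mlin \<eta>" "weakly_symmetric (\<lambda>x y. sa \<kappa> (h x y)) \<eta>" "\<kappa>' = \<kappa> - 2 * c"
  shows "weakly_symmetric (\<lambda>x y. sa \<kappa>' (h x y)) (W c \<eta>)"
proof -
  have "W c \<eta> (us @ x # y # vs, as) + W c \<eta> (us @ y # x # vs, as) = - W c \<eta> (us @ vs, sa \<kappa>' (h x y) # as)"
    for us x y vs as
    using assms(1,2)
  proof (induction us arbitrary: \<eta>)
    case Nil
    have "arg0 y (arg0 x \<eta>) + arg0 x (arg0 y \<eta>) = - (\<lambda>u. t \<kappa> (argm (h x y) \<eta> u))"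
      using ws_head[OF Nil(2), of x y] lin_scale[OF mlin_linm[OF Nil(1)]] by simp
    then have "J c y (J c x \<eta>) + J c x (J c y \<eta>) = - argm (sa \<kappa>' (h x y)) \<eta>"
      unfolding J_J[OF Nil(1)]
      by (simp add: lin_scale[OF mlin_linm[OF Nil(1)]] assms(3) fun_eq_iff scale_left_diff_distrib scale_twice)
    then have "W c (J c y (J c x \<eta>)) + W c (J c x (J c y \<eta>)) = - argm (sa \<kappa>' (h x y)) (W c \<eta>)"
      by (simp flip: wick_simps(1) add: argm_wick[OF Nil(1)])
    from fun_cong[OF this, of "(vs, as)"] show ?case by simp
  next
    case (Cons u us)
    have "weakly_symmetric (\<lambda>x y. sa \<kappa> (h x y)) (J c u \<eta>)"
      using Cons(2,3) by simp
    from Cons(1)[OF _ this] Cons(2) show ?case by simp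
  qed
  then show ?thesis by (simp add: weakly_symmetric_def)
qed

lemma lie_deriv_J:
  assumes "mlin \<eta>" "lin t t l" "\<And>x y. g (h x y) = h (f x) y + h x (f y)" 
  shows "J c x (lie_deriv l f g \<eta>) = lie_deriv l f g (J c x \<eta>) - J c (f x) \<eta>"
  by (simp add: wick_arg_def arg0_lie_deriv lie_deriv_simps assms lie_deriv_shift fun_eq_iff scale_right_distrib)

lemma lie_deriv_wick:
  assumes "mlin \<eta>" "lin t t l" "\<And>x y. g (h x y) = h (f x) y + h x (f y)" 
  shows "lie_deriv l f g (W c \<eta>) = W c (lie_deriv l f g \<eta>)"
proof
  fix u :: "'z list \<times> 'm list"
  obtain xs as where u: "u = (xs, as)" by fastforce
  show "lie_deriv l f g (W c \<eta>) u = W c (lie_deriv l f g \<eta>) u"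
    unfolding u using assms(1)
  proof (induction xs arbitrary: \<eta>)
    case Nil
    then show ?case
    proof (induction as arbitrary: \<eta>)
      case (Cons \<alpha> as)
      then show ?case using Cons(1)[of "argm \<alpha> \<eta>"] by (simp add: argm_wick)
    qed simp
  next
    case (Cons x xs)
    then show ?case by (simp add: arg0_wick lie_deriv_J assms)
  qed
qed

end

context lie2_module
begin

sublocale alternator t "smul_0 L" "smul_m L" "alt L"
  by unfold_locales (simp_all add: alt_sym bilin_lins)

text \<open>
  The action of \<open>x\<close> in the complex of the skew-symmetrization, which is a representation only up to
  homotopy; the last summand collects the terms with \<open>l\<^sub>3(x,-,-)\<close>.
\<close>

definition SLie :: "'z \<Rightarrow> ('z list \<times> 'm list \<Rightarrow> 'w) \<Rightarrow> 'z list \<times> 'm list \<Rightarrow> 'w"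
  where "SLie x \<eta> = lie_deriv (l x) (skew_00 L x) (skew_0m L x) \<eta> + shift2 (skew_3 L x) \<eta>"

sublocale S: cartan t "smul_0 L" "smul_m L" "dif L" SLie "skew_00 L" "skew_0m L" "skew_m0 L" "\<lambda>_ _. 0"
proof
  show "lin (sc t) (sc t) (SLie x)" for x
    by (rule linI) (simp_all add: SLie_def lie_deriv_simps bilin_lins fun_eq_iff scale_right_distrib)
  show "argm \<alpha> (SLie x \<eta>) = SLie x (argm \<alpha> \<eta>) - argm (skew_0m L x \<alpha>) \<eta>" if "mlin \<eta>" for \<eta> \<alpha> x
    using that by (simp add: SLie_def argm_lie_deriv argm_shift2)
  show "SLie x (shift \<phi> \<eta>) = shift \<phi> (SLie x \<eta>) + shift (\<lambda>z. skew_0m L x (\<phi> z) - \<phi> (skew_00 L x z)) \<eta>"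
    if "mlin \<eta>" for \<eta> x \<phi>
    using that by (simp add: SLie_def lie_deriv_shift bilin_lins shift2_shift)
  show "0 = skew_0m L x \<alpha> + skew_m0 L \<alpha> x" for x \<alpha>
    by (simp add: skew_0m_def skew_m0_def flip: A.scale_right_distrib)
qed simp

lemma SLie_rec:
  "SLie x \<eta> ([], []) = l x (\<eta> ([], []))"
  "SLie x \<eta> ([], \<alpha> # as) = SLie x (argm \<alpha> \<eta>) ([], as) - \<eta> ([], skew_0m L x \<alpha> # as)"
  "SLie x \<eta> (y # ys, as) = SLie x (arg0 y \<eta>) (ys, as) - \<eta> (skew_00 L x y # ys, as) + shift (skew_3 L x y) \<eta> (ys, as)"
  by (simp_all add: SLie_def)

lemma double: "smul_m L 2 \<alpha> = \<alpha> + \<alpha>" "smul_0 L 2 x = x + x"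
  by (simp_all only: one_add_one[symmetric] A.scale_left_distrib X.scale_left_distrib A.scale_one X.scale_one)

text \<open>
  The skew-symmetrized brackets differ from the given ones by half the alternator.
\<close>

lemma skew_0m_defect: "alt L x (dif L \<alpha>) = smul_m L 2 (br_0m L x \<alpha> - skew_0m L x \<alpha>)"
proof -
  have "smul_m L 2 (skew_0m L x \<alpha>) = br_0m L x \<alpha> - br_m0 L \<alpha> x" by (simp add: skew_0m_def)
  then show ?thesis by (simp add: A.scale_right_diff_distrib double flip: alt_0m)
qed

lemma skew_00_defect: "dif L (alt L x y) = smul_0 L 2 (br_00 L x y - skew_00 L x y)"
proof -
  have "smul_0 L 2 (skew_00 L x y) = br_00 L x y - br_00 L y x" by (simp add: skew_00_def)
  then show ?thesis by (simp add: X.scale_right_diff_distrib double flip: alt_00)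
qed

text \<open>
  The left-hand side is the quadratic term of \<open>K\<close> for \<open>\<phi> = h\<^sub>2(x,-)\<close>, and this lemma is the reason for the
  formula for \<open>l\<^sub>3\<close>.  Both sides are combinations of the six elements \<open>h\<^sub>2(u,[v,w])\<close> with
  \<open>{u,v,w} = {x,y,z}\<close>.  Comparing two expressions for \<open>[x,h\<^sub>2(y,z)]\<close> gives relations between these six,
  and they make the two sides equal.
\<close>

lemma skew_3_defect:
  "skew_0m L y (alt L x z) - alt L x (skew_00 L y z) + skew_m0 L (alt L x y) z = smul_m L 2 (skew_3 L x y z)"
proof -
  define a a' where "a = alt L x (br_00 L y z)" and "a' = alt L x (br_00 L z y)"
  define b b' where "b = alt L y (br_00 L z x)" and "b' = alt L y (br_00 L x z)"
  define c c' where "c = alt L z (br_00 L x y)" and "c' = alt L z (br_00 L y x)"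
  note ab = a_def a'_def b_def b'_def c_def c'_def
  \<comment> \<open>as \<open>[h\<^sub>2(v,w),u] = 0\<close>, this is \<open>alt_0m\<close> for the element \<open>h\<^sub>2(v,w)\<close> of \<open>L\<^sup>-\<^sup>1\<close>\<close>
  have R: "br_0m L u (alt L v w) = alt L u (br_00 L v w) + alt L u (br_00 L w v)" for u v w
    using alt_0m[of u "alt L v w"] lin_add[OF bilin_lins(7), of u "br_00 L v w" "br_00 L w v"]
    by (simp add: alt_00 br_alt_left)
  have R1: "a + a' = c + b'" using R[of x y z] br_alt_right[of x y z] by (simp add: ab alt_sym[of _ z])
  have R2: "b + b' = c' + a" using R[of y x z] br_alt_right[of y x z] by (simp add: ab alt_sym[of _ z] add.commute)
  have k: "alt L u (smul_0 L k v) = smul_m L k (alt L u v)" "alt L u (v - w) = alt L u v - alt L u w" for u v w k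
    by (simp_all add: lin_scale[OF bilin_lins(7)] lin_diff[OF bilin_lins(7)])
  have 1: "skew_0m L y (alt L x z) = smul_m L (1/2) (c' + a)"
    using br_alt_right[of y x z] by (simp add: skew_0m_def br_alt_left ab alt_sym[of _ z])
  have 2: "alt L x (skew_00 L y z) = smul_m L (1/2) (a - a')"
    by (simp add: skew_00_def k ab)
  have 3: "skew_m0 L (alt L x y) z = smul_m L (1/2) (- (b + a'))"
    using br_alt_right[of z x y] by (simp add: skew_m0_def br_alt_left ab alt_sym[of _ y])
  \<comment> \<open>both sides will turn out to be half of \<open>p\<close>\<close>
  define p where "p = c' - b"
  have 4: "(c - c') + (a - a') + (b - b') = - (p + (p + p))"
  proof -
    have a': "a' = c + b' - a" and c': "c' = b + b' - a" using R1 R2 by (simp_all add: algebra_simps)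
    show ?thesis unfolding p_def a' c' by (simp add: algebra_simps)
  qed
  have "smul_m L (2 + 1) p = (p + p) + p" by (simp only: A.scale_left_distrib double A.scale_one)
  then have 5: "p + (p + p) = smul_m L 3 p" by (simp add: add.assoc)
  have S: "alt L (skew_00 L u v) w = smul_m L (1/2) (alt L w (br_00 L u v) - alt L w (br_00 L v u))" for u v w
    by (subst alt_sym) (simp add: skew_00_def k)
  have "skew_3 L x y z = smul_m L (- (1 / 6)) (smul_m L (1/2) ((c - c') + (a - a') + (b - b')))"
    by (simp only: skew_3_def S ab A.scale_right_distrib)
  also have "\<dots> = smul_m L (1/4) p" unfolding 4 5 by simp
  finally have "smul_m L 2 (skew_3 L x y z) = smul_m L (1/2) p" by simp
  then show ?thesis unfolding 1 2 3 p_def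
    by (simp add: algebra_simps flip: A.scale_right_distrib A.scale_right_diff_distrib)
qed

abbreviation sk :: "('z list \<times> 'm list \<Rightarrow> 'w) \<Rightarrow> bool" where "sk \<equiv> weakly_symmetric (\<lambda>_ _. 0)"

text \<open>
  The actions of \<open>x\<close> in the two complexes differ by a null-homotopic operator, with homotopy half the
  contraction with \<open>h\<^sub>2(x,-)\<close>.
\<close>

lemma skew_K:
  assumes "mlin \<eta>" "sk \<eta>"
  shows "S.K (alt L x) \<eta> = (\<lambda>u. t 2 ((SLie x \<eta> - Lie x \<eta>) u))"
proof
  fix u :: "'z list \<times> 'm list"
  obtain xs as where u: "u = (xs, as)" by fastforce
  show "S.K (alt L x) \<eta> u = t 2 ((SLie x \<eta> - Lie x \<eta>) u)"
    unfolding u using assms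
  proof (induction xs arbitrary: \<eta>)
    case Nil
    then show ?case
    proof (induction as arbitrary: \<eta>)
      case Nil then show ?case by (simp add: S.K_Nil SLie_rec)
    next
      case (Cons \<alpha> as)
      then show ?case
        by (simp add: S.K_argm SLie_rec skew_0m_defect lin_scale[OF mlin_slotm] lin_diff[OF mlin_slotm]
          scale_right_diff_distrib)
    qed
  next
    case (Cons y ys)
    have 1: "shift (\<lambda>z. smul_m L 2 (skew_3 L x y z)) \<eta> = (\<lambda>u. t 2 (shift (skew_3 L x y) \<eta> u))"
      by (rule shift_scale_map[OF Cons(2)])
    have 2: "\<eta> (dif L (alt L x y) # ys, as) = t 2 (\<eta> (br_00 L x y # ys, as) - \<eta> (skew_00 L x y # ys, as))"
    proof -
      have *: "lin (smul_0 L) t (\<lambda>x. \<eta> (x # ys, as))" using mlin_slot0[OF Cons(2), of "[]" ys as] by simp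
      show ?thesis unfolding skew_00_defect lin_scale[OF *] lin_diff[OF *] ..
    qed
    show ?case
      using Cons(1)[of "arg0 y \<eta>"] Cons(2,3) fun_cong[OF S.K_arg0[OF Cons(2,3), of y "alt L x"], of "(ys, as)"]
      by (simp add: skew_3_defect 1 2 SLie_rec scale_right_diff_distrib scale_right_distrib)
  qed
qed

text \<open>
  Both sides satisfy the same recursion: by \<open>skew_K\<close>, the deformed contraction for \<open>c = - 1/2\<close> has with the
  skew differential the anticommutator \<open>L\<^sub>x\<close>, and \<open>wick\<close> commutes with \<open>L\<^sub>x\<close>.
\<close>

lemma wick_D:
  assumes "mlin \<eta>" "sk \<eta>"
  shows "W (- (1 / 2)) (S.D \<eta>) = R.D (W (- (1 / 2)) \<eta>)"
proof
  fix u :: "'z list \<times> 'm list"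
  obtain xs as where u: "u = (xs, as)" by fastforce
  show "W (- (1 / 2)) (S.D \<eta>) u = R.D (W (- (1 / 2)) \<eta>) u"
    unfolding u using assms
  proof (induction xs arbitrary: \<eta>)
    case Nil
    then show ?case
    proof (induction as arbitrary: \<eta>)
      case (Cons \<alpha> as)
      then show ?case using Cons(1)[of "argm \<alpha> \<eta>"] by (simp add: argm_wick wick_arg_def)
    qed simp
  next
    case (Cons x xs)
    let ?E = "\<lambda>\<eta> u. t (- (1 / 2)) (shift (alt L x) \<eta> u)" and ?J = "J (- (1 / 2)) x"
    have I: "mlin (?J \<eta>)" "sk (?J \<eta>)" using Cons(2,3) by simp_all
    have "?J (S.D \<eta>) = SLie x \<eta> - S.D (arg0 x \<eta>) + ?E (S.D \<eta>)"
      by (simp add: arg0_cartan wick_arg_def)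
    also have "?E (S.D \<eta>) = (\<lambda>u. t (- (1 / 2)) (S.K (alt L x) \<eta> u)) - S.D (?E \<eta>)"
      unfolding S.K_def S.D_simps by (simp add: fun_eq_iff scale_right_distrib)
    also have "(\<lambda>u. t (- (1 / 2)) (S.K (alt L x) \<eta> u)) = Lie x \<eta> - SLie x \<eta>"
      by (simp add: skew_K[OF Cons(2,3)] fun_eq_iff)
    finally have "?J (S.D \<eta>) = Lie x \<eta> - S.D (?J \<eta>)"
      unfolding wick_arg_def[of t "alt L" _ x \<eta>] S.D_simps by (simp add: fun_eq_iff)
    then have "W (- (1 / 2)) (S.D \<eta>) (x # xs, as) = W (- (1 / 2)) (Lie x \<eta>) (xs, as) - W (- (1 / 2)) (S.D (?J \<eta>)) (xs, as)"
      by simp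
    also have "\<dots> = Lie x (W (- (1 / 2)) \<eta>) (xs, as) - R.D (W (- (1 / 2)) (?J \<eta>)) (xs, as)"
      unfolding Cons(1)[OF I] by (simp add: lie_deriv_wick[OF Cons(2)] bilin_lins br_alt_right)
    finally show ?case by (simp only: cartan_diff.simps arg0_wick)
  qed
qed

end

section \<open>The differentials as sums over positions\<close>

lemma omit_simps [simp]: "omit 0 (x # xs) = xs" "omit (Suc i) (x # xs) = x # omit i xs"
  by (simp_all add: omit_def)

context coefficients
begin

lemma mlin_move:
  "mlin \<eta> \<Longrightarrow> \<eta> (xs, as @ \<beta> # bs) = \<eta> (xs, \<beta> # as @ bs)"
proof (induction as arbitrary: \<eta>)
  case (Cons \<alpha> as)
  from Cons(1)[of "argm \<alpha> \<eta>"] Cons(2) show ?case by (simp add: mlin_swap0[of _ _ \<alpha> \<beta>])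
qed simp

lemma mlin_mset: "mlin \<eta> \<Longrightarrow> mset as = mset bs \<Longrightarrow> \<eta> (xs, as) = \<eta> (xs, bs)"
proof (induction as arbitrary: \<eta> bs)
  case (Cons \<alpha> as)
  then have "\<alpha> \<in> set bs" by (metis list.set_intros(1) set_mset_mset)
  then obtain b1 b2 where bs: "bs = b1 @ \<alpha> # b2" by (meson split_list)
  with Cons(3) have "mset as = mset (b1 @ b2)" by simp
  from Cons(1)[OF _ this, of "argm \<alpha> \<eta>"] Cons(2) show ?case by (simp add: bs mlin_move)
qed simp

lemma mlin_update: "mlin \<eta> \<Longrightarrow> j < length as \<Longrightarrow> \<eta> (xs, as[j := \<beta>]) = \<eta> (xs, \<beta> # omit j as)"
  by (simp add: upd_conv_take_nth_drop mlin_move omit_def)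

lemma poly_hom_iff:
  "\<eta> \<in> poly_hom L t q \<longleftrightarrow> homogeneous q \<eta> \<and> mlin \<eta>" if "smul_0 L = sx" "smul_m L = sa"
proof
  assume "\<eta> \<in> poly_hom L t q"
  then have 1: "homogeneous q \<eta>" and 2: "\<And>as. multilinear_on UNIV sx t (\<lambda>xs. \<eta> (xs, as))"
    and 3: "\<And>xs. multilinear_on UNIV sa t (\<lambda>as. \<eta> (xs, as))"
    and 4: "\<And>xs as bs. mset as = mset bs \<Longrightarrow> \<eta> (xs, as) = \<eta> (xs, bs)"
    using that unfolding poly_hom_def homogeneous_def by blast+
  have "mlin \<eta>"
  proof (rule mlinI)
    show "lin sx t (\<lambda>x. \<eta> (us @ x # vs, as))" for us vs as
      using 2[of as] unfolding multilinear_on_def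
      by (auto dest!: spec[of _ "us @ 0 # vs"] spec[of _ "length us"])
    show "lin sa t (\<lambda>\<alpha>. \<eta> (xs, \<alpha> # as))" for xs as
      using 3[of xs] unfolding multilinear_on_def
      by (auto dest!: spec[of _ "0 # as"] spec[of _ 0])
    show "\<eta> (xs, as @ \<alpha> # \<beta> # bs) = \<eta> (xs, as @ \<beta> # \<alpha> # bs)" for xs as \<alpha> \<beta> bs
      by (rule 4) simp
  qed
  with 1 show "homogeneous q \<eta> \<and> mlin \<eta>" ..
next
  assume *: "homogeneous q \<eta> \<and> mlin \<eta>"
  have "multilinear_on UNIV sx t (\<lambda>xs. \<eta> (xs, as))" for as
    unfolding multilinear_on_def using * mlin_slot0 by (auto simp: upd_conv_take_nth_drop)
  moreover have "multilinear_on UNIV sa t (\<lambda>as. \<eta> (xs, as))" for xs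
    unfolding multilinear_on_def using * mlin_slotm by (auto simp: mlin_update)
  moreover have "\<eta> (xs, as) = \<eta> (xs, bs)" if "mset as = mset bs" for xs as bs
    using * that mlin_mset by blast
  ultimately show "\<eta> \<in> poly_hom L t q"
    using * that unfolding poly_hom_def homogeneous_def by blast
qed

lemma lie_deriv_sum:
  "lie_deriv l f g \<eta> (xs, as) = l (\<eta> (xs, as)) - (\<Sum>i<length xs. \<eta> (xs[i := f (xs ! i)], as))
    - (\<Sum>j<length as. \<eta> (xs, as[j := g (as ! j)]))"
  for \<eta> :: "'z list \<times> 'm list \<Rightarrow> 'w"
proof (induction xs arbitrary: \<eta>)
  case Nil
  show ?case
  proof (induction as arbitrary: \<eta>)
    case (Cons \<alpha> as) then show ?case by (simp add: sum.lessThan_Suc_shift del: sum.lessThan_Suc)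
  qed simp
next
  case (Cons x xs) then show ?case by (simp add: sum.lessThan_Suc_shift del: sum.lessThan_Suc)
qed

lemma shift_sum:
  "shift \<phi> \<eta> (xs, as) = (\<Sum>i<length xs. t ((-1) ^ i) (\<eta> (omit i xs, \<phi> (xs ! i) # as)))"
  for \<eta> :: "'z list \<times> 'm list \<Rightarrow> 'w"
proof (induction xs arbitrary: \<eta>)
  case (Cons x xs) then show ?case
    by (simp add: sum.lessThan_Suc_shift sum_negf del: sum.lessThan_Suc)
qed simp

lemma shift2_sum:
  "shift2 \<tau> \<eta> (xs, as) =
    (\<Sum>k<length xs. \<Sum>j<k. t ((-1) ^ (j + k + 1)) (\<eta> (omit j (omit k xs), \<tau> (xs ! j) (xs ! k) # as)))"
  for \<eta> :: "'z list \<times> 'm list \<Rightarrow> 'w"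
proof (induction xs arbitrary: \<eta>)
  case (Cons x xs) then show ?case
    by (simp add: sum.lessThan_Suc_shift shift_sum sum.distrib del: sum.lessThan_Suc)
qed simp

text \<open>
  The differential of \<open>L\<close> leaves a bracket at the place of its second argument, the other two put it in
  front.
\<close>

lemma skew_move:
  assumes "mlin \<eta>" "weakly_symmetric (\<lambda>_ _. 0) \<eta>" "j < length xs"
  shows "\<eta> (xs[j := y], as) = t ((-1) ^ j) (\<eta> (y # omit j xs, as))"
  using assms
proof (induction xs arbitrary: \<eta> j)
  case (Cons x xs)
  show ?case
  proof (cases j)
    case (Suc i)
    have "\<eta> (x # y # omit i xs, as) = - \<eta> (y # x # omit i xs, as)"
      using fun_cong[OF ws_head[OF Cons(3), of y x], of "(omit i xs, as)"] arg_0(1)[OF Cons(2)] by simp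
    then show ?thesis using Cons(1)[of "arg0 x \<eta>" i] Cons(2-4) Suc by simp
  qed simp
qed simp

end

context lie2_module
begin

lemma rep_diff_part_Nil: "rep_diff_part L t l \<eta> ([], as) = R.D \<eta> ([], as)"
  and skew_diff_part_Nil: "skew_diff_part L t l \<eta> ([], as) = S.D \<eta> ([], as)"
proof -
  have *: "cartan_diff (dif L) \<Lambda> \<eta> ([], as) = (\<Sum>j<length as. \<eta> ([dif L (as ! j)], omit j as))" for \<Lambda> \<eta>
  proof (induction as arbitrary: \<eta>)
    case (Cons \<alpha> as) then show ?case
      by (simp add: sum.lessThan_Suc_shift add.commute del: sum.lessThan_Suc)
  qed simp
  show "rep_diff_part L t l \<eta> ([], as) = R.D \<eta> ([], as)" "skew_diff_part L t l \<eta> ([], as) = S.D \<eta> ([], as)"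
    by (simp_all add: * rep_diff_part_def skew_diff_part_def)
qed

text \<open>
  This is the Cartan formula.  The terms with \<open>d \<alpha>\<close> have \<open>d \<alpha>\<close> in front of \<open>x\<close>; exchanging the two yields
  \<open>- h\<^sub>2(x, d \<alpha>)\<close>, which turns the right brackets \<open>[\<alpha>,x]\<close> of the formula into \<open>- [x,\<alpha>]\<close>.
\<close>

lemma rep_diff_part_Cons:
  assumes "mlin \<eta>" "ws \<eta>"
  shows "rep_diff_part L t l \<eta> (x # xs, as) = Lie x \<eta> (xs, as) - rep_diff_part L t l (arg0 x \<eta>) (xs, as)"
proof -
  have 1: "\<eta> (dif L \<alpha> # x # xs, bs) = - \<eta> (x # dif L \<alpha> # xs, bs) - \<eta> (xs, br_m0 L \<alpha> x # bs) - \<eta> (xs, br_0m L x \<alpha> # bs)" for \<alpha> bs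
  proof -
    have "\<eta> (xs, alt L x (dif L \<alpha>) # bs) = \<eta> (xs, br_0m L x \<alpha> # bs) + \<eta> (xs, br_m0 L \<alpha> x # bs)"
      unfolding alt_0m[symmetric] by (rule lin_add[OF mlin_slotm[OF assms(1)]])
    then show ?thesis
      using fun_cong[OF ws_head[OF assms(2), of x "dif L \<alpha>"], of "(xs, bs)"] by simp
  qed
  have 2: "(\<Sum>j<length as. \<eta> (dif L (as ! j) # x # xs, omit j as)) =
    - (\<Sum>j<length as. \<eta> (x # dif L (as ! j) # xs, omit j as)) - (\<Sum>j<length as. \<eta> (xs, as[j := br_m0 L (as ! j) x]))
      - (\<Sum>j<length as. \<eta> (xs, as[j := br_0m L x (as ! j)]))"
    unfolding 1 by (simp add: sum_subtractf sum_negf mlin_update[OF assms(1)])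
  show ?thesis
    unfolding rep_diff_part_def lie_deriv_sum prod.case length_Cons sum.lessThan_Suc_shift
    by (simp add: 2 sum.distrib sum_negf sum_subtractf algebra_simps del: sum.lessThan_Suc)
qed

lemma rep_diff_part_eq: "mlin \<eta> \<Longrightarrow> ws \<eta> \<Longrightarrow> rep_diff_part L t l \<eta> = R.D \<eta>"
proof
  fix u :: "'z list \<times> 'm list" assume "mlin \<eta>" "ws \<eta>"
  moreover obtain xs as where u: "u = (xs, as)" by fastforce
  ultimately show "rep_diff_part L t l \<eta> u = R.D \<eta> u" unfolding u
    by (induction xs arbitrary: \<eta>) (simp_all add: rep_diff_part_Nil rep_diff_part_Cons)
qed

lemma skew_diff_part_Cons:
  assumes "mlin \<eta>" "sk \<eta>"
  shows "skew_diff_part L t l \<eta> (x # xs, as) = SLie x \<eta> (xs, as) - skew_diff_part L t l (arg0 x \<eta>) (xs, as)"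
proof -
  have 1: "\<eta> (y # x # vs, bs) = - \<eta> (x # y # vs, bs)" for y vs bs
    using fun_cong[OF ws_head[OF assms(2), of x y], of "(vs, bs)"] arg_0(1)[OF assms(1)] by simp
  have 2: "(\<Sum>i<length xs. \<eta> (xs[i := skew_00 L x (xs ! i)], as)) =
    (\<Sum>j<length xs. t ((-1) ^ j) (\<eta> (skew_00 L x (xs ! j) # omit j xs, as)))"
    by (simp add: skew_move[OF assms])
  have 3: "skew_m0 L \<alpha> x = - skew_0m L x \<alpha>" for \<alpha>
    by (simp add: skew_m0_def skew_0m_def flip: A.scale_minus_right)
  have 4: "(\<Sum>j<length as. \<eta> (xs, as[j := - skew_0m L x (as ! j)])) = - (\<Sum>j<length as. \<eta> (xs, as[j := skew_0m L x (as ! j)]))"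
    by (simp add: mlin_update[OF assms(1)] lin_minus[OF mlin_slotm[OF assms(1)]] sum_negf)
  show ?thesis
    unfolding skew_diff_part_def SLie_def add_apply lie_deriv_sum shift2_sum prod.case length_Cons sum.lessThan_Suc_shift
    by (simp add: 1[of "dif L _"] 1[of "skew_00 L _ _"] 2 3 4 sum.distrib sum_negf sum_subtractf algebra_simps del: sum.lessThan_Suc)
qed

lemma skew_diff_part_eq: "mlin \<eta> \<Longrightarrow> sk \<eta> \<Longrightarrow> skew_diff_part L t l \<eta> = S.D \<eta>"
proof
  fix u :: "'z list \<times> 'm list" assume "mlin \<eta>" "sk \<eta>"
  moreover obtain xs as where u: "u = (xs, as)" by fastforce
  ultimately show "skew_diff_part L t l \<eta> u = S.D \<eta> u" unfolding u
    by (induction xs arbitrary: \<eta>) (simp_all add: skew_diff_part_Nil skew_diff_part_Cons)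
qed

text \<open>
  Moving two equal arguments next to each other and swapping them shows that twice the value is zero.
\<close>

lemma sk_iff_alternating:
  assumes "mlin \<eta>"
  shows "sk \<eta> \<longleftrightarrow> (\<forall>as. alternating (\<lambda>xs. \<eta> (xs, as)))"
proof
  assume sk: "sk \<eta>"
  have 0: "\<eta> (xs, as) = 0" if "xs = us @ x # vs @ x # ws" for us x vs ws xs as
    using assms sk that
  proof (induction us arbitrary: \<eta> xs)
    case Nil
    have "\<eta> (x # vs @ x # ws, as) = t ((-1) ^ length vs) (\<eta> (x # x # vs @ ws, as))"
      using skew_move[of "arg0 x \<eta>" "length vs" "vs @ x # ws" x as] Nil(1,2)
      by (simp add: omit_def)
    moreover have "\<eta> (x # x # vs @ ws, as) + \<eta> (x # x # vs @ ws, as) = 0"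
      using fun_cong[OF ws_head[OF Nil(2), of x x], of "(vs @ ws, as)"] arg_0(1)[OF Nil(1)]
      by (simp add: eq_neg_iff_add_eq_0)
    then have "t 2 (\<eta> (x # x # vs @ ws, as)) = 0" using scale_twice[of 1] by simp
    ultimately show ?case using Nil by simp
  next
    case (Cons u us)
    from Cons(1)[of "arg0 u \<eta>" "us @ x # vs @ x # ws"] Cons(2-4) show ?case by simp
  qed
  show "\<forall>as. alternating (\<lambda>xs. \<eta> (xs, as))"
    unfolding alternating_def using 0 not_distinct_decomp by (metis append_Cons append_assoc append_Nil)
next
  assume *: "\<forall>as. alternating (\<lambda>xs. \<eta> (xs, as))"
  have z: "\<eta> (us @ x # x # vs, as) = 0" for us x vs as
    using * by (simp add: alternating_def)
  show "sk \<eta>" unfolding weakly_symmetric_def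
  proof (intro allI)
    fix us x y vs as
    have a: "\<eta> (us @ (u + v) # w # vs, as) = \<eta> (us @ u # w # vs, as) + \<eta> (us @ v # w # vs, as)" for u v w
      by (rule lin_add[OF mlin_slot0[OF assms]])
    have b: "\<eta> (us @ w # (u + v) # vs, as) = \<eta> (us @ w # u # vs, as) + \<eta> (us @ w # v # vs, as)" for u v w
      using lin_add[OF mlin_slot0[OF assms, of "us @ [w]" vs as], of u v] by simp
    have "\<eta> (us @ x # y # vs, as) + \<eta> (us @ y # x # vs, as) = 0"
      using z[of us "x + y" vs as, unfolded a b] by (simp add: z add.commute)
    then show "\<eta> (us @ x # y # vs, as) + \<eta> (us @ y # x # vs, as) = - \<eta> (us @ vs, 0 # as)"
      by (simp add: lin_zero[OF mlin_slotm[OF assms]])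
  qed
qed

end

section \<open>Chevalley-Eilenberg cochains as basic cochains\<close>

definition pull :: "('z \<Rightarrow> 'z set) \<Rightarrow> ('z set list \<Rightarrow> 'w) \<Rightarrow> 'z list \<times> 'm list \<Rightarrow> 'w::zero"
  where "pull \<pi> f = (\<lambda>(xs, as). if as = [] then f (map \<pi> xs) else 0)"

lemma pull_apply [simp]: "pull \<pi> f (xs, []) = f (map \<pi> xs)" "as \<noteq> [] \<Longrightarrow> pull \<pi> f (xs, as) = 0"
  "pull \<pi> f (xs, \<alpha> # as) = 0"
  by (simp_all add: pull_def)

lemma vanishes_above_pull: "vanishes_above 0 (pull \<pi> f)"
  by (simp add: vanishes_above_def)

context alternator
begin

text \<open>
  Without arguments in the second list there is nothing to contract into.
\<close>

lemma wick_id: 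
  assumes "vanishes_above 0 \<eta>" shows "W c \<eta> = \<eta>"
proof
  fix u :: "'z list \<times> 'm list"
  obtain xs as where u: "u = (xs, as)" by fastforce
  show "W c \<eta> u = \<eta> u" unfolding u using assms
  proof (induction xs arbitrary: \<eta>)
    case (Cons x xs)
    have "shift (h x) \<eta> = 0"
      using vanishes_above_shift[OF Cons(2)] by (auto simp: fun_eq_iff)
    then have "J c x \<eta> = arg0 x \<eta>" by (simp add: wick_arg_def fun_eq_iff)
    then show ?case using Cons by (simp add: vanishes_above_arg0)
  qed simp
qed

end

context lie2_module
begin

abbreviation "B \<equiv> range (dif L)"

definition cls :: "'z \<Rightarrow> 'z set" where "cls x = x +o B"

lemma B_subspace: "X.subspace B"
proof (rule X.subspaceI)
  show "0 \<in> B" using rangeI[of "dif L" 0] by (simp only: lin_zero[OF bilin_lins(11)])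
  show "x + y \<in> B" if "x \<in> B" "y \<in> B" for x y
    using that by (auto simp flip: lin_add[OF bilin_lins(11)])
  show "smul_0 L c x \<in> B" if "x \<in> B" for c x
    using that by (auto simp flip: lin_scale[OF bilin_lins(11)])
qed

lemma cls_eq_iff: "cls x = cls y \<longleftrightarrow> x - y \<in> B"
  unfolding cls_def by (rule coset_eq_iff[OF vs_0 B_subspace])

lemma mem_cls: "z \<in> cls x \<longleftrightarrow> cls z = cls x"
  by (simp add: cls_eq_iff) (simp add: cls_def flip: set_minus_plus)

lemma lie_carrier_eq: "lie_carrier L = range cls"
  by (simp add: lie_carrier_def quot_def cls_def[abs_def])

lemma cls_carrier [simp]: "set (map cls xs) \<subseteq> lie_carrier L"
  by (auto simp: lie_carrier_eq)

lemma cls_add: "cls x + cls y = cls (x + y)"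
  unfolding cls_def by (rule coset_add[OF vs_0 B_subspace])

lemma cls_smul: "lie_smul L c (cls x) = cls (smul_0 L c x)"
  unfolding cls_def lie_smul_def by (rule coset_smul[OF vs_0 B_subspace])

lemma cls_br: 
  assumes "cls x = cls x'" "cls y = cls y'"
  shows "cls (br_00 L x y) = cls (br_00 L x' y')"
proof -
  obtain \<alpha> \<beta> where *: "x = x' + dif L \<alpha>" "y = y' + dif L \<beta>"
    using assms unfolding cls_eq_iff by (metis add.commute diff_add_cancel rangeE)
  have "br_00 L x y - br_00 L x' y' = dif L (br_0m L x' \<beta> + (br_m0 L \<alpha> y' + br_m0 L \<alpha> (dif L \<beta>)))"
    by (simp add: * lin_add[OF bilin_lins(1)] lin_add[OF bilin_lins(2)] lin_add[OF bilin_lins(11)]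
        dif_br_0m dif_br_m0 algebra_simps)
  then show ?thesis by (simp add: cls_eq_iff)
qed

lemma lie_bracket_cls: "lie_bracket L (cls x) (cls y) = cls (br_00 L x y)"
proof -
  have "lie_bracket L (cls x) (cls y) = (\<Union>x'\<in>cls x. \<Union>y'\<in>cls y. cls (br_00 L x' y'))"
    by (simp add: lie_bracket_def cls_def[of "br_00 L _ _"])
  also have "\<dots> = (\<Union>x'\<in>cls x. \<Union>y'\<in>cls y. cls (br_00 L x y))"
    by (intro SUP_cong refl cls_br) (simp_all add: mem_cls)
  also have "\<dots> = cls (br_00 L x y)" using mem_cls[of x x] mem_cls[of y y] by auto
  finally show ?thesis .
qed

lemma lie_action_cls: "lie_action l (cls x) w = l x w"
proof -
  have "l x' w = l x w" if "x' \<in> cls x" for x'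
  proof -
    from that obtain \<alpha> where "x' - x = dif L \<alpha>" by (auto simp: mem_cls cls_eq_iff)
    then show ?thesis using l_dif[of \<alpha> w] lin_diff[OF bilin_lins(10), of x' x w] by simp
  qed
  then have "(\<lambda>x'. l x' w) ` cls x = (\<lambda>_. l x w) ` cls x" by (intro image_cong refl)
  moreover have "x \<in> cls x" by (simp only: mem_cls)
  ultimately have "(\<lambda>x'. l x' w) ` cls x = {l x w}" by blast
  then show ?thesis by (simp add: lie_action_def)
qed

lemma cls_skew: "cls (skew_00 L x y) = cls (br_00 L x y)"
proof -
  have "br_00 L y x = dif L (alt L x y) - br_00 L x y" using alt_00[of x y] by (simp add: algebra_simps)
  then have "skew_00 L x y - br_00 L x y = dif L (smul_m L (- (1 / 2)) (alt L x y))"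
    using skew_00_defect[of x y] lin_scale[OF bilin_lins(11), of "- (1/2)" "alt L x y"] by simp
  then show ?thesis by (simp add: cls_eq_iff)
qed

lemma lift_carrier: "set Xs \<subseteq> lie_carrier L \<Longrightarrow> \<exists>xs. Xs = map cls xs"
  unfolding lie_carrier_eq by (metis ex_map_conv subset_code(1) imageE)

abbreviation pull_cls :: "('z set list \<Rightarrow> 'w) \<Rightarrow> 'z list \<times> 'm list \<Rightarrow> 'w" where "pull_cls \<equiv> pull cls"

text \<open>
  Cochains on the quotient vanish on lists that are not lists of cosets, so nothing is lost.
\<close>

lemma pull_inj:
  assumes "f \<in> ce_hom L t q" "g \<in> ce_hom L t q'" "(pull_cls f :: 'z list \<times> 'm list \<Rightarrow> 'w) = pull_cls g"
  shows "f = g"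
proof
  fix Xs show "f Xs = g Xs"
  proof (cases "set Xs \<subseteq> lie_carrier L")
    case True
    then obtain xs where "Xs = map cls xs" using lift_carrier by blast
    then show ?thesis using fun_cong[OF assms(3), of "(xs, [])"] by simp
  next
    case False then show ?thesis using assms(1,2) by (simp add: ce_hom_def)
  qed
qed

text \<open>
  The right-hand side of the weak symmetry relation has an argument in the second list.
\<close>

lemma sk_ws_basic:
  fixes h :: "'z \<Rightarrow> 'z \<Rightarrow> 'm"
  assumes "vanishes_above 0 \<eta>" shows "weakly_symmetric h \<eta> \<longleftrightarrow> sk \<eta>"
  using assms by (simp add: weakly_symmetric_def vanishes_above_def)

lemma basic_pull:
  assumes "mlin (pull_cls f)"
  shows "basic (dif L) (pull_cls f :: 'z list \<times> 'm list \<Rightarrow> 'w)"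
  unfolding basic_def
proof (intro allI impI)
  fix xs and as :: "'m list" assume *: "as \<noteq> [] \<or> (\<exists>x\<in>set xs. x \<in> B)"
  show "pull_cls f (xs, as) = 0"
  proof (cases "as = []")
    case True
    with * obtain x where "x \<in> set xs" "x \<in> B" by blast
    then obtain us vs where xs: "xs = us @ x # vs" by (meson split_list)
    have "cls x = cls 0" using \<open>x \<in> B\<close> by (simp add: cls_eq_iff)
    then have "pull_cls f (xs, as) = pull_cls f (us @ 0 # vs, as)" by (simp add: xs True)
    then show ?thesis using lin_zero[OF mlin_slot0[OF assms]] by simp
  qed simp
qed

lemma pull_props:
  assumes f: "f \<in> ce_hom L t q"
  shows "homogeneous q (pull_cls f)" "mlin (pull_cls f)" "weakly_symmetric h (pull_cls f)"
    "basic (dif L) (pull_cls f :: 'z list \<times> 'm list \<Rightarrow> 'w)"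
proof -
  have f0: "f Xs = 0" if "\<not> (set Xs \<subseteq> lie_carrier L \<and> int (length Xs) = q)" for Xs
    using f that by (simp add: ce_hom_def)
  have "multilinear_on (lie_carrier L) (lie_smul L) t f" using f by (simp add: ce_hom_def)
  then have f1: "lin_on (lie_carrier L) (lie_smul L) t (\<lambda>y. f ((map cls (us @ 0 # vs))[length us := y]))" for us vs
    unfolding multilinear_on_def using cls_carrier[of "us @ 0 # vs"] by (simp del: set_map map_append)
  have f2: "alternating f" using f by (simp add: ce_hom_def)
  show h: "homogeneous q (pull_cls f)" unfolding homogeneous_def
  proof (intro allI impI)
    fix xs :: "'z list" and as :: "'m list" assume "int (length xs) + 2 * int (length as) \<noteq> q"
    then show "pull_cls f (xs, as) = 0" by (cases "as = []") (auto intro: f0)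
  qed
  show m: "mlin (pull_cls f)"
  proof (rule mlinI)
    show "lin (smul_0 L) t (\<lambda>x. pull_cls f (us @ x # vs, as))" for us vs and as :: "'m list"
    proof (cases "as = []")
      case True
      have c: "cls x \<in> lie_carrier L" for x by (simp add: lie_carrier_eq)
      show ?thesis using f1[of us vs] c True
        by (simp add: lin_on_def list_update_append flip: cls_add cls_smul)
    qed (simp add: lin_0)
  qed (simp_all add: lin_0)
  have "sk (pull_cls f)"
    unfolding sk_iff_alternating[OF m]
  proof
    fix as show "alternating (\<lambda>xs. pull_cls f (xs, as))"
      using f2 unfolding alternating_def by (cases "as = []") (auto simp: distinct_map)
  qed
  then show "weakly_symmetric h (pull_cls f)" by (simp only: sk_ws_basic[OF vanishes_above_pull, of h])
  show "basic (dif L) (pull_cls f :: 'z list \<times> 'm list \<Rightarrow> 'w)"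
    by (rule basic_pull[OF m])
qed

text \<open>
  A basic cochain depends only on the cosets of its arguments, hence may be evaluated at arbitrary
  representatives.
\<close>

lemma basic_imp_pull:
  assumes "homogeneous q \<eta>" "mlin \<eta>" "ws \<eta> \<or> sk \<eta>" "basic (dif L) \<eta>"
  shows "\<exists>f\<in>ce_hom L t q. pull_cls f = \<eta>"
proof -
  have van: "vanishes_above 0 \<eta>" using assms(4) by (auto simp: basic_def vanishes_above_def)
  then have sk: "sk \<eta>" using assms(3) sk_ws_basic by blast
  have cong1: "\<eta> (us @ x # vs, []) = \<eta> (us @ y # vs, [])" if "cls x = cls y" for us vs x y
  proof -
    have "\<eta> (us @ (x - y) # vs, []) = 0"
      using assms(4) that unfolding basic_def cls_eq_iff by (metis in_set_conv_decomp)
    then show ?thesis using lin_diff[OF mlin_slot0[OF assms(2)], of us x y vs "[]"] by simp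
  qed
  have cong: "\<eta> (us @ xs, []) = \<eta> (us @ ys, [])" if "map cls xs = map cls ys" for us xs ys
    using that
  proof (induction xs arbitrary: ys us)
    case (Cons x xs)
    then obtain y ys' where ys: "ys = y # ys'" "cls x = cls y" "map cls xs = map cls ys'" by auto
    show ?case using Cons(1)[of ys' "us @ [x]"] cong1[OF ys(2), of us ys'] ys by simp
  qed simp
  define r where "r X = (SOME x. cls x = X)" for X
  have r: "cls (r X) = X" if "X \<in> lie_carrier L" for X
    unfolding r_def by (rule someI_ex) (use that in \<open>auto simp: lie_carrier_eq\<close>)
  define f where "f Xs = (if set Xs \<subseteq> lie_carrier L then \<eta> (map r Xs, []) else 0)" for Xs
  have f_cls: "f (map cls xs) = \<eta> (xs, [])" for xs
  proof -
    have "map cls (map r (map cls xs)) = map cls xs" by (simp add: r lie_carrier_eq)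
    from cong[OF this, of "[]"] show ?thesis by (simp add: f_def del: set_map map_map)
  qed
  have pull: "pull_cls f = \<eta>"
  proof
    fix u :: "'z list \<times> 'm list"
    obtain xs as where u: "u = (xs, as)" by fastforce
    show "pull_cls f u = \<eta> u" using assms(4) unfolding u by (cases "as = []") (auto simp: f_cls basic_def)
  qed
  have "f \<in> ce_hom L t q"
    unfolding ce_hom_def
  proof (intro CollectI conjI allI impI)
    fix Xs assume *: "\<not> (set Xs \<subseteq> lie_carrier L \<and> int (length Xs) = q)"
    show "f Xs = 0"
      using * hom_apply[OF assms(1), of "map r Xs" "[]"] by (auto simp: f_def)
  next
    show "multilinear_on (lie_carrier L) (lie_smul L) t f"
      unfolding multilinear_on_def
    proof (intro allI impI)
      fix Xs i assume Xs: "set Xs \<subseteq> lie_carrier L \<and> i < length Xs"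
      then obtain xs where xs: "Xs = map cls xs" using lift_carrier by blast
      have *: "f (Xs[i := cls y]) = \<eta> (xs[i := y], [])" for y
        by (simp add: xs f_cls flip: map_update)
      have "lin (smul_0 L) t (\<lambda>y. \<eta> (xs[i := y], []))"
        using Xs xs mlin_slot0[OF assms(2)] by (simp add: upd_conv_take_nth_drop)
      then show "lin_on (lie_carrier L) (lie_smul L) t (\<lambda>Y. f (Xs[i := Y]))"
        by (auto simp: lin_on_def lie_carrier_eq cls_add cls_smul *)
    qed
  next
    show "alternating f" unfolding alternating_def
    proof (intro allI impI)
      fix Xs :: "'z set list" assume "\<not> distinct Xs"
      then have "\<not> distinct (map r Xs)" by (simp add: distinct_map)
      then show "f Xs = 0" using sk sk_iff_alternating[OF assms(2)] by (simp add: f_def alternating_def)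
    qed
  qed
  then show ?thesis using pull by blast
qed

text \<open>
  The skew differential has the same shape as that of Chevalley and Eilenberg, and the two brackets agree
  modulo \<open>d L\<^sup>-\<^sup>1\<close>.
\<close>

lemma S_D_pull:
  assumes "f \<in> ce_hom L t q"
  shows "S.D (pull_cls f) = pull_cls (ce_diff_part L t l f)"
proof
  fix u :: "'z list \<times> 'm list"
  obtain xs as where u: "u = (xs, as)" by fastforce
  note f = pull_props[OF assms]
  have "skew_diff_part L t l (pull_cls f) (xs, as) = pull_cls (ce_diff_part L t l f) (xs, as)"
  proof (cases "as = []")
    case True
    have o: "map cls (omit i ys) = omit i (map cls ys)" for i ys by (simp add: omit_def take_map drop_map)
    show ?thesis using cls_carrier[of xs]
      by (simp add: True skew_diff_part_def ce_diff_part_def o cls_skew lie_action_cls lie_bracket_cls del: set_map)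
  next
    case False
    have "pull_cls f (dif L (as ! j) # xs, omit j as) = 0" for j
      using f(4) by (auto simp: basic_def)
    then show ?thesis using False
      by (simp add: skew_diff_part_def lin_zero[OF bilin_lins(9)])
  qed
  then show "S.D (pull_cls f) u = pull_cls (ce_diff_part L t l f) u"
    by (simp add: u skew_diff_part_eq[OF f(2,3)])
qed

text \<open>
  Transported along \<open>wick\<close>, which fixes pulled back cochains.
\<close>

lemma R_D_pull:
  assumes "f \<in> ce_hom L t q"
  shows "R.D (pull_cls f) = pull_cls (ce_diff_part L t l f)"
  using wick_D[OF pull_props(2,3)[OF assms]]
  by (simp add: S_D_pull[OF assms] wick_id vanishes_above_pull)

text \<open>
  Inherited from the complex of the representation, where it was shown for \<open>D\<close>.
\<close>

lemma ce_diff_part_in: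
  assumes "f \<in> ce_hom L t q"
  shows "ce_diff_part L t l f \<in> ce_hom L t (q + 1)"
proof -
  let ?g = "ce_diff_part L t l f"
  note f = pull_props[OF assms]
  have "homogeneous (q + 1) (pull_cls ?g)" "mlin (pull_cls ?g)" "ws (pull_cls ?g)"
    using f by (simp_all flip: R_D_pull[OF assms])
  then obtain g where g: "g \<in> ce_hom L t (q + 1)" "pull_cls g = (pull_cls ?g :: 'z list \<times> 'm list \<Rightarrow> 'w)"
    using basic_imp_pull basic_pull by blast
  have "g Xs = ?g Xs" for Xs
  proof (cases "set Xs \<subseteq> lie_carrier L")
    case True
    then obtain xs where "Xs = map cls xs" using lift_carrier by blast
    then show ?thesis using fun_cong[OF g(2), of "(xs, [])"] by simp
  next
    case False then show ?thesis using g(1) by (simp add: ce_hom_def ce_diff_part_def)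
  qed
  then have "g = ?g" by blast
  with g(1) show ?thesis by simp
qed

end

section \<open>The two components of a cochain\<close>

text \<open>
  All operations are natural in the space of values.  This is needed for the differential of \<open>V\<close>, which
  maps one of the two components of a cochain to the other.
\<close>

lemma arg_map: "arg0 x (\<lambda>u. T (\<eta> u)) = (\<lambda>u. T (arg0 x \<eta> u))" "argm \<alpha> (\<lambda>u. T (\<eta> u)) = (\<lambda>u. T (argm \<alpha> \<eta> u))"
  by (auto simp: fun_eq_iff)

context
  fixes T :: "'w::ab_group_add \<Rightarrow> 'v::ab_group_add"
  assumes T_add: "T (x + y) = T x + T y"
begin

lemma T_diff: "T (x - y) = T x - T y"
  by (metis T_add add_diff_cancel_right' diff_add_cancel)

lemma T_0: "T 0 = 0" using T_diff[of 0 0] by simp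

lemma shift_map: "shift \<phi> (\<lambda>u. T (\<eta> u)) = (\<lambda>u. T (shift \<phi> \<eta> u))"
proof
  fix u show "shift \<phi> (\<lambda>u. T (\<eta> u)) u = T (shift \<phi> \<eta> u)"
    by (induction \<phi> \<eta> u rule: shift.induct) (simp_all add: T_0 T_diff arg_map)
qed

lemma lie_deriv_map:
  assumes "\<And>w. l' (T w) = T (l w)"
  shows "lie_deriv l' f g (\<lambda>u. T (\<eta> u)) = (\<lambda>u. T (lie_deriv l f g \<eta> u))"
proof
  fix u show "lie_deriv l' f g (\<lambda>u. T (\<eta> u)) u = T (lie_deriv l f g \<eta> u)"
    using assms by (induction l f g \<eta> u rule: lie_deriv.induct) (simp_all add: T_diff arg_map)
qed

lemma cartan_diff_map:
  assumes "\<And>x \<eta>. \<Lambda>' x (\<lambda>u. T (\<eta> u)) = (\<lambda>u. T (\<Lambda> x \<eta> u))"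
  shows "cartan_diff d \<Lambda>' (\<lambda>u. T (\<eta> u)) = (\<lambda>u. T (cartan_diff d \<Lambda> \<eta> u))"
proof
  fix u show "cartan_diff d \<Lambda>' (\<lambda>u. T (\<eta> u)) u = T (cartan_diff d \<Lambda> \<eta> u)"
    using assms by (induction d \<Lambda> \<eta> u rule: cartan_diff.induct) (simp_all add: T_0 T_add T_diff arg_map)
qed

lemma wick_map:
  fixes h :: "'z \<Rightarrow> 'z \<Rightarrow> 'm" and \<eta> :: "'z list \<times> 'm list \<Rightarrow> 'w"
  assumes "\<And>c w. t' c (T w) = T (t c w)"
  shows "wick t' h c (\<lambda>u. T (\<eta> u)) = (\<lambda>u. T (wick t h c \<eta> u))"
proof
  fix u :: "'z list \<times> 'm list"
  have J: "wick_arg t' h c x (\<lambda>u. T (\<eta> u)) = (\<lambda>u. T (wick_arg t h c x \<eta> u))" for x and \<eta> :: "'z list \<times> 'm list \<Rightarrow> 'w"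
    by (simp add: wick_arg_def arg_map shift_map assms T_add fun_eq_iff)
  obtain xs as where u: "u = (xs, as)" by fastforce
  show "wick t' h c (\<lambda>u. T (\<eta> u)) u = T (wick t h c \<eta> u)"
    unfolding u by (induction xs arbitrary: \<eta>) (simp_all add: J)
qed

end

text \<open>
  Stated for arbitrary functions: \<open>wick_inverse\<close> applies only to multilinear ones, and the skew
  differential of a cochain is not known to be multilinear before this lemma is used.
\<close>

lemma wick_injective: 
  fixes \<eta> :: "'z list \<times> 'm list \<Rightarrow> 'w::ab_group_add"
  assumes "vector_space t" "wick t h c \<eta> = 0" shows "\<eta> = 0"
proof -
  interpret vector_space t by fact
  have "\<eta> (xs, as) = 0" if "\<And>xs as. length xs \<le> n \<Longrightarrow> wick t h c \<eta> (xs, as) = 0" "length xs \<le> n" for n xs as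
    using that
  proof (induction n arbitrary: \<eta> xs as)
    case 0
    then show ?case using 0(1)[of "[]" as] by simp
  next
    case (Suc n)
    have small: "\<eta> (ys, bs) = 0" if "length ys \<le> n" for ys bs
      by (rule Suc(1)[OF _ that]) (rule Suc(2), simp)
    show ?case
    proof (cases xs)
      case Nil then show ?thesis using Suc(2)[of "[]" as] by simp
    next
      case (Cons x ys)
      have "wick_arg t h c x \<eta> (ys, as) = 0"
      proof (rule Suc(1))
        show "wick t h c (wick_arg t h c x \<eta>) (zs, bs) = 0" if "length zs \<le> n" for zs bs
          using Suc(2)[of "x # zs" bs] that by simp
      qed (use Suc(3) Cons in simp)
      moreover have "shift \<phi> \<zeta> (zs, as) = 0" if "\<And>ys as. length ys < length zs \<Longrightarrow> \<zeta> (ys, as) = 0"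
        for \<phi> zs and \<zeta> :: "'z list \<times> 'm list \<Rightarrow> 'w"
        using that by (induction zs arbitrary: \<zeta>) simp_all
      then have "shift (h x) \<eta> (ys, as) = 0" using small Suc(3) Cons by simp
      ultimately show ?thesis using Cons by (simp add: wick_arg_def)
    qed
  qed
  then show ?thesis using assms(2) by (auto simp: fun_eq_iff)
qed

text \<open>
  The two spaces of \<open>V\<close> give two modules, which share the splitting \<open>s\<close>.
\<close>

locale lie2_pair = L: hemistrict_lie2 L + V: hemistrict_lie2_rep L V
  for L :: "('k::field_char_0, 'm::ab_group_add, 'z::ab_group_add) lie2"
    and V :: "('k, 'm, 'z, 'a::ab_group_add, 'b::ab_group_add) lie2_rep" +
  fixes s :: "'z \<Rightarrow> 'm"
  assumes l_m0_zero: "l_m0 V \<alpha> v = 0"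
    and s_lin: "lin (smul_0 L) (smul_m L) s" and s_dif: "s (dif L \<alpha>) = \<alpha>"
begin

sublocale m: split_lie2_module L "smul_m V" "l_0m V" s
proof (intro split_lie2_module.intro lie2_module.intro coefficients.intro lie2_module_axioms.intro
    split_lie2_module_axioms.intro)
  show "l_0m V (dif L \<alpha>) w = 0" for \<alpha> w using V.dif_l_mm[of \<alpha> w] by (simp add: l_m0_zero)
qed (rule L.hemistrict_lie2_axioms V.vs_m V.l_0m_bilin V.l_br_00m s_lin s_dif)+

sublocale z: split_lie2_module L "smul_0 V" "l_00 V" s
proof (intro split_lie2_module.intro lie2_module.intro coefficients.intro lie2_module_axioms.intro
    split_lie2_module_axioms.intro)
  show "l_00 V (dif L \<alpha>) v = 0" for \<alpha> v
    using V.dif_l_m0[of \<alpha> v] lin_zero[OF linear_imp_lin[OF V.dif_linear]] by (simp add: l_m0_zero)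
qed (rule L.hemistrict_lie2_axioms V.vs_0 V.l_00_bilin V.l_br_000 s_lin s_dif)+

abbreviation "dV \<equiv> dif V"

lemma dV_lin: "lin (smul_m V) (smul_0 V) dV"
  by (rule linear_imp_lin[OF V.dif_linear])

abbreviation T :: "('z list \<times> 'm list \<Rightarrow> 'a) \<Rightarrow> 'z list \<times> 'm list \<Rightarrow> 'b"
  where "T \<omega> \<equiv> (\<lambda>u. dV (\<omega> u))"

lemmas T_add = lin_add[OF dV_lin]

lemma T_R_D: "z.R.D (T \<omega>) = T (m.R.D \<omega>)"
  by (intro cartan_diff_map lie_deriv_map T_add) (simp add: V.dif_l_0m)

lemma T_shift: "shift \<phi> (T \<omega>) = T (shift \<phi> \<omega>)"
  by (intro shift_map T_add)

lemma T_wick: "z.W c (T \<omega>) = T (m.W c \<omega>)"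
  by (intro wick_map T_add) (simp add: lin_scale[OF dV_lin])

lemma mlin_T [simp]: "m.mlin \<omega> \<Longrightarrow> z.mlin (T \<omega>)"
  by (rule z.mlinI) (auto intro: lin_compose[OF m.mlin_slot0 dV_lin] lin_compose[OF m.mlin_slotm dV_lin]
      simp: m.mlin_swap[of \<omega>])

lemma ws_T [simp]: "weakly_symmetric h \<omega> \<Longrightarrow> weakly_symmetric h (T \<omega>)"
  unfolding weakly_symmetric_def by (simp add: lin_minus[OF dV_lin] flip: T_add)

lemma hom_T [simp]: "homogeneous p \<omega> \<Longrightarrow> homogeneous p (T \<omega>)"
  by (simp add: homogeneous_def lin_zero[OF dV_lin])

end

lemma ce_hom_map:
  fixes T :: "'w::ab_group_add \<Rightarrow> 'v::ab_group_add"
  assumes "lin t t' T" "f \<in> ce_hom L t q" shows "(\<lambda>Xs. T (f Xs)) \<in> ce_hom L t' q"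
  using assms(2) lin_zero[OF assms(1)] lin_add[OF assms(1)] lin_scale[OF assms(1)]
  by (auto simp: ce_hom_def multilinear_on_def lin_on_def alternating_def)

context lie2_module
begin

lemma ce_hom_add:
  assumes "f \<in> ce_hom L t q" "g \<in> ce_hom L t q" shows "f + g \<in> ce_hom L t q"
  using assms
  by (auto simp: ce_hom_def multilinear_on_def lin_on_def alternating_def scale_right_distrib)

lemma ce_hom_scale: "f \<in> ce_hom L t q \<Longrightarrow> (\<lambda>Xs. t c (f Xs)) \<in> ce_hom L t q"
  by (rule ce_hom_map[where t = t]) (simp_all add: lin_on_def scale_right_distrib mult.commute)

lemma ce_hom_zero: "0 \<in> ce_hom L t q"
  by (simp add: ce_hom_def multilinear_on_def lin_on_def alternating_def)

end

lemma pull_ops: "pull \<pi> (f + g) = pull \<pi> f + pull \<pi> g" "T 0 = 0 \<Longrightarrow> pull \<pi> (\<lambda>Xs. T (f' Xs)) = (\<lambda>u. T (pull \<pi> f' u))"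
  "pull \<pi> 0 = 0"
  for f g :: "'z set list \<Rightarrow> 'w::ab_group_add" and f' :: "'z set list \<Rightarrow> 'v::zero" and T :: "'v \<Rightarrow> 'u::zero"
  by (auto simp: pull_def fun_eq_iff)

context lie2_pair
begin

abbreviation e :: "int \<Rightarrow> 'k" where "e n \<equiv> (- 1) powi (n + 1)"

lemma e_Suc: "e (n + 1) = - e n" "e (n - 1) = - e n"
proof -
  show "e (n + 1) = - e n" for n using power_int_add_1[of "- 1 :: 'k" "n + 1"] by simp
  from this[of "n - 1"] show "e (n - 1) = - e n" by simp
qed

abbreviation smul where "smul \<equiv> cochain_smul V"

lemma smul_apply: "smul c (\<omega>, \<eta>) = (\<lambda>u. smul_m V c (\<omega> u), \<lambda>u. smul_0 V c (\<eta> u))"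
  by (simp add: cochain_smul_def)

lemma smul_vs: "vector_space (smul :: 'k \<Rightarrow> ('u \<Rightarrow> 'a) \<times> ('u \<Rightarrow> 'b) \<Rightarrow> _)"
  by unfold_locales
    (auto simp: smul_apply fun_eq_iff m.scale_right_distrib z.scale_right_distrib m.scale_left_distrib z.scale_left_distrib)

lemma rep_mem: "(\<omega>, \<eta>) \<in> rep_cochains L V n \<longleftrightarrow>
    (homogeneous (n + 1) \<omega> \<and> m.mlin \<omega> \<and> m.ws \<omega>) \<and> (homogeneous n \<eta> \<and> z.mlin \<eta> \<and> z.ws \<eta>)"
  by (auto simp: rep_cochains_def m.poly_hom_iff z.poly_hom_iff)

lemma skew_mem: "(\<omega>, \<eta>) \<in> skew_cochains L V n \<longleftrightarrow>
    (homogeneous (n + 1) \<omega> \<and> m.mlin \<omega> \<and> m.sk \<omega>) \<and> (homogeneous n \<eta> \<and> z.mlin \<eta> \<and> z.sk \<eta>)"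
  by (auto simp: skew_cochains_def m.poly_hom_iff z.poly_hom_iff m.sk_iff_alternating z.sk_iff_alternating)

lemma rep_diff_eq:
  assumes "(\<omega>, \<eta>) \<in> rep_cochains L V n"
  shows "rep_diff L V n (\<omega>, \<eta>) = (m.R.D \<omega>, (\<lambda>u. smul_0 V (e n) (T \<omega> u)) + z.R.D \<eta>)"
  using assms by (simp add: rep_mem rep_diff_def m.rep_diff_part_eq z.rep_diff_part_eq fun_eq_iff)

lemma skew_diff_eq:
  assumes "(\<omega>, \<eta>) \<in> skew_cochains L V n"
  shows "skew_diff L V n (\<omega>, \<eta>) = (m.S.D \<omega>, (\<lambda>u. smul_0 V (e n) (T \<omega> u)) + z.S.D \<eta>)"
  using assms by (simp add: skew_mem skew_diff_def m.skew_diff_part_eq z.skew_diff_part_eq fun_eq_iff)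

definition pull2 :: "('z set list \<Rightarrow> 'a) \<times> ('z set list \<Rightarrow> 'b) \<Rightarrow>
    ('z list \<times> 'm list \<Rightarrow> 'a) \<times> ('z list \<times> 'm list \<Rightarrow> 'b)"
  where "pull2 = (\<lambda>(f, g). (m.pull_cls f, z.pull_cls g))"

text \<open>
  The differential of \<open>V\<close> enters \<open>D h\<close> and \<open>h D\<close> with opposite signs, because its sign depends on the
  degree and \<open>h\<close> lowers the degree.  So \<open>N\<close> acts on the two components separately.  By assumption
  \<open>h\<close> kills the differential of the cochain, thus only \<open>D h\<close> contributes to \<open>N\<close>.
\<close>

lemma relax_step:
  assumes x: "(\<omega>, \<eta>) \<in> rep_cochains L V n"
    and b: "basic (dif L) (m.R.D \<omega>)" "basic (dif L) ((\<lambda>u. smul_0 V (e n) (T \<omega> u)) + z.R.D \<eta>)"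
  shows "\<exists>z\<in>rep_cochains L V (n - 1). (m.relax k \<omega>, z.relax k \<eta>) = (\<omega>, \<eta>) - rep_diff L V (n - 1) z"
proof
  let ?c = "1 / of_nat k :: 'k"
  let ?\<omega> = "\<lambda>u. smul_m V ?c (shift s \<omega> u)" and ?\<eta> = "\<lambda>u. smul_0 V ?c (shift s \<eta> u)"
  note x' = x[unfolded rep_mem]
  have "homogeneous (n + 1 - 1) (shift s \<omega>)" "homogeneous (n - 1) (shift s \<eta>)" using x' by (blast intro: hom_shift)+
  then show z: "(?\<omega>, ?\<eta>) \<in> rep_cochains L V (n - 1)"
    using x' by (simp add: rep_mem m.mlin_shift z.mlin_shift m.ws_shift z.ws_shift s_lin)
  have 1: "shift s (m.R.D \<omega>) = 0" by (rule basic_shift[OF b(1)])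
  have "shift s ((\<lambda>u. smul_0 V (e n) (T \<omega> u)) + z.R.D \<eta>) = 0" by (rule basic_shift[OF b(2)])
  then have 2: "shift s (z.R.D \<eta>) = (\<lambda>u. smul_0 V (e (n - 1)) (T (shift s \<omega>) u))"
    unfolding z.shift_simps T_shift e_Suc by (simp add: fun_eq_iff add_eq_0_iff)
  have "smul_0 V (e (n - 1)) (dV (smul_m V ?c w)) = smul_0 V ?c (smul_0 V (e (n - 1)) (dV w))" for w
    by (simp add: lin_scale[OF dV_lin] mult.commute)
  then show "(m.relax k \<omega>, z.relax k \<eta>) = (\<omega>, \<eta>) - rep_diff L V (n - 1) (?\<omega>, ?\<eta>)"
    unfolding rep_diff_eq[OF z] m.R.D_simps z.R.D_simps m.relax_def z.relax_def m.R.K_def z.R.K_def 1 2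
    by (simp add: fun_eq_iff z.scale_right_distrib algebra_simps)
qed

lemma rep_subspace: "module.subspace smul (rep_cochains L V n)"
proof -
  interpret vector_space "smul :: 'k \<Rightarrow> ('z list \<times> 'm list \<Rightarrow> 'a) \<times> ('z list \<times> 'm list \<Rightarrow> 'b) \<Rightarrow> _" by (rule smul_vs)
  show ?thesis by (rule subspaceI) (auto simp: rep_mem smul_apply zero_prod_def)
qed

lemma skew_subspace: "module.subspace smul (skew_cochains L V n)"
proof -
  interpret vector_space "smul :: 'k \<Rightarrow> ('z list \<times> 'm list \<Rightarrow> 'a) \<times> ('z list \<times> 'm list \<Rightarrow> 'b) \<Rightarrow> _" by (rule smul_vs)
  show ?thesis by (rule subspaceI) (auto simp: skew_mem smul_apply zero_prod_def)
qed

lemma ce_subspace: "module.subspace smul (ce_cochains L V n)"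
proof -
  interpret vector_space "smul :: 'k \<Rightarrow> ('z set list \<Rightarrow> 'a) \<times> ('z set list \<Rightarrow> 'b) \<Rightarrow> _" by (rule smul_vs)
  show ?thesis
    by (rule subspaceI) (auto simp: ce_cochains_def smul_apply zero_prod_def m.ce_hom_zero z.ce_hom_zero
      m.ce_hom_add z.ce_hom_add m.ce_hom_scale z.ce_hom_scale)
qed

lemma rep_diff_in: "x \<in> rep_cochains L V n \<Longrightarrow> rep_diff L V n x \<in> rep_cochains L V (n + 1)"
proof (cases x)
  case (Pair \<omega> \<eta>)
  assume x: "x \<in> rep_cochains L V n"
  then have *: "(homogeneous (n + 1) \<omega> \<and> m.mlin \<omega> \<and> m.ws \<omega>) \<and> (homogeneous n \<eta> \<and> z.mlin \<eta> \<and> z.ws \<eta>)"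
    by (simp add: Pair rep_mem)
  show ?thesis using x * m.hom_D[of "n + 1" \<omega>] z.hom_D[of n \<eta>]
    unfolding Pair by (simp add: rep_diff_eq rep_mem del: z.lie_deriv_simps)
qed

lemma rep_diff_lin: "lin_on (rep_cochains L V n) smul smul (rep_diff L V n)"
  unfolding lin_on_def
proof (intro conjI ballI allI)
  interpret vs: vector_space "smul :: 'k \<Rightarrow> ('z list \<times> 'm list \<Rightarrow> 'a) \<times> ('z list \<times> 'm list \<Rightarrow> 'b) \<Rightarrow> _" by (rule smul_vs)
  fix x y c assume x: "x \<in> rep_cochains L V n"
  obtain \<omega> \<eta> where p: "x = (\<omega>, \<eta>)" by fastforce
  have "rep_diff L V n (smul c x) = (m.R.D (\<lambda>u. smul_m V c (\<omega> u)),
      (\<lambda>u. smul_0 V (e n) (T (\<lambda>u. smul_m V c (\<omega> u)) u)) + z.R.D (\<lambda>u. smul_0 V c (\<eta> u)))"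
    using vs.subspace_scale[OF rep_subspace x, of c] by (simp add: p smul_apply rep_diff_eq)
  then show "rep_diff L V n (smul c x) = smul c (rep_diff L V n x)"
    using x by (simp add: p rep_diff_eq smul_apply fun_eq_iff z.scale_right_distrib lin_scale[OF dV_lin] mult.commute)
  assume y: "y \<in> rep_cochains L V n"
  obtain \<omega>' \<eta>' where q: "y = (\<omega>', \<eta>')" by fastforce
  have "rep_diff L V n (x + y) = (m.R.D (\<omega> + \<omega>'), (\<lambda>u. smul_0 V (e n) (T (\<omega> + \<omega>') u)) + z.R.D (\<eta> + \<eta>'))"
    using vs.subspace_add[OF rep_subspace x y] by (simp add: p q rep_diff_eq)
  then show "rep_diff L V n (x + y) = rep_diff L V n x + rep_diff L V n y"
    using x y by (simp add: p q rep_diff_eq fun_eq_iff z.scale_right_distrib T_add)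
qed

lemma rep_diff_add:
  "x \<in> rep_cochains L V n \<Longrightarrow> y \<in> rep_cochains L V n \<Longrightarrow>
    rep_diff L V n (x + y) = rep_diff L V n x + rep_diff L V n y"
  using rep_diff_lin[of n] by (simp add: lin_on_def)

lemma rep_diff_rep_diff: "rep_diff L V (n + 1) (rep_diff L V n x) = 0" if x: "x \<in> rep_cochains L V n"
proof -
  obtain \<omega> \<eta> where p: "x = (\<omega>, \<eta>)" by fastforce
  have *: "m.mlin \<omega>" "m.ws \<omega>" "z.mlin \<eta>" "z.ws \<eta>" using x by (simp_all add: p rep_mem)
  have "(- 1 :: 'k) powi (2 + n) = - e n" using e_Suc(1)[of n] by (simp add: add.commute add.left_commute)
  then show ?thesis
    using rep_diff_in[OF x] x unfolding p rep_diff_eq[OF x[unfolded p]]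
    by (simp add: rep_diff_eq m.D_D z.D_D * T_R_D fun_eq_iff zero_prod_def)
qed

text \<open>
  A step does not change the differential, so it can be followed by the next one.
\<close>

lemma relax_steps:
  assumes "(\<omega>, \<eta>) \<in> rep_cochains L V n"
    and "basic (dif L) (fst (rep_diff L V n (\<omega>, \<eta>)))" "basic (dif L) (snd (rep_diff L V n (\<omega>, \<eta>)))"
  shows "\<exists>z\<in>rep_cochains L V (n - 1). (fold m.relax ks \<omega>, fold z.relax ks \<eta>) = (\<omega>, \<eta>) - rep_diff L V (n - 1) z"
  using assms
proof (induction ks arbitrary: \<omega> \<eta>)
  interpret vs: vector_space "smul :: 'k \<Rightarrow> ('z list \<times> 'm list \<Rightarrow> 'a) \<times> ('z list \<times> 'm list \<Rightarrow> 'b) \<Rightarrow> _" by (rule smul_vs)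
  case Nil
  have "rep_diff L V (n - 1) 0 = 0"
    using rep_diff_add[of 0 "n - 1" 0] vs.subspace_0[OF rep_subspace] by simp
  then show ?case using vs.subspace_0[OF rep_subspace] by (intro bexI[of _ 0]) auto
next
  interpret vs: vector_space "smul :: 'k \<Rightarrow> ('z list \<times> 'm list \<Rightarrow> 'a) \<times> ('z list \<times> 'm list \<Rightarrow> 'b) \<Rightarrow> _" by (rule smul_vs)
  note sub = vs.subspace_add[OF rep_subspace] vs.subspace_diff[OF rep_subspace]
  case (Cons k ks)
  have b: "basic (dif L) (m.R.D \<omega>)" "basic (dif L) ((\<lambda>u. smul_0 V (e n) (T \<omega> u)) + z.R.D \<eta>)"
    using Cons(3,4) unfolding rep_diff_eq[OF Cons(2)] fst_conv snd_conv by blast+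
  obtain z where z: "z \<in> rep_cochains L V (n - 1)"
    "(m.relax k \<omega>, z.relax k \<eta>) = (\<omega>, \<eta>) - rep_diff L V (n - 1) z"
    using relax_step[OF Cons(2) b] by blast
  have Dz: "rep_diff L V (n - 1) z \<in> rep_cochains L V n" "rep_diff L V n (rep_diff L V (n - 1) z) = 0"
    using rep_diff_in[OF z(1)] rep_diff_rep_diff[OF z(1)] by simp_all
  have in_n: "(m.relax k \<omega>, z.relax k \<eta>) \<in> rep_cochains L V n"
    unfolding z(2) by (rule sub(2)[OF Cons(2) Dz(1)])
  have "rep_diff L V n (m.relax k \<omega>, z.relax k \<eta>) = rep_diff L V n (\<omega>, \<eta>)"
    using rep_diff_add[OF in_n Dz(1)] Dz(2) z(2) by simp
  then obtain z' where z': "z' \<in> rep_cochains L V (n - 1)"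
    "(fold m.relax ks (m.relax k \<omega>), fold z.relax ks (z.relax k \<eta>))
      = (m.relax k \<omega>, z.relax k \<eta>) - rep_diff L V (n - 1) z'"
    using Cons(1)[OF in_n] Cons(3,4) by auto
  show ?case
  proof
    show "z + z' \<in> rep_cochains L V (n - 1)" by (rule sub(1)[OF z(1) z'(1)])
    show "(fold m.relax (k # ks) \<omega>, fold z.relax (k # ks) \<eta>) = (\<omega>, \<eta>) - rep_diff L V (n - 1) (z + z')"
      unfolding rep_diff_add[OF z(1) z'(1)] using z'(2) unfolding z(2) by (simp add: diff_diff_eq)
  qed
qed

lemma pull2_in: "y \<in> ce_cochains L V n \<Longrightarrow> pull2 y \<in> rep_cochains L V n"
  by (auto simp: ce_cochains_def pull2_def rep_mem m.pull_props z.pull_props)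

lemma pull2_image:
  assumes "(\<omega>, \<eta>) \<in> rep_cochains L V n" "basic (dif L) \<omega>" "basic (dif L) \<eta>"
  shows "(\<omega>, \<eta>) \<in> pull2 ` ce_cochains L V n"
proof -
  obtain f g where "f \<in> ce_hom L (smul_m V) (n + 1)" "m.pull_cls f = \<omega>" "g \<in> ce_hom L (smul_0 V) n" "z.pull_cls g = \<eta>"
    using assms m.basic_imp_pull[of "n + 1" \<omega>] z.basic_imp_pull[of n \<eta>] unfolding rep_mem by blast
  then have "(f, g) \<in> ce_cochains L V n" "pull2 (f, g) = (\<omega>, \<eta>)" by (simp_all add: ce_cochains_def pull2_def)
  then show ?thesis by (metis imageI)
qed

lemma rep_embedding:
  "cochain_embedding smul (rep_cochains L V) (rep_diff L V) smul (ce_cochains L V) (ce_diff L V) pull2"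
proof (rule cochain_embedding.intro)
  fix n
  show "lin_on (ce_cochains L V n) smul smul pull2"
    by (auto simp: lin_on_def pull2_def smul_apply pull_ops)
  show "inj_on pull2 (ce_cochains L V n)"
    by (auto simp: inj_on_def pull2_def ce_cochains_def dest: m.pull_inj z.pull_inj)
  show "ce_diff L V n y \<in> ce_cochains L V (n + 1)" if "y \<in> ce_cochains L V n" for y
    using that m.ce_diff_part_in[of _ "n + 1"] z.ce_diff_part_in[of _ n]
      z.ce_hom_add[OF z.ce_hom_scale[OF ce_hom_map[OF dV_lin]]]
    by (auto simp: ce_cochains_def ce_diff_def plus_fun_def)
  show "rep_diff L V n (pull2 y) = pull2 (ce_diff L V n y)" if y: "y \<in> ce_cochains L V n" for y
  proof -
    obtain f g where fg: "y = (f, g)" by fastforce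
    have "f \<in> ce_hom L (smul_m V) (n + 1)" "g \<in> ce_hom L (smul_0 V) n" using y by (simp_all add: fg ce_cochains_def)
    then show ?thesis using pull2_in[OF y]
      by (simp add: fg pull2_def rep_diff_eq m.R_D_pull z.R_D_pull ce_diff_def)
        (auto simp: pull_def fun_eq_iff lin_zero[OF dV_lin])
  qed
  fix x assume x: "x \<in> rep_cochains L V n" "rep_diff L V n x \<in> pull2 ` ce_cochains L V (n + 1)"
  obtain \<omega> \<eta> where p: "x = (\<omega>, \<eta>)" by fastforce
  have "basic (dif L) (fst (pull2 y)) \<and> basic (dif L) (snd (pull2 y))" if "y \<in> ce_cochains L V (n + 1)" for y
    using that by (auto simp: pull2_def ce_cochains_def m.pull_props z.pull_props)
  then have "basic (dif L) (fst (rep_diff L V n (\<omega>, \<eta>)))" "basic (dif L) (snd (rep_diff L V n (\<omega>, \<eta>)))"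
    using x(2) unfolding p by auto
  from relax_steps[OF x(1)[unfolded p] this, of "schedule (nat (n + 1))"] obtain z where z: "z \<in> rep_cochains L V (n - 1)"
    "(fold m.relax (schedule (nat (n + 1))) \<omega>, fold z.relax (schedule (nat (n + 1))) \<eta>) = x - rep_diff L V (n - 1) z"
    unfolding p by blast
  have x': "(homogeneous (n + 1) \<omega> \<and> m.mlin \<omega> \<and> m.ws \<omega>) \<and> (homogeneous n \<eta> \<and> z.mlin \<eta> \<and> z.ws \<eta>)"
    using x(1) by (simp add: p rep_mem)
  have "(fold m.relax (schedule (nat (n + 1))) \<omega>, fold z.relax (schedule (nat (n + 1))) \<eta>) \<in> pull2 ` ce_cochains L V n"
    by (rule pull2_image) (use x' in \<open>auto simp: rep_mem intro!: m.basic_schedule[of _ "n + 1"] z.basic_schedule[of _ n]\<close>)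
  then show "\<exists>z\<in>rep_cochains L V (n - 1). x - rep_diff L V (n - 1) z \<in> pull2 ` ce_cochains L V n"
    using z by auto
qed (simp_all add: smul_vs rep_subspace ce_subspace rep_diff_lin rep_diff_in rep_diff_rep_diff pull2_in)

definition wick2 :: "'k \<Rightarrow> ('z list \<times> 'm list \<Rightarrow> 'a) \<times> ('z list \<times> 'm list \<Rightarrow> 'b) \<Rightarrow>
    ('z list \<times> 'm list \<Rightarrow> 'a) \<times> ('z list \<times> 'm list \<Rightarrow> 'b)"
  where "wick2 c = (\<lambda>(\<omega>, \<eta>). (m.W c \<omega>, z.W c \<eta>))"

lemma wick2_lin: "lin_on S smul smul (wick2 c)"
  by (auto simp: lin_on_def wick2_def smul_apply)

lemma skew_to_rep: "x \<in> skew_cochains L V n \<Longrightarrow> wick2 (- (1 / 2)) x \<in> rep_cochains L V n"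
  using m.ws_wick[of _ 0 1 "- (1 / 2)"] z.ws_wick[of _ 0 1 "- (1 / 2)"]
  by (cases x) (auto simp: skew_mem rep_mem wick2_def)

lemma rep_to_skew: "x \<in> rep_cochains L V n \<Longrightarrow> wick2 (1 / 2) x \<in> skew_cochains L V n"
  using m.ws_wick[of _ 1 0 "1 / 2"] z.ws_wick[of _ 1 0 "1 / 2"]
  by (cases x) (auto simp: skew_mem rep_mem wick2_def)

lemma wick2_inverse:
  "x \<in> skew_cochains L V n \<Longrightarrow> wick2 (1 / 2) (wick2 (- (1 / 2)) x) = x"
  "x \<in> rep_cochains L V n \<Longrightarrow> wick2 (- (1 / 2)) (wick2 (1 / 2) x) = x"
  using m.wick_inverse[of _ "1 / 2"] z.wick_inverse[of _ "1 / 2"]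
    m.wick_inverse[of _ "- (1 / 2)"] z.wick_inverse[of _ "- (1 / 2)"]
  by (cases x; auto simp: skew_mem rep_mem wick2_def)+

lemma wick2_injective: "wick2 c x = wick2 c y \<Longrightarrow> x = y"
proof -
  assume *: "wick2 c x = wick2 c y"
  have "m.W c (fst x - fst y) = 0" "z.W c (snd x - snd y) = 0"
    using * by (auto simp: wick2_def split: prod.splits)
  then have "fst x - fst y = 0" "snd x - snd y = 0"
    using wick_injective[OF V.vs_m] wick_injective[OF V.vs_0] by blast+
  then show "x = y" by (simp add: prod_eq_iff)
qed

lemma wick2_skew_diff:
  assumes x: "x \<in> skew_cochains L V n"
  shows "wick2 (- (1 / 2)) (skew_diff L V n x) = rep_diff L V n (wick2 (- (1 / 2)) x)"
proof -
  obtain \<omega> \<eta> where p: "x = (\<omega>, \<eta>)" by fastforce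
  have x': "m.mlin \<omega>" "m.sk \<omega>" "z.mlin \<eta>" "z.sk \<eta>" using x by (simp_all add: p skew_mem)
  have "rep_diff L V n (wick2 (- (1 / 2)) x) = (m.R.D (m.W (- (1 / 2)) \<omega>),
    (\<lambda>u. smul_0 V (e n) (T (m.W (- (1 / 2)) \<omega>) u)) + z.R.D (z.W (- (1 / 2)) \<eta>))"
    using skew_to_rep[OF x] by (simp add: p wick2_def rep_diff_eq)
  also have "\<dots> = wick2 (- (1 / 2)) (skew_diff L V n x)"
    unfolding p skew_diff_eq[OF x[unfolded p]] wick2_def prod.case z.wick_simps T_wick
      m.wick_D[OF x'(1,2)] z.wick_D[OF x'(3,4)] ..
  finally show ?thesis ..
qed

text \<open>
  It is enough to compare images under \<open>wick2 (- (1 / 2))\<close>, where \<open>wick2_skew_diff\<close> applies.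
\<close>

lemma skew_diff_conj:
  assumes x: "x \<in> skew_cochains L V n"
  shows "skew_diff L V n x = wick2 (1 / 2) (rep_diff L V n (wick2 (- (1 / 2)) x))"
  by (rule wick2_injective[of "- (1 / 2)"])
    (simp only: wick2_skew_diff[OF x] wick2_inverse(2)[OF rep_diff_in[OF skew_to_rep[OF x]]])

lemma skew_embedding:
  "cochain_embedding smul (skew_cochains L V) (skew_diff L V) smul (ce_cochains L V) (ce_diff L V)
    (\<lambda>y. wick2 (1 / 2) (pull2 y))"
  by (rule cochain_embedding.transport[OF rep_embedding skew_subspace wick2_lin skew_to_rep wick2_lin rep_to_skew
        wick2_inverse skew_diff_conj])

end

theorem theorem4p4:
  fixes L :: "('k::real_normed_field, 'm::ab_group_add, 'z::ab_group_add) lie2"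
    and V :: "('k, 'm, 'z, 'a::ab_group_add, 'b::ab_group_add) lie2_rep"
  assumes "hemistrict_lie2 L"
    and "inj (dif L)"
    and "hemistrict_lie2_rep L V"
    and "\<forall>\<alpha> v. l_m0 V \<alpha> v = 0"
  shows "((\<forall>\<alpha> \<beta>. alt L (dif L \<alpha>) (dif L \<beta>) = 0) \<longrightarrow>
      cohomology_isomorphic
        (cochain_smul V) (rep_cochains L V) (rep_diff L V)
        (cochain_smul V) (ce_cochains L V) (ce_diff L V)) \<and>
    cohomology_isomorphic
      (cochain_smul V) (skew_cochains L V) (skew_diff L V)
      (cochain_smul V) (ce_cochains L V) (ce_diff L V)"
proof -
  interpret hemistrict_lie2 L by fact
  have "vector_space_pair (smul_m L) (smul_0 L)"
    using vs_m vs_0 by (simp add: vector_space_pair_def)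
  then obtain s where s: "Vector_Spaces.linear (smul_0 L) (smul_m L) s" "s \<circ> dif L = id"
    using vector_space_pair.linear_injective_left_inverse[OF _ dif_linear assms(2)] by blast
  interpret lie2_pair L V s
  proof (intro lie2_pair.intro lie2_pair_axioms.intro)
    show "lin (smul_0 L) (smul_m L) s" by (rule linear_imp_lin[OF s(1)])
    show "s (dif L \<alpha>) = \<alpha>" for \<alpha> using s(2) by (metis comp_apply id_apply)
  qed (use assms in auto)
  show ?thesis
    using cochain_embedding.cohomology_iso[OF rep_embedding] cochain_embedding.cohomology_iso[OF skew_embedding]
    by blast
qed

end
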